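(* Let $R:\mathbb{R}^n\to\mathbb{Z}^n$ be a quantizer and suppose the nonsingular matrix $L\in\mathbb{R}^{n\times n}$ of the quantized linear $(R,L)$-system, with transition operator $T=R\circ L:\mathbb{Z}^n\to\mathbb{Z}^n$, is iteratively nonresonant. Then the algebras $\mathcal{S}_{E_k}$ generated by the quantization errors $E_k$ are representable as $$\mathcal{S}_{E_k}=T^{-(k-1)}(\mathcal{Q}_1^+)\subset\mathcal{Q}_k^+\qquad\text{for all }k\in\mathbb{N},$$ and are mutually independent in the sense that for any $N\in\mathbb{N}$ and any sets $A_k\in\mathcal{S}_{E_k}$, $1\le k\le N$, $$\mathbf{F}\Big(\bigcap_{k=1}^NA_k\Big)=\prod_{k=1}^N\mathbf{F}(A_k).$$
   Context: Frequency. For $a\in\mathbb{Z}^n$ and $\ell\in\mathbb{N}^n$ let $P_{a,\ell}=\{x\in\mathbb{Z}^n:\ a_k\le x_k<a_k+\ell_k \text{ for all }1\le k\le n\}$, and for $N\in\mathbb{N}$ let $\mathcal{P}_N=\{P_{a,\ell}:\ a\in\mathbb{Z}^n,\ \ell\in\mathbb{N}^n,\ \min_k\ell_k\ge N\}$. For $A\subset\mathbb{Z}^n$ put $\mathbf{F}_*(A)=\sup_{N\ge1}\inf_{P\in\mathcal{P}_N}\frac{\#(A\cap P)}{\#P}$ and $\mathbf{F}^*(A)=\inf_{N\ge1}\sup_{P\in\mathcal{P}_N}\frac{\#(A\cap P)}{\#P}$. The set $A$ is frequency measurable if $\mathbf{F}_*(A)=\mathbf{F}^*(A)$; the common value is the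 frequency $\mathbf{F}(A)$. Distributed maps. Let $X$ be a metric space with Borel $\sigma$-algebra $\mathcal{B}$ and $D$ a countably additive probability measure on $(X,\mathcal{B})$. A map $h:\mathbb{Z}^n\to X$ is $D$-distributed if for every $B\in\mathcal{B}$ with $D(\partial B)=0$ the preimage $h^{-1}(B)$ is frequency measurable and $\mathbf{F}(h^{-1}(B))=D(B)$. In this case the algebra generated by $h$ is $\mathcal{S}_h=\{h^{-1}(B):\ B\in\mathcal{B},\ D(\partial B)=0\}$. System. A quantizer is a map $R:\mathbb{R}^n\to\mathbb{Z}^n$ such that $R(u+z)=R(u)+z$ for all $u\in\mathbb{R}^n$, $z\in\mathbb{Z}^n$, and the set $R^{-1}(0)$ is Jordan measurable (bounded with boundary of zero Lebesgue measure). The quantization errors are the maps $E_k=E\circ T^{k-1}:\mathbb{Z}^n\to R^{-1}(0)$, $k\in\mathbb{N}$, where $E(x)=Lx-T(x)$. Under the iterative nonresonance assumption each $E_k$ is $D$-distributed with $X=R^{-1}(0)$ and $D$ the restriction of the Lebesgue measure $\mathrm{mes}_n$ to $R^{-1}(0)$ (a probability measure), and $\mathcal{S}_{E_k}$ is understood accordingly. Algebras. For $m\in\mathbb{N}$, $G\subset\mathbb{R}^m$ and $\Lambda\in\mathbb{R}^{m\times n}$ let $Q_m(G,\Lambda)=\{x\in\mathbb{Z}^n:\ \Lambda x\in G+\mathbb{Z}^m\}$ and $\mathcal{Q}_m(\Lambda)=\{Q_m(G,\Lambda):\ G\subset[0,1)^m\text{ Jordan measurable}\}$. For $N\in\mathbb{N}$,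 $\mathcal{Q}_N^+=\mathcal{Q}_{Nn}(\mathcal{L}_N^+)$, where $\mathcal{L}_N^+\in\mathbb{R}^{Nn\times n}$ is obtained by stacking $L,L^2,\ldots,L^N$. For a class $\mathcal{C}$ of subsets of $\mathbb{Z}^n$, $T^{-j}(\mathcal{C})=\{T^{-j}(A): A\in\mathcal{C}\}$, with $T^{-j}(A)$ the preimage of $A$ under the $j$-th iterate of $T$. Nonresonance. $\Lambda\in\mathbb{R}^{m\times n}$ is nonresonant if the rows of $\begin{bmatrix}I_n\\ \Lambda\end{bmatrix}$ are linearly independent over the rationals. A nonsingular $L$ is iteratively nonresonant if every finite submatrix (formed from finitely many rows with distinct indices) of the infinite matrix obtained by stacking all nonzero integer powers $L^k$, $k\in\mathbb{Z}\setminus\{0\}$, is nonresonant. *)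

theory Defs
  imports "HOL-Probability.Probability"
begin

text \<open>Throughout, \<open>\<int>\<^sup>n\<close> and \<open>\<real>\<^sup>n\<close> are the types \<open>int ^ 'n\<close> and \<open>real ^ 'n\<close>, and natural
  number parameters such as \<open>k\<close> and \<open>N\<close> range over the positive integers.\<close>

definition of_int_vec :: "int ^ 'n \<Rightarrow> real ^ 'n" where
  "of_int_vec x = (\<chi> i. of_int (x $ i))"


subsection \<open>Frequency\<close>

definition int_box :: "int ^ 'n \<Rightarrow> nat ^ 'n \<Rightarrow> (int ^ 'n) set" where
  "int_box a l = {x. \<forall>k. a $ k \<le> x $ k \<and> x $ k < a $ k + int (l $ k)}"

definition int_boxes :: "nat \<Rightarrow> (int ^ 'n) set set" where
  "int_boxes N = {int_box a l | a l. \<forall>k. N \<le> l $ k}"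

definition lower_frequency :: "(int ^ 'n) set \<Rightarrow> real" where
  "lower_frequency A =
    (SUP N\<in>{1..}. INF P\<in>int_boxes N. real (card (A \<inter> P)) / real (card P))"

definition upper_frequency :: "(int ^ 'n) set \<Rightarrow> real" where
  "upper_frequency A =
    (INF N\<in>{1..}. SUP P\<in>int_boxes N. real (card (A \<inter> P)) / real (card P))"

definition frequency_measurable :: "(int ^ 'n) set \<Rightarrow> bool" where
  "frequency_measurable A \<longleftrightarrow> lower_frequency A = upper_frequency A"

text \<open>Only meaningful for frequency measurable sets.\<close>

definition frequency :: "(int ^ 'n) set \<Rightarrow> real" where
  "frequency A = lower_frequency A"


subsection \<open>Distributed maps\<close>

text \<open>The metric space is a subset \<open>X\<close> of a metric space type, with the subspace metric; the
  boundary of a subset of \<open>X\<close> is therefore its boundary relative to \<open>X\<close>.\<close>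

definition distributed_map ::
    "'a::metric_space set \<Rightarrow> 'a measure \<Rightarrow> (int ^ 'n \<Rightarrow> 'a) \<Rightarrow> bool" where
  "distributed_map X D h \<longleftrightarrow>
    prob_space D \<and> space D = X \<and> sets D = sets (restrict_space borel X) \<and>
    (\<forall>x. h x \<in> X) \<and>
    (\<forall>B\<in>sets (restrict_space borel X). measure D (top_of_set X frontier_of B) = 0 \<longrightarrow>
       frequency_measurable (h -` B) \<and> frequency (h -` B) = measure D B)"

definition generated_algebra ::
    "'a::metric_space set \<Rightarrow> 'a measure \<Rightarrow> (int ^ 'n \<Rightarrow> 'a) \<Rightarrow> (int ^ 'n) set set" where
  "generated_algebra X D h =
    {h -` B | B. B \<in> sets (restrict_space borel X) \<and> measure D (top_of_set X frontier_of B) = 0}"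

text \<open>Lebesgue measure on the Borel \<open>\<sigma>\<close>-algebra of the subspace \<open>X\<close>. A Jordan measurable \<open>X\<close> is
  Lebesgue measurable but need not be a Borel set, so \<open>restrict_space lborel X\<close> would be wrong.\<close>

definition lebesgue_borel_on :: "'a::euclidean_space set \<Rightarrow> 'a measure" where
  "lebesgue_borel_on X = measure_of X (sets (restrict_space borel X)) (emeasure lebesgue)"


subsection \<open>Quantized linear systems\<close>

definition jordan_measurable :: "'a::euclidean_space set \<Rightarrow> bool" where
  "jordan_measurable S \<longleftrightarrow> bounded S \<and> negligible (frontier S)"

definition quantizer :: "(real ^ 'n \<Rightarrow> int ^ 'n) \<Rightarrow> bool" where
  "quantizer R \<longleftrightarrow>
    (\<forall>u z. R (u + of_int_vec z) = R u + z) \<and> jordan_measurable (R -` {0})"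

definition transition :: "(real ^ 'n \<Rightarrow> int ^ 'n) \<Rightarrow> real ^ 'n ^ 'n \<Rightarrow> int ^ 'n \<Rightarrow> int ^ 'n" where
  "transition R L x = R (L *v of_int_vec x)"

definition quantization_error ::
    "(real ^ 'n \<Rightarrow> int ^ 'n) \<Rightarrow> real ^ 'n ^ 'n \<Rightarrow> nat \<Rightarrow> int ^ 'n \<Rightarrow> real ^ 'n" where
  "quantization_error R L k =
    (\<lambda>x. L *v of_int_vec x - of_int_vec (transition R L x)) \<circ> (transition R L ^^ (k - 1))"

definition error_algebra ::
    "(real ^ 'n \<Rightarrow> int ^ 'n) \<Rightarrow> real ^ 'n ^ 'n \<Rightarrow> nat \<Rightarrow> (int ^ 'n) set set" where
  "error_algebra R L k =
    generated_algebra (R -` {0}) (lebesgue_borel_on (R -` {0})) (quantization_error R L k)"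

definition mat_pow :: "real ^ 'n ^ 'n \<Rightarrow> nat \<Rightarrow> real ^ 'n ^ 'n" where
  "mat_pow A k = (((**) A) ^^ k) (mat 1)"

definition mat_zpow :: "real ^ 'n ^ 'n \<Rightarrow> int \<Rightarrow> real ^ 'n ^ 'n" where
  "mat_zpow A k =
    (if k \<ge> 0 then mat_pow A (nat k) else mat_pow (matrix_inv A) (nat (- k)))"


subsection \<open>Nonresonance and the algebras of quasiperiodic sets\<close>

text \<open>A real matrix with \<open>m\<close> rows and columns indexed by \<open>'n\<close> is a family \<open>\<Lambda> :: 'i \<Rightarrow> real ^ 'n\<close> of
  rows over a finite index set \<open>I\<close> with \<open>m\<close> elements, and \<open>\<real>\<^sup>m\<close> is the set \<open>I \<rightarrow>\<^sub>E UNIV\<close> of real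
  functions on \<open>I\<close>. A stacked matrix \<open>L, L\<^sup>2, \<dots>, L\<^sup>N\<close> has rows indexed by pairs (exponent, row),
  so that \<open>N\<close> may vary.\<close>

definition rat_independent :: "'j set \<Rightarrow> ('j \<Rightarrow> real ^ 'n) \<Rightarrow> bool" where
  "rat_independent J v \<longleftrightarrow>
    (\<forall>c :: 'j \<Rightarrow> rat. (\<Sum>j\<in>J. of_rat (c j) *\<^sub>R v j) = 0 \<longrightarrow> (\<forall>j\<in>J. c j = 0))"

definition nonresonant :: "'i set \<Rightarrow> ('i \<Rightarrow> real ^ 'n) \<Rightarrow> bool" where
  "nonresonant I \<Lambda> \<longleftrightarrow> rat_independent (UNIV <+> I) (case_sum (\<lambda>j. row j (mat 1)) \<Lambda>)"

definition iteratively_nonresonant :: "real ^ 'n ^ 'n \<Rightarrow> bool" where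
  "iteratively_nonresonant L \<longleftrightarrow>
    (\<forall>I. finite I \<and> I \<subseteq> (- {0}) \<times> UNIV \<longrightarrow> nonresonant I (\<lambda>(k, i). row i (mat_zpow L k)))"

text \<open>Jordan measurable subsets of \<open>\<real>\<^sup>I\<close> for a finite index set \<open>I\<close>. The boundary is closed, hence
  Borel, so that null sets of the product of the (uncompleted) Lebesgue measures suffice.\<close>

definition jordan_measurable_in :: "'i set \<Rightarrow> ('i \<Rightarrow> real) set \<Rightarrow> bool" where
  "jordan_measurable_in I G \<longleftrightarrow>
    G \<subseteq> (I \<rightarrow>\<^sub>E UNIV) \<and> (\<exists>c. \<forall>u\<in>G. \<forall>i\<in>I. \<bar>u i\<bar> \<le> c) \<and>
    product_topology (\<lambda>_. euclideanreal) I frontier_of G \<in> null_sets (Pi\<^sub>M I (\<lambda>_. lborel))"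

definition quasiperiodic_set ::
    "'i set \<Rightarrow> ('i \<Rightarrow> real) set \<Rightarrow> ('i \<Rightarrow> real ^ 'n) \<Rightarrow> (int ^ 'n) set" where
  "quasiperiodic_set I G \<Lambda> =
    {x. \<exists>g\<in>G. \<exists>z :: 'i \<Rightarrow> int. \<forall>i\<in>I. \<Lambda> i \<bullet> of_int_vec x = g i + of_int (z i)}"

definition quasiperiodic_algebra :: "'i set \<Rightarrow> ('i \<Rightarrow> real ^ 'n) \<Rightarrow> (int ^ 'n) set set" where
  "quasiperiodic_algebra I \<Lambda> =
    {quasiperiodic_set I G \<Lambda> | G. G \<subseteq> (I \<rightarrow>\<^sub>E {0..<1}) \<and> jordan_measurable_in I G}"

definition forward_algebra :: "real ^ 'n ^ 'n \<Rightarrow> nat \<Rightarrow> (int ^ 'n) set set" where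
  "forward_algebra L N =
    quasiperiodic_algebra ({1..N} \<times> UNIV) (\<lambda>(k, i). row i (mat_pow L k))"

end

theory Submission
  imports Defs
begin

text \<open>Write \<open>S u = u - R u\<close>, so that \<open>E\<^sub>k = S \<circ> y\<^sub>k\<close> with \<open>y\<^sub>k = L T\<^sup>k\<^sup>-\<^sup>1\<close>. Modulo integer vectors
  \<open>y\<^sub>k\<close> equals \<open>L\<^sup>k x\<close> minus a linear combination of \<open>E\<^sub>1 x, \<dots>, E\<^sub>k\<^sub>-\<^sub>1 x\<close>. Hence a character of
  \<open>y\<^sub>k\<close> is a character of \<open>L\<^sup>k x\<close> times a function \<open>f\<close> of the earlier errors. By induction \<open>f\<close> is
  approximable, in the mean over large boxes, by trigonometric polynomials with frequencies in the
  integer span of the rows of \<open>L, \<dots>, L\<^sup>k\<^sup>-\<^sup>1\<close>; nonresonance then makes the mean of the product vanish.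
  So \<open>y\<^sub>k\<close> is equidistributed on the torus and independent of the earlier errors, and \<open>S\<close>, which is
  continuous off a null set, carries Lebesgue measure on the torus to Lebesgue measure on \<open>R\<^sup>-\<^sup>1(0)\<close>.

  For the inclusion in the algebra \<open>Q\<^sub>k\<^sup>+\<close>, \<open>E\<^sub>k\<close> is a function of \<open>(L x, \<dots>, L\<^sup>k x)\<close> on the torus whose jumps lie in
  countably many preimages of null sets under affine maps onto \<open>\<real>\<^sup>n\<close>, one for each
  integer vector that the orbit may visit.\<close>

subsection \<open>Means over boxes\<close>

text \<open>But the error of such an approximation is itself an average along the orbit. The way
  out: a periodic function that is continuous off a closed null set gets, besides an approximating
  polynomial, a trigonometric majorant of the error with small integral
  (\<open>trig_sandwich\<close>). The mean of this majorant along y_k is known once the characters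
  of y_k have the right means, and these involve only the errors before the k-th. The characters of
  the errors that arise have real frequencies, because \<open>m v* L\<close> is not an integer
  vector; hence the induction statement \<open>orbit_periodic\<close> quantifies over all real
  \<open>c\<close>. The cell of the quantizer is Jordan measurable but perhaps not Borel. Integrands
  are therefore replaced by Borel functions equal to them off a closed null set, and the error
  algebras are described by \<open>negligible (frontier B)\<close> with the frontier in the full
  space.\<close>

definition box_filter :: "(int ^ 'n) set filter" where
  "box_filter = (INF N\<in>{1..}. principal (int_boxes N))"

definition box_avg :: "(int ^ 'n \<Rightarrow> 'a::real_normed_vector) \<Rightarrow> (int ^ 'n) set \<Rightarrow> 'a" where
  "box_avg f P = (\<Sum>x\<in>P. f x) /\<^sub>R real (card P)"

lemma int_boxes_antimono: "M \<le> N \<Longrightarrow> int_boxes N \<subseteq> int_boxes M"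
  unfolding int_boxes_def using order_trans by blast

text \<open>\<open>int_boxes N\<close> shrinks as \<open>N\<close> grows, so the infimum of the
  principal filters is decided by a single \<open>N\<close>. The corner of the box does not enter:
  limits along this filter are uniform over all positions, as the frequency demands.\<close>

lemma eventually_box_filter:
  "eventually Q box_filter \<longleftrightarrow> (\<exists>N\<ge>1. \<forall>P\<in>int_boxes N. Q P)"
proof -
  have "eventually Q box_filter \<longleftrightarrow> (\<exists>N\<in>{1..}. eventually Q (principal (int_boxes N)))"
    unfolding box_filter_def
  proof (rule eventually_INF_base)
    fix a b :: nat assume "a \<in> {1..}" "b \<in> {1..}"
    then show "\<exists>x\<in>{1..}. principal (int_boxes x :: (int ^ 'a) set set) \<le> inf (principal (int_boxes a)) (principal (int_boxes b))"
      by (intro bexI[of _ "max a b"]) (simp_all add: int_boxes_antimono)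
  qed auto
  then show ?thesis
    by (auto simp: eventually_principal)
qed

lemma int_boxes_nonempty: "int_boxes N \<noteq> {}"
  unfolding int_boxes_def by (auto intro!: exI[of _ "\<chi> i. N"])

text \<open>Distributivity over a box. With constant factors it counts the box, with characters it
  splits their sum into one geometric sum per coordinate.\<close>

lemma sum_int_box_prod:
  fixes g :: "'n::finite \<Rightarrow> int \<Rightarrow> 'a::comm_semiring_1"
  shows "(\<Sum>x\<in>int_box a l. \<Prod>k\<in>UNIV. g k (x $ k)) = (\<Prod>k\<in>UNIV. \<Sum>t\<in>{a $ k..<a $ k + int (l $ k)}. g k t)"
proof -
  have "(\<Prod>k\<in>UNIV. \<Sum>t\<in>{a $ k..<a $ k + int (l $ k)}. g k t)
      = (\<Sum>h\<in>(\<Pi>\<^sub>E k\<in>UNIV. {a $ k..<a $ k + int (l $ k)}). \<Prod>k\<in>UNIV. g k (h k))"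
    by (rule prod_sum_PiE) auto
  also have "\<dots> = (\<Sum>x\<in>int_box a l. \<Prod>k\<in>UNIV. g k (x $ k))"
    by (rule sum.reindex_bij_witness[of _ "\<lambda>x. vec_nth x" "\<lambda>h. vec_lambda h"])
       (auto simp: int_box_def PiE_iff)
  finally show ?thesis ..
qed

lemma finite_int_box [simp]: "finite (int_box a l)"
proof -
  have "int_box a l \<subseteq> vec_lambda ` (\<Pi>\<^sub>E k\<in>UNIV. {a $ k..<a $ k + int (l $ k)})"
  proof
    fix x assume "x \<in> int_box a l"
    then show "x \<in> vec_lambda ` (\<Pi>\<^sub>E k\<in>UNIV. {a $ k..<a $ k + int (l $ k)})"
      by (intro image_eqI[of _ _ "vec_nth x"]) (auto simp: int_box_def PiE_iff)
  qed
  then show ?thesis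
    by (rule finite_subset) (auto intro!: finite_PiE)
qed

lemma card_int_box: "card (int_box a l) = (\<Prod>k\<in>UNIV. l $ k)"
  using sum_int_box_prod[of "\<lambda>_ _. 1::nat" a l] by simp

lemma int_boxes_finite: "P \<in> int_boxes N \<Longrightarrow> finite P"
  unfolding int_boxes_def by auto

lemma int_boxes_card_pos:
  assumes "N \<ge> 1" "P \<in> int_boxes N"
  shows "card P > 0"
proof -
  obtain a l where P: "P = int_box a l" "\<And>k. N \<le> l $ k"
    using assms(2) unfolding int_boxes_def by auto
  have "l $ k \<noteq> 0" for k
    using P(2)[of k] assms(1) by linarith
  then show ?thesis
    unfolding P(1) card_int_box by (intro prod_pos) auto
qed

lemma eventually_box_filter_finite: "eventually (\<lambda>P. finite P \<and> card P > 0) box_filter"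
  unfolding eventually_box_filter
  using int_boxes_finite int_boxes_card_pos by (intro exI[of _ 1]) auto

lemma box_avg_add: "box_avg (\<lambda>x. f x + g x) P = box_avg f P + box_avg g P"
  by (simp add: box_avg_def sum.distrib scaleR_right_distrib)

lemma box_avg_diff: "box_avg (\<lambda>x. f x - g x) P = box_avg f P - box_avg g P"
  by (simp add: box_avg_def sum_subtractf scaleR_right_diff_distrib)

lemma box_avg_mult_left: "box_avg (\<lambda>x. c * f x) P = c * box_avg f P" for c :: "'a::real_normed_algebra"
  by (simp add: box_avg_def sum_distrib_left)

lemma norm_box_avg_le: "norm (box_avg f P) \<le> box_avg (\<lambda>x. norm (f x)) P"
  by (simp add: box_avg_def mult_left_mono norm_sum)

lemma box_avg_mono:
  fixes f :: "int ^ 'n \<Rightarrow> real"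
  shows "(\<And>x. f x \<le> g x) \<Longrightarrow> box_avg f P \<le> box_avg g P"
  by (simp add: box_avg_def mult_left_mono sum_mono)

lemma box_avg_const: "finite P \<Longrightarrow> card P > 0 \<Longrightarrow> box_avg (\<lambda>_. c) P = c"
  by (simp add: box_avg_def sum_constant_scaleR card_gt_0_iff)

lemma box_avg_Re: "box_avg (\<lambda>x. Re (f x)) P = Re (box_avg f P)"
  by (simp add: box_avg_def)

lemma tendsto_box_avg_const: "(box_avg (\<lambda>_. c) \<longlongrightarrow> c) box_filter"
  by (rule tendsto_eventually)
     (use eventually_box_filter_finite in eventually_elim, simp add: box_avg_const)

text \<open>Uniform convergence puts every quotient over \<open>int_boxes M\<close> within
  \<open>e\<close> of \<open>c\<close>, which bounds the infimum from below and the supremum from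
  above. The opposite bounds hold for every \<open>N\<close>, since a box with all sides at least
  \<open>max M N\<close> belongs to both families.\<close>

lemma frequency_of_mean:
  fixes A :: "(int ^ 'n) set"
  assumes lim: "(box_avg (\<lambda>x. of_bool (x \<in> A) :: real) \<longlongrightarrow> c) box_filter"
  shows "frequency_measurable A" "frequency A = c"
proof -
  define q where "q = (\<lambda>P::(int ^ 'n) set. real (card (A \<inter> P)) / real (card P))"
  have q_eq: "q P = box_avg (\<lambda>x. of_bool (x \<in> A)) P" if "finite P" for P
  proof -
    have "(\<Sum>x\<in>P. of_bool (x \<in> A) :: real) = real (card (A \<inter> P))"
      using that by (simp add: Int_commute sum.If_cases of_bool_def Int_def)
    then show ?thesis by (simp add: q_def box_avg_def divide_inverse mult.commute)
  qed
  have q01: "0 \<le> q P" "q P \<le> 1" if "finite P" for P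
  proof -
    show "0 \<le> q P" by (simp add: q_def)
    show "q P \<le> 1"
      using card_mono[OF that Int_lower2[of A P]] by (simp add: q_def divide_le_eq)
  qed
  \<comment> \<open>Suprema of reals need bounds. For \<open>N = 0\<close> empty boxes occur, and
    their quotient is 0 / 0 = 0, still within [0, 1].\<close>
  have bdd: "bdd_below (q ` int_boxes N)" "bdd_above (q ` int_boxes N)" for N
    using q01[OF int_boxes_finite] by (auto intro!: bdd_belowI2[of _ 0] bdd_aboveI2[of _ _ 1])
  have close: "\<exists>M\<ge>1. \<forall>P\<in>int_boxes M. \<bar>q P - c\<bar> \<le> e" if "e > 0" for e
  proof -
    have "\<forall>\<^sub>F P in box_filter. \<bar>q P - c\<bar> \<le> e"
      using tendstoD[OF lim that] eventually_box_filter_finite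
      by eventually_elim (simp add: q_eq dist_real_def)
    then show ?thesis
      by (simp only: eventually_box_filter)
  qed
  have inf_le: "(INF P\<in>int_boxes N. q P) \<le> c" for N
  proof (rule field_le_epsilon)
    fix e :: real assume "e > 0"
    then obtain M where M: "M \<ge> 1" "\<forall>P\<in>int_boxes M. \<bar>q P - c\<bar> \<le> e" using close by blast
    obtain P :: "(int ^ 'n) set" where P: "P \<in> int_boxes (max M N)" using int_boxes_nonempty by blast
    have "P \<in> int_boxes N" "P \<in> int_boxes M"
      using P int_boxes_antimono[of N "max M N"] int_boxes_antimono[of M "max M N"] by auto
    then show "(INF P\<in>int_boxes N. q P) \<le> c + e"
      using cINF_lower[OF bdd(1), of P N] M(2) by force
  qed
  have sup_ge: "c \<le> (SUP P\<in>int_boxes N. q P)" for N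
  proof (rule field_le_epsilon)
    fix e :: real assume "e > 0"
    then obtain M where M: "M \<ge> 1" "\<forall>P\<in>int_boxes M. \<bar>q P - c\<bar> \<le> e" using close by blast
    obtain P :: "(int ^ 'n) set" where P: "P \<in> int_boxes (max M N)" using int_boxes_nonempty by blast
    have "P \<in> int_boxes N" "P \<in> int_boxes M"
      using P int_boxes_antimono[of N "max M N"] int_boxes_antimono[of M "max M N"] by auto
    then show "c \<le> (SUP P\<in>int_boxes N. q P) + e"
      using cSUP_upper[OF _ bdd(2), of P N] M(2) by force
  qed
  have "lower_frequency A = c"
  proof (rule antisym)
    show "lower_frequency A \<le> c"
      unfolding lower_frequency_def q_def[symmetric] using inf_le by (intro cSUP_least) (auto simp: q_def)
    show "c \<le> lower_frequency A"
    proof (rule field_le_epsilon)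
      fix e :: real assume "e > 0"
      then obtain M where M: "M \<ge> 1" "\<forall>P\<in>int_boxes M. \<bar>q P - c\<bar> \<le> e" using close by blast
      have "c - e \<le> (INF P\<in>int_boxes M. q P)"
        using M(2) int_boxes_nonempty by (intro cINF_greatest) force+
      also have "\<dots> \<le> (SUP N\<in>{1..}. INF P\<in>int_boxes N. q P)"
        using M(1) inf_le by (intro cSUP_upper bdd_aboveI2[of _ _ c]) auto
      finally show "c \<le> lower_frequency A + e"
        by (simp add: lower_frequency_def q_def)
    qed
  qed
  moreover have "upper_frequency A = c"
  proof (rule antisym)
    show "c \<le> upper_frequency A"
      unfolding upper_frequency_def q_def[symmetric] using sup_ge by (intro cINF_greatest) (auto simp: q_def)
    show "upper_frequency A \<le> c"
    proof (rule field_le_epsilon)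
      fix e :: real assume "e > 0"
      then obtain M where M: "M \<ge> 1" "\<forall>P\<in>int_boxes M. \<bar>q P - c\<bar> \<le> e" using close by blast
      have "(INF N\<in>{1..}. SUP P\<in>int_boxes N. q P) \<le> (SUP P\<in>int_boxes M. q P)"
        using M(1) sup_ge by (intro cINF_lower bdd_belowI2[of _ c]) auto
      also have "\<dots> \<le> c + e"
        using M(2) int_boxes_nonempty by (intro cSUP_least) force+
      finally show "upper_frequency A \<le> c + e"
        by (simp add: upper_frequency_def q_def)
    qed
  qed
  ultimately show "frequency_measurable A" "frequency A = c"
    by (simp_all add: frequency_measurable_def frequency_def)
qed

section \<open>Characters of the circle and their means over boxes\<close>

definition circ :: "real \<Rightarrow> complex" where
  "circ t = cis (2 * pi * t)"

lemma norm_circ [simp]: "norm (circ t) = 1"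
  by (simp add: circ_def)

lemma circ_0 [simp]: "circ 0 = 1"
  by (simp add: circ_def)

lemma circ_add: "circ (s + t) = circ s * circ t"
  by (simp add: circ_def cis_mult distrib_left)

lemma circ_eq_1_iff: "circ t = 1 \<longleftrightarrow> t \<in> \<int>"
proof
  assume "circ t = 1"
  then have "cos (2 * pi * t) = 1" unfolding circ_def by (simp add: complex_eq_iff)
  then obtain m :: int where "2 * pi * t = of_int m * 2 * pi"
    by (auto simp: cos_one_2pi_int)
  then have "t = of_int m" by simp
  then show "t \<in> \<int>" by simp
next
  assume "t \<in> \<int>"
  then show "circ t = 1" by (auto elim!: Ints_cases simp: circ_def cis_multiple_2pi)
qed

lemma circ_add_int: "s - t \<in> \<int> \<Longrightarrow> circ s = circ t"
  using circ_add[of t "s - t"] circ_eq_1_iff by simp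

lemma circ_sum: "circ (sum f A) = (\<Prod>i\<in>A. circ (f i))"
  by (induction A rule: infinite_finite_induct) (auto simp: circ_add)

text \<open>A geometric sum: multiplication by \<open>circ t - 1\<close> telescopes it to two terms
  of modulus 1, so the bound is independent of the length and the starting point.\<close>

lemma norm_sum_circ_le:
  assumes "t \<notin> \<int>"
  shows "norm (\<Sum>x\<in>{a..<a + int l}. circ (t * of_int x)) \<le> 2 / norm (circ t - 1)"
proof -
  have ne: "circ t - 1 \<noteq> 0" using assms circ_eq_1_iff by auto
  have tele: "(circ t - 1) * (\<Sum>x\<in>{a..<a + int l}. circ (t * of_int x)) = circ (t * of_int (a + int l)) - circ (t * of_int a)"
  proof (induction l)
    case (Suc l)
    have "{a..<a + int (Suc l)} = insert (a + int l) {a..<a + int l}" by auto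
    then have "(circ t - 1) * (\<Sum>x\<in>{a..<a + int (Suc l)}. circ (t * of_int x))
       = (circ t - 1) * circ (t * of_int (a + int l)) + (circ (t * of_int (a + int l)) - circ (t * of_int a))"
      using Suc by (simp add: distrib_left)
    also have "\<dots> = circ (t * of_int (a + int (Suc l))) - circ (t * of_int a)"
      by (simp add: algebra_simps flip: circ_add)
    finally show ?case .
  qed simp
  have "norm (circ t - 1) * norm (\<Sum>x\<in>{a..<a + int l}. circ (t * of_int x)) \<le> 1 + 1"
    unfolding norm_mult[symmetric] tele by (rule order_trans[OF norm_triangle_ineq4]) simp
  then show ?thesis using ne by (simp add: field_simps)
qed

text \<open>The mean factors over the coordinates. The \<open>j\<close>-th sum is bounded by the
  constant \<open>K\<close>, each other one by its number of terms, so the mean is at most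
  \<open>K / N\<close> on every box with sides at least \<open>N\<close>.\<close>

lemma tendsto_box_avg_circ:
  fixes \<theta> :: "real ^ 'n"
  assumes "\<theta> $ j \<notin> \<int>"
  shows "(box_avg (\<lambda>x. circ (\<theta> \<bullet> of_int_vec x)) \<longlongrightarrow> 0) box_filter"
proof -
  define K where "K = 2 / norm (circ (\<theta> $ j) - 1)"
  have K0: "K \<ge> 0" by (simp add: K_def)
  have bound: "norm (box_avg (\<lambda>x. circ (\<theta> \<bullet> of_int_vec x)) P) \<le> K / real N"
    if N: "N \<ge> 1" "P \<in> int_boxes N" for N P
  proof -
    obtain a l where P: "P = int_box a l" "\<And>k. N \<le> l $ k"
      using N(2) unfolding int_boxes_def by auto
    have lpos: "l $ k > 0" for k using P(2)[of k] N(1) by linarith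
    have "(\<Sum>x\<in>P. circ (\<theta> \<bullet> of_int_vec x)) = (\<Sum>x\<in>int_box a l. \<Prod>k\<in>UNIV. circ (\<theta> $ k * of_int (x $ k)))"
      by (simp add: P(1) inner_vec_def circ_sum of_int_vec_def)
    also have "\<dots> = (\<Prod>k\<in>UNIV. \<Sum>t\<in>{a $ k..<a $ k + int (l $ k)}. circ (\<theta> $ k * of_int t))"
      by (rule sum_int_box_prod)
    finally have "norm (\<Sum>x\<in>P. circ (\<theta> \<bullet> of_int_vec x))
       = (\<Prod>k\<in>UNIV. norm (\<Sum>t\<in>{a $ k..<a $ k + int (l $ k)}. circ (\<theta> $ k * of_int t)))"
      by (simp add: prod_norm)
    also have "\<dots> \<le> (\<Prod>k\<in>UNIV. if k = j then K else real (l $ k))"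
    proof (rule prod_mono, intro conjI)
      fix k
      show "norm (\<Sum>t\<in>{a $ k..<a $ k + int (l $ k)}. circ (\<theta> $ k * of_int t)) \<le> (if k = j then K else real (l $ k))"
        using norm_sum_circ_le[OF assms] sum_norm_le[of "{a $ k..<a $ k + int (l $ k)}" "\<lambda>t. circ (\<theta> $ k * of_int t)" "\<lambda>_. 1"]
        by (auto simp: K_def)
    qed simp
    also have "\<dots> = K * (\<Prod>k\<in>UNIV - {j}. real (l $ k))"
      by (subst prod.remove[of _ j]) auto
    finally have "norm (\<Sum>x\<in>P. circ (\<theta> \<bullet> of_int_vec x)) \<le> K * (\<Prod>k\<in>UNIV - {j}. real (l $ k))" .
    moreover have card: "real (card P) = real (l $ j) * (\<Prod>k\<in>UNIV - {j}. real (l $ k))"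
      by (simp add: P(1) card_int_box prod.remove[of UNIV j])
    ultimately have "norm (box_avg (\<lambda>x. circ (\<theta> \<bullet> of_int_vec x)) P) \<le> K / real (l $ j)"
    proof -
      have pos: "(\<Prod>k\<in>UNIV - {j}. real (l $ k)) > 0" using lpos by (intro prod_pos) auto
      assume "norm (\<Sum>x\<in>P. circ (\<theta> \<bullet> of_int_vec x)) \<le> K * (\<Prod>k\<in>UNIV - {j}. real (l $ k))"
      then have "norm (\<Sum>x\<in>P. circ (\<theta> \<bullet> of_int_vec x)) / real (card P) \<le> K * (\<Prod>k\<in>UNIV - {j}. real (l $ k)) / real (card P)"
        by (intro divide_right_mono) auto
      moreover have "K * (\<Prod>k\<in>UNIV - {j}. real (l $ k)) / real (card P) = K / real (l $ j)"
        using less_imp_neq[OF pos] by (simp add: card del: prod_zero_iff)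
      moreover have "norm (box_avg (\<lambda>x. circ (\<theta> \<bullet> of_int_vec x)) P) = norm (\<Sum>x\<in>P. circ (\<theta> \<bullet> of_int_vec x)) / real (card P)"
        by (simp add: box_avg_def divide_inverse mult.commute)
      ultimately show ?thesis by linarith
    qed
    also have "\<dots> \<le> K / real N"
      using P(2)[of j] N(1) K0 by (intro divide_left_mono) (auto simp: lpos)
    finally show ?thesis .
  qed
  show ?thesis
  proof (rule tendstoI)
    fix e :: real assume e: "e > 0"
    obtain N :: nat where N: "N > K / e" using reals_Archimedean2 by blast
    then have "N \<ge> 1" using K0 e
      by (cases N) (auto simp: divide_less_0_iff)
    moreover have "K / real N < e" using N e \<open>N \<ge> 1\<close> by (simp add: field_simps)
    ultimately show "\<forall>\<^sub>F P in box_filter. dist (box_avg (\<lambda>x. circ (\<theta> \<bullet> of_int_vec x)) P) 0 < e"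
      unfolding eventually_box_filter using bound[of N] by (intro exI[of _ N]) force
  qed
qed

subsection \<open>Trigonometric polynomials\<close>

lemma of_int_vec_add: "of_int_vec (x + y) = of_int_vec x + of_int_vec y"
  by (simp add: of_int_vec_def vec_eq_iff)

lemma of_int_vec_diff: "of_int_vec (x - y) = of_int_vec x - of_int_vec y"
  by (simp add: of_int_vec_def vec_eq_iff)

lemma of_int_vec_minus: "of_int_vec (- x) = - of_int_vec x"
  by (simp add: of_int_vec_def vec_eq_iff)

lemma of_int_vec_0 [simp]: "of_int_vec 0 = 0"
  by (simp add: of_int_vec_def vec_eq_iff)

lemma of_int_vec_nth [simp]: "of_int_vec x $ i = of_int (x $ i)"
  by (simp add: of_int_vec_def)

lemma inner_of_int_vec_Ints: "of_int_vec x \<bullet> of_int_vec y \<in> \<int>"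
  by (auto simp: inner_vec_def intro!: Ints_sum)

definition lattice_periodic :: "(real ^ 'n \<Rightarrow> 'b) \<Rightarrow> bool" where
  "lattice_periodic f \<longleftrightarrow> (\<forall>u z. f (u + of_int_vec z) = f u)"

inductive trig_poly :: "(real ^ 'n \<Rightarrow> complex) \<Rightarrow> bool" where
  trig_poly_circ: "trig_poly (\<lambda>u. circ (of_int_vec m \<bullet> u))"
| trig_poly_cmult: "trig_poly p \<Longrightarrow> trig_poly (\<lambda>u. c * p u)"
| trig_poly_add: "trig_poly p \<Longrightarrow> trig_poly q \<Longrightarrow> trig_poly (\<lambda>u. p u + q u)"

lemma trig_poly_const: "trig_poly (\<lambda>u. c)"
  using trig_poly_cmult[OF trig_poly_circ[of 0], of c] by simp

lemma trig_poly_mult: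
  assumes "trig_poly p" "trig_poly q"
  shows "trig_poly (\<lambda>u. p u * q u)"
  using assms
proof (induction arbitrary: q)
  case (trig_poly_circ m)
  from \<open>trig_poly q\<close> show ?case
  proof induction
    case (trig_poly_circ m')
    show ?case using trig_poly.trig_poly_circ[of "m + m'"]
      by (simp add: of_int_vec_add inner_left_distrib circ_add)
  next
    case (trig_poly_cmult p c)
    then show ?case using trig_poly.trig_poly_cmult[of _ c] by (simp add: mult.left_commute)
  next
    case (trig_poly_add p q)
    then show ?case using trig_poly.trig_poly_add by (simp add: distrib_left)
  qed
next
  case (trig_poly_cmult p c)
  show ?case
    using trig_poly.trig_poly_cmult[OF trig_poly_cmult.IH[OF trig_poly_cmult.prems], of c] by (simp add: mult.assoc)
next
  case (trig_poly_add p p')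
  show ?case
    using trig_poly.trig_poly_add[OF trig_poly_add.IH(1)[OF trig_poly_add.prems] trig_poly_add.IH(2)[OF trig_poly_add.prems]]
    by (simp add: distrib_right)
qed

lemma circ_periodic: "lattice_periodic (\<lambda>u. circ (of_int_vec m \<bullet> u))"
  unfolding lattice_periodic_def
  by (intro allI circ_add_int) (simp add: inner_right_distrib inner_of_int_vec_Ints)

lemma continuous_on_circ [continuous_intros]: "continuous_on A f \<Longrightarrow> continuous_on A (\<lambda>x. circ (f x))"
  unfolding circ_def by (intro continuous_intros)

lemma trig_poly_continuous: "trig_poly p \<Longrightarrow> continuous_on A p"
  by (induction rule: trig_poly.induct) (intro continuous_intros; assumption)+

lemma trig_poly_bounded: "trig_poly p \<Longrightarrow> \<exists>K. \<forall>u. norm (p u) \<le> K"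
proof (induction rule: trig_poly.induct)
  case (trig_poly_cmult p c)
  then show ?case by (metis mult_left_mono norm_ge_zero norm_mult)
next
  case (trig_poly_add p q)
  then show ?case by (metis add_mono norm_triangle_le)
qed auto

section \<open>The torus as a compact set and the density of trigonometric polynomials\<close>

definition torus :: "(complex ^ 'n) set" where
  "torus = {w. \<forall>i. norm (w $ i) = 1}"

definition to_torus :: "real ^ 'n \<Rightarrow> complex ^ 'n" where
  "to_torus u = (\<chi> i. circ (u $ i))"

lemma to_torus_in: "to_torus u \<in> torus"
  by (simp add: to_torus_def torus_def)

lemma to_torus_surj:
  assumes "w \<in> torus"
  obtains u where "u \<in> cbox 0 1" "to_torus u = w"
proof -
  have "\<exists>t. 0 \<le> t \<and> t \<le> 1 \<and> circ t = w $ i" for i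
  proof -
    have "norm (w $ i) = 1" using assms by (simp add: torus_def)
    then have "cis (Arg2pi (w $ i)) = w $ i"
      using complex_norm_eq_1_exp by (simp add: cis_conv_exp)
    then have "0 \<le> Arg2pi (w $ i) / (2 * pi)" "Arg2pi (w $ i) / (2 * pi) \<le> 1" "circ (Arg2pi (w $ i) / (2 * pi)) = w $ i"
      using Arg2pi[of "w $ i"] by (simp_all add: circ_def)
    then show ?thesis by blast
  qed
  then obtain t where t: "\<forall>i. 0 \<le> t i \<and> t i \<le> 1 \<and> circ (t i) = w $ i"
    using choice[of "\<lambda>i t. 0 \<le> t \<and> t \<le> 1 \<and> circ t = w $ i"] by blast
  show thesis
  proof (rule that[of "vec_lambda t"])
    show "vec_lambda t \<in> cbox 0 1" using t by (simp add: mem_box_cart)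
    show "to_torus (vec_lambda t) = w" using t by (simp add: to_torus_def vec_eq_iff)
  qed
qed

lemma to_torus_eqD:
  assumes "to_torus u = to_torus v"
  obtains z where "u = v + of_int_vec z"
proof -
  have "\<exists>z. u $ i - v $ i = of_int z" for i
  proof -
    have "circ (u $ i) = circ (v $ i)" using assms by (simp add: to_torus_def vec_eq_iff)
    then have "circ (u $ i - v $ i) = 1"
      using circ_add[of "u $ i - v $ i" "v $ i"] norm_circ[of "v $ i"] by (metis diff_add_cancel mult_cancel_right1 norm_eq_zero zero_neq_one)
    then show ?thesis by (auto simp: circ_eq_1_iff elim: Ints_cases)
  qed
  then obtain z where "\<And>i. u $ i - v $ i = of_int (z i)" by metis
  then show thesis
    by (intro that[of "vec_lambda z"]) (simp add: vec_eq_iff algebra_simps)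
qed

lemma compact_torus: "compact torus"
proof -
  have "to_torus ` cbox 0 1 = torus"
    using to_torus_in to_torus_surj by (metis (no_types, opaque_lifting) image_iff subsetI subset_antisym)
  moreover have "continuous_on (cbox 0 1) to_torus"
    unfolding to_torus_def by (intro continuous_intros)
  ultimately show ?thesis
    by (metis compact_cbox compact_continuous_image)
qed

text \<open>Stone-Weierstrass on \<open>torus\<close>. The ring consists of the continuous real
  functions whose pullback along \<open>to_torus\<close> is a trigonometric polynomial; the real and
  imaginary parts of the coordinates lie in it and separate points.\<close>

lemma trig_poly_dense_real:
  fixes f :: "real ^ 'n \<Rightarrow> real"
  assumes per: "lattice_periodic f" and cont: "continuous_on UNIV f" and "e > 0"
  shows "\<exists>p. trig_poly p \<and> (\<forall>u. norm (of_real (f u) - p u) < e)"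
proof -
  define R where "R = {g :: complex ^ 'n \<Rightarrow> real. continuous_on torus g \<and> trig_poly (\<lambda>u. of_real (g (to_torus u)))}"
  have coord: "(\<lambda>w. Re (w $ i)) \<in> R" "(\<lambda>w. Im (w $ i)) \<in> R" for i
  proof -
    define m :: "int ^ 'n" where "m = (\<chi> j. if j = i then 1 else 0)"
    have m: "of_int_vec m \<bullet> u = u $ i" for u :: "real ^ 'n"
      by (simp add: inner_vec_def m_def if_distrib[of of_int] if_distribR if_distrib[of "\<lambda>x. x * _"] cong: if_cong)
    have mm: "of_int_vec (- m) \<bullet> u = - u $ i" for u :: "real ^ 'n"
      using m[of u] by (metis add.inverse_inverse minus_unique of_int_vec_0 of_int_vec_add inner_minus_left right_minus)
    have re: "complex_of_real (Re (circ t)) = (1/2) * circ t + (1/2) * circ (- t)" for t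
      by (simp add: complex_eq_iff circ_def)
    have im: "complex_of_real (Im (circ t)) = (1/(2*\<i>)) * circ t + (- 1/(2*\<i>)) * circ (- t)" for t
      by (simp add: complex_eq_iff circ_def Re_divide Im_divide)
    have tp: "trig_poly (\<lambda>u. a * circ (u $ i) + b * circ (- u $ i))" for a b
      using trig_poly_add[OF trig_poly_cmult[OF trig_poly_circ[of m], of a] trig_poly_cmult[OF trig_poly_circ[of "- m"], of b]]
      by (simp add: m mm)
    show "(\<lambda>w. Re (w $ i)) \<in> R"
      using tp[of "1/2" "1/2"] unfolding R_def by (auto simp: to_torus_def re intro!: continuous_intros)
    show "(\<lambda>w. Im (w $ i)) \<in> R"
      using tp[of "1/(2*\<i>)" "-1/(2*\<i>)"] unfolding R_def
      by (auto simp: to_torus_def im simp del: mult_minus_left intro!: continuous_intros)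
  qed
  interpret function_ring_on R torus
  proof
    show "compact torus" by (rule compact_torus)
    fix x y :: "complex ^ 'n" assume "x \<in> torus" "y \<in> torus" "x \<noteq> y"
    then obtain i where "Re (x $ i) \<noteq> Re (y $ i) \<or> Im (x $ i) \<noteq> Im (y $ i)"
      by (metis complex_eqI vec_eq_iff)
    then show "\<exists>g\<in>R. g x \<noteq> g y"
      using bexI[OF _ coord(1)[of i], of "\<lambda>g. g x \<noteq> g y"] bexI[OF _ coord(2)[of i], of "\<lambda>g. g x \<noteq> g y"] by argo
  qed (auto simp: R_def intro!: continuous_intros trig_poly_add trig_poly_mult trig_poly_const)
  \<comment> \<open>\<open>f\<close> descended to the torus. The choice of the preimage is harmless,
    because two preimages differ by an integer vector.\<close>
  define g where "g = (\<lambda>w. f (SOME u. to_torus u = w))"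
  have g: "g (to_torus u) = f u" for u
  proof -
    have "to_torus (SOME v. to_torus v = to_torus u) = to_torus u" by (rule someI) simp
    then obtain z where "(SOME v. to_torus v = to_torus u) = u + of_int_vec z" by (rule to_torus_eqD)
    then show ?thesis using per by (simp add: g_def lattice_periodic_def)
  qed
  \<comment> \<open>Continuity of \<open>g\<close> cannot be read off its definition by choice. A
    continuous map from the compact cube onto a Hausdorff space is closed, hence a quotient map, and
    \<open>g\<close> is continuous because its composition with it is.\<close>
  have "quotient_map (top_of_set (cbox 0 1)) (top_of_set torus) (to_torus :: real ^ 'n \<Rightarrow> _)"
  proof (rule continuous_closed_imp_quotient_map)
    have im: "to_torus ` cbox 0 1 = (torus :: (complex ^ 'n) set)"
      using to_torus_in to_torus_surj by (metis (no_types, opaque_lifting) image_iff subsetI subset_antisym)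
    then show "to_torus ` topspace (top_of_set (cbox 0 1)) = topspace (top_of_set (torus :: (complex ^ 'n) set))" by simp
    have c: "continuous_on (cbox 0 1) (to_torus :: real ^ 'n \<Rightarrow> _)"
      unfolding to_torus_def by (intro continuous_intros)
    then show "continuous_map (top_of_set (cbox 0 1)) (top_of_set torus) (to_torus :: real ^ 'n \<Rightarrow> _)"
      using to_torus_in by (auto simp: continuous_map_in_subtopology)
    show "closed_map (top_of_set (cbox 0 1)) (top_of_set torus) (to_torus :: real ^ 'n \<Rightarrow> _)"
      using c to_torus_in
      by (intro continuous_imp_closed_map)
         (auto simp: continuous_map_in_subtopology compact_space_subtopology Hausdorff_space_subtopology)
  qed
  moreover have "continuous_map (top_of_set (cbox 0 1)) euclidean (g \<circ> (to_torus :: real ^ 'n \<Rightarrow> _))"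
    using continuous_on_subset[OF cont subset_UNIV] by (simp add: o_def g)
  ultimately have "continuous_map (top_of_set torus) euclidean g"
    by (rule continuous_compose_quotient_map)
  then have "continuous_on torus g" by simp
  from Stone_Weierstrass_basic[OF this \<open>e > 0\<close>] obtain h where h: "h \<in> R" "\<And>w. w \<in> torus \<Longrightarrow> \<bar>g w - h w\<bar> < e"
    by blast
  show ?thesis
  proof (intro exI[of _ "\<lambda>u. of_real (h (to_torus u))"] conjI allI)
    show "trig_poly (\<lambda>u. complex_of_real (h (to_torus u)))" using h(1) by (simp add: R_def)
    show "norm (complex_of_real (f u) - of_real (h (to_torus u))) < e" for u
      using h(2)[OF to_torus_in[of u]] by (simp add: g flip: of_real_diff)
  qed
qed

lemma trig_poly_dense:
  fixes f :: "real ^ 'n \<Rightarrow> complex"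
  assumes per: "lattice_periodic f" and cont: "continuous_on UNIV f" and "e > 0"
  shows "\<exists>p. trig_poly p \<and> (\<forall>u. norm (f u - p u) < e)"
proof -
  have "\<exists>p. trig_poly p \<and> (\<forall>u. norm (of_real (Re (f u)) - p u) < e / 2)"
    by (rule trig_poly_dense_real) (use assms in \<open>auto simp: lattice_periodic_def intro!: continuous_intros\<close>)
  moreover have "\<exists>p. trig_poly p \<and> (\<forall>u. norm (of_real (Im (f u)) - p u) < e / 2)"
    by (rule trig_poly_dense_real) (use assms in \<open>auto simp: lattice_periodic_def intro!: continuous_intros\<close>)
  ultimately obtain p q where p: "trig_poly p" "\<And>u. norm (of_real (Re (f u)) - p u) < e / 2"
    and q: "trig_poly q" "\<And>u. norm (of_real (Im (f u)) - q u) < e / 2" by blast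
  show ?thesis
  proof (intro exI[of _ "\<lambda>u. p u + \<i> * q u"] conjI allI)
    show "trig_poly (\<lambda>u. p u + \<i> * q u)" by (intro trig_poly_add trig_poly_cmult p q)
    fix u
    have eq: "f u - (p u + \<i> * q u) = (of_real (Re (f u)) - p u) + \<i> * (of_real (Im (f u)) - q u)"
      by (subst complex_eq[of "f u"]) (simp add: algebra_simps)
    have "norm (f u - (p u + \<i> * q u)) \<le> norm (of_real (Re (f u)) - p u) + norm (of_real (Im (f u)) - q u)"
      unfolding eq by (rule order_trans[OF norm_triangle_ineq]) (simp add: norm_mult)
    then show "norm (f u - (p u + \<i> * q u)) < e" using p(2)[of u] q(2)[of u] by linarith
  qed
qed

subsection \<open>Integration over the unit cube\<close>

definition unit_cube :: "(real ^ 'n) set" where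
  "unit_cube = {u. \<forall>i. 0 \<le> u $ i \<and> u $ i < 1}"

lemma unit_cube_borel [measurable]: "unit_cube \<in> sets borel"
  unfolding unit_cube_def by measurable

lemma unit_cube_ex1:
  fixes u :: "real ^ 'n"
  shows "\<exists>!z. u - of_int_vec z \<in> unit_cube"
proof (rule ex1I[of _ "\<chi> i. \<lfloor>u $ i\<rfloor>"])
  show "u - of_int_vec (\<chi> i. \<lfloor>u $ i\<rfloor>) \<in> unit_cube"
    by (auto simp: unit_cube_def) linarith
  fix z assume "u - of_int_vec z \<in> unit_cube"
  then have "0 \<le> u $ i - of_int (z $ i) \<and> u $ i - of_int (z $ i) < 1" for i
    by (simp add: unit_cube_def)
  then have "z $ i = \<lfloor>u $ i\<rfloor>" for i
    by (smt (verit) floor_unique)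
  then show "z = (\<chi> i. \<lfloor>u $ i\<rfloor>)" by (simp add: vec_eq_iff)
qed

lemma unit_cube_ex1_add:
  fixes u :: "real ^ 'n"
  shows "\<exists>!z. u + of_int_vec z \<in> unit_cube"
proof -
  obtain z where z: "u - of_int_vec z \<in> unit_cube" "\<And>z'. u - of_int_vec z' \<in> unit_cube \<Longrightarrow> z' = z"
    using unit_cube_ex1[of u] by auto
  have neg: "of_int_vec (- z) = - (of_int_vec z :: real ^ 'n)" for z
    by (simp add: vec_eq_iff)
  show ?thesis
  proof (rule ex1I[of _ "- z"])
    show "u + of_int_vec (- z) \<in> unit_cube" using z(1) by (simp add: neg)
    show "z' = - z" if "u + of_int_vec z' \<in> unit_cube" for z'
      using z(2)[of "- z'"] that by (simp add: neg) (metis minus_minus)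
  qed
qed

lemma unit_cube_emeasure: "emeasure lborel (unit_cube :: (real ^ 'n) set) = 1"
proof -
  have sub: "box 0 1 \<subseteq> (unit_cube :: (real ^ 'n) set)" "(unit_cube :: (real ^ 'n) set) \<subseteq> cbox 0 1"
    by (auto simp: unit_cube_def mem_box_cart less_imp_le)
  have one: "(\<Prod>b\<in>Basis. (1 :: real ^ 'n) \<bullet> b) = 1"
    by (rule prod.neutral) (auto simp: Basis_vec_def inner_axis)
  have b: "0 \<le> (1 :: real ^ 'n) \<bullet> b" if "b \<in> Basis" for b
    using that by (auto simp: Basis_vec_def inner_axis)
  have "emeasure lborel (cbox 0 1 :: (real ^ 'n) set) = 1" "emeasure lborel (box 0 1 :: (real ^ 'n) set) = 1"
    using emeasure_lborel_cbox[of 0 "1 :: real ^ 'n"] emeasure_lborel_box[of 0 "1 :: real ^ 'n"]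
    by (auto simp: one b)
  then show ?thesis
    using emeasure_mono[OF sub(1), of lborel] emeasure_mono[OF sub(2), of lborel] by auto
qed

definition cube_measure :: "(real ^ 'n) measure" where
  "cube_measure = restrict_space lborel unit_cube"

lemma prob_space_cube: "prob_space cube_measure"
  by (rule prob_spaceI) (simp add: cube_measure_def emeasure_restrict_space space_restrict_space unit_cube_emeasure)

interpretation cube: prob_space cube_measure
  by (rule prob_space_cube)

lemma measurable_cube [measurable (raw)]: "f \<in> borel_measurable borel \<Longrightarrow> f \<in> borel_measurable cube_measure"
  unfolding cube_measure_def by (intro measurable_restrict_space1) auto

lemma integral_cube:
  fixes f :: "real ^ 'n \<Rightarrow> 'b::{banach, second_countable_topology}"
  shows "integral\<^sup>L cube_measure f = (LINT u|lborel. indicator unit_cube u *\<^sub>R f u)"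
  unfolding cube_measure_def by (subst integral_restrict_space) auto

lemma cube_integrable_bounded:
  fixes f :: "real ^ 'n \<Rightarrow> 'b::{banach, second_countable_topology}"
  assumes "f \<in> borel_measurable borel" "\<And>u. norm (f u) \<le> K"
  shows "integrable cube_measure f"
  using assms by (intro cube.integrable_const_bound[of _ K]) auto

lemma lborel_translate:
  fixes f :: "'a::euclidean_space \<Rightarrow> 'b::{banach, second_countable_topology}"
  assumes [measurable]: "f \<in> borel_measurable borel"
  shows "(LINT u|lborel. f (c + u)) = (LINT u|lborel. f u)"
    and "integrable lborel (\<lambda>u. f (c + u)) \<longleftrightarrow> integrable lborel f"
proof -
  show "(LINT u|lborel. f (c + u)) = (LINT u|lborel. f u)"
    by (subst (2) lborel_distr_plus[of c, symmetric]) (simp add: integral_distr)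
  show "integrable lborel (\<lambda>u. f (c + u)) \<longleftrightarrow> integrable lborel f"
    by (subst (2) lborel_distr_plus[of c, symmetric]) (simp add: integrable_distr_eq)
qed

text \<open>The integer translates of \<open>unit_cube\<close> tile the space; each piece of the
  integral is moved back to the cube. \<open>Z\<close> contains every translate on which
  \<open>f\<close> can be nonzero, so finite sums suffice.\<close>

lemma integral_unfold_lattice:
  fixes f :: "real ^ 'n \<Rightarrow> 'b::{banach, second_countable_topology}"
  assumes int: "integrable lborel f" and Z: "finite Z"
    and supp: "\<And>u z. u \<in> unit_cube \<Longrightarrow> z \<notin> Z \<Longrightarrow> f (u + of_int_vec z) = 0"
  shows "(LINT u|lborel. f u) = (LINT u|cube_measure. (\<Sum>z\<in>Z. f (u + of_int_vec z)))"
proof -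
  have [measurable]: "f \<in> borel_measurable borel" using int by auto
  \<comment> \<open>Exactly one translate of the cube contains \<open>u\<close>; if its index lies
    outside \<open>Z\<close>, both sides are 0 by \<open>supp\<close>.\<close>
  have split: "f u = (\<Sum>z\<in>Z. indicator unit_cube (u - of_int_vec z) *\<^sub>R f u)" for u
  proof -
    obtain z where z: "\<And>z'. u - of_int_vec z' \<in> unit_cube \<longleftrightarrow> z' = z"
      using unit_cube_ex1[of u] by auto
    have "(\<Sum>z\<in>Z. indicator unit_cube (u - of_int_vec z) *\<^sub>R f u) = (\<Sum>z'\<in>Z. if z' = z then f u else 0)"
      by (intro sum.cong) (simp_all add: indicator_def z)
    also have "\<dots> = f u" using supp[of "u - of_int_vec z" z] Z by (simp add: z)
    finally show ?thesis ..
  qed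
  have int': "integrable lborel (\<lambda>u. indicator unit_cube (u - of_int_vec z) *\<^sub>R f u)" for z :: "int ^ 'n"
    by (rule Bochner_Integration.integrable_bound[OF int]) (auto simp: indicator_def)
  have int'': "integrable lborel (\<lambda>u. indicator unit_cube u *\<^sub>R f (u + of_int_vec z))" for z :: "int ^ 'n"
    using int' lborel_translate(2)[of "\<lambda>u. indicator unit_cube (u - of_int_vec z) *\<^sub>R f u" "of_int_vec z"]
    by (simp add: add.commute)
  have "(LINT u|lborel. f u) = (LINT u|lborel. (\<Sum>z\<in>Z. indicator unit_cube (u - of_int_vec z) *\<^sub>R f u))"
    by (subst split) (rule refl)
  also have "\<dots> = (\<Sum>z\<in>Z. LINT u|lborel. indicator unit_cube (u - of_int_vec z) *\<^sub>R f u)"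
    by (intro Bochner_Integration.integral_sum int')
  also have "\<dots> = (\<Sum>z\<in>Z. LINT u|lborel. indicator unit_cube u *\<^sub>R f (u + of_int_vec z))"
  proof (intro sum.cong refl)
    fix z :: "int ^ 'n"
    show "(LINT u|lborel. indicator unit_cube (u - of_int_vec z) *\<^sub>R f u) = (LINT u|lborel. indicator unit_cube u *\<^sub>R f (u + of_int_vec z))"
      using lborel_translate(1)[of "\<lambda>u. indicator unit_cube (u - of_int_vec z) *\<^sub>R f u" "of_int_vec z"]
      by (simp add: add.commute)
  qed
  also have "\<dots> = (LINT u|lborel. (\<Sum>z\<in>Z. indicator unit_cube u *\<^sub>R f (u + of_int_vec z)))"
    by (intro Bochner_Integration.integral_sum[symmetric] int'')
  also have "\<dots> = (LINT u|cube_measure. (\<Sum>z\<in>Z. f (u + of_int_vec z)))"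
    by (simp add: integral_cube scaleR_sum_right)
  finally show ?thesis .
qed

lemma finite_bounded_int_vec: "finite {z :: int ^ 'n. norm (of_int_vec z) \<le> c}"
proof -
  have "z \<in> int_box (\<chi> i. - \<lceil>\<bar>c\<bar>\<rceil>) (\<chi> i. nat (2 * \<lceil>\<bar>c\<bar>\<rceil> + 1))" if "norm (of_int_vec z) \<le> c" for z :: "int ^ 'n"
  proof -
    have "\<bar>real_of_int (z $ i)\<bar> \<le> c" for i
      using component_le_norm_cart[of "of_int_vec z" i] that by simp
    then have "\<bar>z $ i\<bar> \<le> \<lceil>\<bar>c\<bar>\<rceil>" for i
      by (metis (no_types, opaque_lifting) abs_ge_self ceiling_mono ceiling_of_int of_int_abs order_trans)
    then have "- \<lceil>\<bar>c\<bar>\<rceil> \<le> z $ i \<and> z $ i < \<lceil>\<bar>c\<bar>\<rceil> + 1" for i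
      by (smt (verit, best))
    then show ?thesis by (auto simp: int_box_def)
  qed
  then show ?thesis by (intro finite_subset[OF _ finite_int_box]) auto
qed

lemma norm_unit_cube_le:
  assumes "u \<in> unit_cube"
  shows "norm (u :: real ^ 'n) \<le> real CARD('n)"
proof -
  have "norm u \<le> (\<Sum>i\<in>UNIV. \<bar>u $ i\<bar>)" by (rule norm_le_l1_cart)
  also have "\<dots> \<le> (\<Sum>i\<in>(UNIV :: 'n set). 1)"
    using assms by (intro sum_mono) (simp add: unit_cube_def less_imp_le)
  finally show ?thesis by simp
qed

text \<open>Translation by a vector \<open>t\<close> with
  \<open>of_int_vec m \<bullet> t = 1 / 2\<close> reverses the sign of the character, while the
  integral over a translated period cell stays the same. So the integral equals its own
  negative.\<close>

lemma integral_circ_cube: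
  fixes m :: "int ^ 'n"
  assumes "m \<noteq> 0"
  shows "(LINT u|cube_measure. circ (of_int_vec m \<bullet> u)) = 0"
proof -
  obtain j where j: "m $ j \<noteq> 0" using assms by (auto simp: vec_eq_iff)
  define t :: "real ^ 'n" where "t = axis j (1 / (2 * of_int (m $ j)))"
  have mt: "of_int_vec m \<bullet> t = 1 / 2" using j by (simp add: t_def inner_axis)
  have half: "circ (1/2) = -1" by (simp add: circ_def)
  define g where "g = (\<lambda>u. circ (of_int_vec m \<bullet> u))"
  have [measurable]: "g \<in> borel_measurable borel"
    unfolding g_def by (intro borel_measurable_continuous_onI continuous_intros)
  have gt: "g (t + u) = - g u" for u by (simp add: g_def inner_right_distrib circ_add mt half)
  have gz: "g (u + of_int_vec z) = g u" for u z
    using circ_periodic[of m] by (simp add: g_def lattice_periodic_def)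
  \<comment> \<open>The character cut off to the cube shifted by \<open>t\<close>. Unfolding its
    integral gives the integral of \<open>g\<close> over the unit cube; substituting
    \<open>t + u\<close> gives minus that integral.\<close>
  define f where "f = (\<lambda>u. indicator unit_cube (u - t) *\<^sub>R g u)"
  have [measurable]: "f \<in> borel_measurable borel" unfolding f_def by measurable
  have ft: "f (t + u) = - (indicator unit_cube u *\<^sub>R g u)" for u
    by (simp add: f_def gt)
  have int0: "integrable lborel (\<lambda>u. indicator unit_cube u *\<^sub>R g u)"
    using cube_integrable_bounded[OF \<open>g \<in> borel_measurable borel\<close>, of 1]
    by (simp add: cube_measure_def integrable_restrict_space) (simp add: g_def)
  then have intf: "integrable lborel f"
    using lborel_translate(2)[of f t] by (simp add: ft)
  \<comment> \<open>A point of the unit cube has norm at most the dimension; the bound follows from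
    writing \<open>z\<close> as (u + z - t) + t - u.\<close>
  define Z where "Z = {z :: int ^ 'n. norm (of_int_vec z) \<le> real CARD('n) + norm t + real CARD('n)}"
  have in_Z: "z \<in> Z" if "u \<in> unit_cube" "u + of_int_vec z - t \<in> unit_cube" for u z
  proof -
    have "norm (of_int_vec z) = norm ((u + of_int_vec z - t) + t - u)" by simp
    also have "\<dots> \<le> norm (u + of_int_vec z - t) + norm t + norm u"
      by (meson add_right_mono norm_triangle_ineq norm_triangle_ineq4 order_trans)
    finally show ?thesis using norm_unit_cube_le[OF that(1)] norm_unit_cube_le[OF that(2)]
      unfolding Z_def by simp
  qed
  have "(LINT u|lborel. f u) = (LINT u|cube_measure. (\<Sum>z\<in>Z. f (u + of_int_vec z)))"
    using in_Z by (intro integral_unfold_lattice intf) (auto simp: f_def Z_def finite_bounded_int_vec indicator_def)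
  also have "\<dots> = (LINT u|cube_measure. g u)"
  proof (intro Bochner_Integration.integral_cong refl)
    fix u :: "real ^ 'n" assume "u \<in> space cube_measure"
    then have u: "u \<in> unit_cube" by (simp add: cube_measure_def space_restrict_space)
    obtain z where z: "\<And>z'. u + of_int_vec z' - t \<in> unit_cube \<longleftrightarrow> z' = z"
      using unit_cube_ex1_add[of "u - t"] by (auto simp: algebra_simps)
    have "(\<Sum>z'\<in>Z. f (u + of_int_vec z')) = (\<Sum>z'\<in>Z. if z' = z then g u else 0)"
      by (intro sum.cong) (simp_all add: f_def gz indicator_def z)
    also have "\<dots> = g u"
      using in_Z[OF u, of z] z by (simp add: Z_def finite_bounded_int_vec)
    finally show "(\<Sum>z'\<in>Z. f (u + of_int_vec z')) = g u" .
  qed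
  finally have "(LINT u|lborel. f u) = (LINT u|cube_measure. g u)" .
  moreover have "(LINT u|lborel. f u) = (LINT u|lborel. f (t + u))"
    by (subst lborel_translate(1)) auto
  moreover have "(LINT u|lborel. f (t + u)) = - (LINT u|cube_measure. g u)"
    by (simp add: ft integral_cube)
  ultimately show ?thesis by (simp add: g_def)
qed

subsection \<open>Approximation of almost everywhere continuous periodic functions\<close>

text \<open>Riemann integrability on the torus in the form of Lebesgue's criterion, with
  \<open>N\<close> a superset of the discontinuities. Closedness of \<open>N\<close> makes the
  distance to it positive off \<open>N\<close>; its periodicity makes the cut-off functions below
  periodic.\<close>

definition riemann_periodic :: "(real ^ 'n) set \<Rightarrow> (real ^ 'n \<Rightarrow> complex) \<Rightarrow> bool" where
  "riemann_periodic N \<psi> \<longleftrightarrow> closed N \<and> N \<in> null_sets lborel \<and> (\<forall>u z. u + of_int_vec z \<in> N \<longleftrightarrow> u \<in> N) \<and>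
     lattice_periodic \<psi> \<and> (\<exists>K. \<forall>u. norm (\<psi> u) \<le> K) \<and> (\<forall>u. u \<notin> N \<longrightarrow> isCont \<psi> u)"

text \<open>The case distinction is needed because \<open>infdist u {} = 0\<close>.\<close>

definition bump :: "(real ^ 'n) set \<Rightarrow> nat \<Rightarrow> real ^ 'n \<Rightarrow> real" where
  "bump N k u = (if N = {} then 0 else max 0 (1 - real k * infdist u N))"

lemma bump_bounds: "0 \<le> bump N k u" "bump N k u \<le> 1"
  by (auto simp: bump_def infdist_nonneg)

lemma bump_eq_1: "u \<in> N \<Longrightarrow> bump N k u = 1"
  by (auto simp: bump_def)

lemma continuous_on_bump: "continuous_on A (bump N k)"
  unfolding bump_def by (cases "N = {}") (auto intro!: continuous_intros)

lemma bump_periodic: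
  assumes "\<And>u z. u + of_int_vec z \<in> N \<longleftrightarrow> u \<in> N"
  shows "lattice_periodic (bump N k)"
proof -
  have "infdist (u + of_int_vec z) N = infdist u N" for u z
  proof -
    have eq: "(\<lambda>v. v + of_int_vec z) ` N = N"
    proof (intro equalityI subsetI)
      fix v assume "v \<in> N"
      then have "v - of_int_vec z \<in> N" using assms[of "v - of_int_vec z" z] by simp
      then show "v \<in> (\<lambda>v. v + of_int_vec z) ` N" by (intro image_eqI[of _ _ "v - of_int_vec z"]) auto
    qed (use assms in auto)
    have "infdist (u + of_int_vec z) ((\<lambda>v. v + of_int_vec z) ` N) = infdist u N"
      unfolding infdist_def by (simp add: image_image)
    then show ?thesis by (simp add: eq)
  qed
  then show ?thesis by (simp add: lattice_periodic_def bump_def)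
qed

text \<open>Dominated convergence: off the closed null set the distance to \<open>N\<close> is
  positive, and the bump vanishes once \<open>k\<close> exceeds its reciprocal.\<close>

lemma bump_integral_tendsto_0:
  fixes N :: "(real ^ 'n) set"
  assumes "closed N" "N \<in> null_sets lborel"
  shows "(\<lambda>k. LINT u|cube_measure. bump N k u) \<longlonglongrightarrow> 0"
proof -
  have meas [measurable]: "bump N k \<in> borel_measurable borel" for k
    by (intro borel_measurable_continuous_onI continuous_on_bump)
  have "AE u in lborel. u \<notin> N" using assms(2) by (rule AE_not_in)
  then have "AE u in cube_measure. u \<notin> N"
    unfolding cube_measure_def by (subst AE_restrict_space_iff) auto
  then have lim: "AE u in cube_measure. (\<lambda>k. bump N k u) \<longlonglongrightarrow> 0"
  proof eventually_elim
    case (elim u)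
    show ?case
    proof (cases "N = {}")
      case False
      have pos: "infdist u N > 0"
        using elim assms(1) False in_closed_iff_infdist_zero[of N u] infdist_nonneg[of u N] by linarith
      obtain k0 :: nat where k0: "real k0 > 1 / infdist u N" using reals_Archimedean2 by blast
      have "bump N k u = 0" if "k \<ge> k0" for k
      proof -
        have "1 \<le> real k0 * infdist u N" using k0 pos by (simp add: field_simps)
        also have "\<dots> \<le> real k * infdist u N" using that pos by (intro mult_right_mono) auto
        finally show ?thesis by (simp add: bump_def)
      qed
      then show ?thesis
        by (intro tendsto_eventually) (auto simp: eventually_sequentially)
    qed (simp add: bump_def)
  qed
  have "(\<lambda>k. LINT u|cube_measure. bump N k u) \<longlonglongrightarrow> (LINT u|(cube_measure :: (real ^ 'n) measure). (0::real))"
  proof (rule integral_dominated_convergence[where w = "\<lambda>_. 1"])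
    show "AE u in cube_measure. (\<lambda>k. bump N k u) \<longlonglongrightarrow> 0" by (rule lim)
    show "AE u in cube_measure. norm (bump N k u) \<le> 1" for k
      by (intro AE_I2) (simp add: bump_bounds abs_of_nonneg)
  qed (simp_all add: meas)
  then show ?thesis by simp
qed

lemma integrable_trig_poly: "trig_poly p \<Longrightarrow> integrable cube_measure p"
  using trig_poly_bounded[of p] trig_poly_continuous[of p UNIV]
  by (auto intro!: cube_integrable_bounded borel_measurable_continuous_onI)

text \<open>Damping \<open>\<psi>\<close> by \<open>1 - bump N k\<close> makes it continuous at an
  error of at most \<open>K\<close> times the bump. \<open>p\<close> approximates the damped
  function and \<open>q\<close> a multiple of the bump plus slack. The error is majorized by a
  trigonometric polynomial because means of such polynomials along orbits are the ones that can be
  computed.\<close>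

lemma trig_sandwich:
  assumes "riemann_periodic N \<psi>" "e > 0"
  shows "\<exists>p q. trig_poly p \<and> trig_poly q \<and> (\<forall>u. norm (\<psi> u - p u) \<le> Re (q u)) \<and>
    Re (LINT u|cube_measure. q u) \<le> e"
proof -
  obtain K0 where K0: "\<And>u. norm (\<psi> u) \<le> K0" using assms(1) by (auto simp: riemann_periodic_def)
  define K where "K = max K0 0"
  have K: "norm (\<psi> u) \<le> K" "K \<ge> 0" for u using K0[of u] by (auto simp: K_def)
  have N: "closed N" "N \<in> null_sets lborel" "\<And>u z. u + of_int_vec z \<in> N \<longleftrightarrow> u \<in> N"
    and per: "lattice_periodic \<psi>" and cont: "\<And>u. u \<notin> N \<Longrightarrow> isCont \<psi> u"
    using assms(1) by (auto simp: riemann_periodic_def)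
  \<comment> \<open>The integral of the majorant is at most \<open>K * d\<close> from the bump plus
    \<open>2 * K * d + d\<close> from the two uniform approximations, in total
    \<open>d * (3 * K + 1)\<close>.\<close>
  define d where "d = e / (3 * K + 1)"
  have d: "d > 0" using assms(2) K(2) by (simp add: d_def)
  obtain k where k: "(LINT u|cube_measure. bump N k u) < d"
    using order_tendstoD(2)[OF bump_integral_tendsto_0[OF N(1,2)] d] by (auto simp: eventually_sequentially)
  let ?\<chi> = "bump N k"
  have contb: "isCont ?\<chi> u" for u
    using continuous_on_bump[of UNIV N k] by (simp add: continuous_on_eq_continuous_at)
  define \<psi>' where "\<psi>' = (\<lambda>u. \<psi> u * of_real (1 - ?\<chi> u))"
  have "isCont \<psi>' u" for u
  proof (cases "u \<in> N")
    case True
    \<comment> \<open>On \<open>N\<close> nothing is known about \<open>\<psi>\<close> except its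
      bound, but the factor \<open>1 - ?\<chi>\<close> tends to 0 there.\<close>
    have bnd: "norm (\<psi>' v) \<le> K * (1 - ?\<chi> v)" for v
      using K(1)[of v] K(2) bump_bounds[of N k v] by (auto simp: \<psi>'_def norm_mult simp flip: of_real_diff intro!: mult_mono)
    have "((\<lambda>v. K * (1 - ?\<chi> v)) \<longlongrightarrow> K * (1 - ?\<chi> u)) (at u)"
      by (intro tendsto_intros isContD contb)
    then have "((\<lambda>v. K * (1 - ?\<chi> v)) \<longlongrightarrow> 0) (at u)" using bump_eq_1[OF True] by simp
    then have "(\<psi>' \<longlongrightarrow> 0) (at u)"
      by (rule Lim_null_comparison[rotated]) (auto intro!: always_eventually bnd)
    then show ?thesis by (simp add: isCont_def \<psi>'_def bump_eq_1[OF True])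
  next
    case False
    then show ?thesis unfolding \<psi>'_def by (intro continuous_intros cont contb)
  qed
  then have "continuous_on UNIV \<psi>'" by (simp add: continuous_on_eq_continuous_at)
  moreover have "lattice_periodic \<psi>'" "lattice_periodic (\<lambda>u. complex_of_real (?\<chi> u))"
    using per bump_periodic[OF N(3), of k] by (simp_all add: \<psi>'_def lattice_periodic_def)
  moreover have "continuous_on UNIV (\<lambda>u. complex_of_real (?\<chi> u))"
    by (intro continuous_intros continuous_on_bump)
  ultimately obtain p q0 where p: "trig_poly p" "\<And>u. norm (\<psi>' u - p u) < d"
    and q0: "trig_poly q0" "\<And>u. norm (of_real (?\<chi> u) - q0 u) < d"
    using trig_poly_dense d by meson
  define q where "q = (\<lambda>u. of_real K * q0 u + of_real (K * d + d))"
  have tq: "trig_poly q" unfolding q_def by (intro trig_poly_add trig_poly_cmult trig_poly_const q0)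
  have Re_q0: "\<bar>?\<chi> u - Re (q0 u)\<bar> < d" for u
    using abs_Re_le_cmod[of "of_real (?\<chi> u) - q0 u"] q0(2)[of u] by simp
  have "norm (\<psi> u - p u) \<le> Re (q u)" for u
  proof -
    have "\<psi> u - p u = \<psi> u * of_real (?\<chi> u) + (\<psi>' u - p u)"
      by (simp add: \<psi>'_def algebra_simps)
    then have "norm (\<psi> u - p u) \<le> norm (\<psi> u * of_real (?\<chi> u)) + norm (\<psi>' u - p u)"
      by (metis norm_triangle_ineq)
    also have "\<dots> \<le> K * ?\<chi> u + d"
      using p(2)[of u] K(1)[of u] bump_bounds[of N k u]
      by (intro add_mono) (auto simp: norm_mult intro!: mult_right_mono)
    also have "\<dots> \<le> K * (Re (q0 u) + d) + d"
      using Re_q0[of u] K(2) by (intro add_mono mult_left_mono) auto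
    finally show ?thesis by (simp add: q_def algebra_simps)
  qed
  moreover have "Re (LINT u|cube_measure. q u) \<le> e"
  proof -
    have intb: "integrable cube_measure ?\<chi>"
      using bump_bounds[of N k] by (intro cube_integrable_bounded[of _ 1] borel_measurable_continuous_onI continuous_on_bump) auto
    have "Re (LINT u|cube_measure. q u) = (LINT u|cube_measure. Re (q u))"
      by (simp add: integrable_trig_poly tq)
    also have "\<dots> \<le> (LINT u|cube_measure. K * ?\<chi> u + (2 * K * d + d))"
    proof (rule integral_mono)
      show "integrable cube_measure (\<lambda>u. Re (q u))" using integrable_trig_poly[OF tq] by simp
      show "integrable cube_measure (\<lambda>u. K * ?\<chi> u + (2 * K * d + d))" using intb by auto
      fix u
      have "K * Re (q0 u) \<le> K * (?\<chi> u + d)" using Re_q0[of u] K(2) by (intro mult_left_mono) auto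
      then show "Re (q u) \<le> K * ?\<chi> u + (2 * K * d + d)" by (simp add: q_def algebra_simps)
    qed
    also have "\<dots> = K * (LINT u|cube_measure. ?\<chi> u) + (2 * K * d + d)"
      using intb by (simp add: cube.prob_space)
    also have "\<dots> \<le> K * d + (2 * K * d + d)" using k K(2) by (intro add_mono mult_left_mono) auto
    also have "\<dots> = d * (3 * K + 1)" by (simp add: algebra_simps)
    also have "\<dots> = e" using K(2) by (simp add: d_def)
    finally show ?thesis .
  qed
  ultimately show ?thesis using p(1) tq by blast
qed

subsection \<open>Almost periodic functions on the integer lattice\<close>

inductive lattice_trig :: "(real ^ 'n) set \<Rightarrow> (int ^ 'n \<Rightarrow> complex) \<Rightarrow> bool" for \<Gamma> where
  lattice_trig_circ: "\<theta> \<in> \<Gamma> \<Longrightarrow> lattice_trig \<Gamma> (\<lambda>x. circ (\<theta> \<bullet> of_int_vec x))"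
| lattice_trig_cmult: "lattice_trig \<Gamma> p \<Longrightarrow> lattice_trig \<Gamma> (\<lambda>x. c * p x)"
| lattice_trig_add: "lattice_trig \<Gamma> p \<Longrightarrow> lattice_trig \<Gamma> q \<Longrightarrow> lattice_trig \<Gamma> (\<lambda>x. p x + q x)"

text \<open>Almost periodicity in the sense of Weyl: closeness in the mean over large boxes,
  uniformly in their position, with exponents from \<open>\<Gamma>\<close>. Boundedness is included
  so that products stay in the class.\<close>

definition mean_periodic :: "(real ^ 'n) set \<Rightarrow> (int ^ 'n \<Rightarrow> complex) \<Rightarrow> bool" where
  "mean_periodic \<Gamma> f \<longleftrightarrow> (\<exists>K. \<forall>x. norm (f x) \<le> K) \<and>
     (\<forall>e>0. \<exists>p. lattice_trig \<Gamma> p \<and> (\<forall>\<^sub>F P in box_filter. box_avg (\<lambda>x. norm (f x - p x)) P \<le> e))"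

definition add_closed :: "'a::monoid_add set \<Rightarrow> bool" where
  "add_closed \<Gamma> \<longleftrightarrow> 0 \<in> \<Gamma> \<and> (\<forall>a\<in>\<Gamma>. \<forall>b\<in>\<Gamma>. a + b \<in> \<Gamma>)"

lemma lattice_trig_mono: "lattice_trig \<Gamma> p \<Longrightarrow> \<Gamma> \<subseteq> \<Delta> \<Longrightarrow> lattice_trig \<Delta> p"
  by (induction rule: lattice_trig.induct) (auto intro: lattice_trig.intros)

lemma mean_periodic_mono: "mean_periodic \<Gamma> f \<Longrightarrow> \<Gamma> \<subseteq> \<Delta> \<Longrightarrow> mean_periodic \<Delta> f"
  unfolding mean_periodic_def using lattice_trig_mono by meson

lemma lattice_trig_bounded: "lattice_trig \<Gamma> p \<Longrightarrow> \<exists>K. \<forall>x. norm (p x) \<le> K"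
proof (induction rule: lattice_trig.induct)
  case (lattice_trig_cmult p c)
  then show ?case by (metis mult_left_mono norm_ge_zero norm_mult)
next
  case (lattice_trig_add p q)
  then show ?case by (metis add_mono norm_triangle_le)
qed auto

lemma lattice_trig_mult:
  assumes "lattice_trig \<Gamma> p" "lattice_trig \<Gamma> q" "add_closed \<Gamma>"
  shows "lattice_trig \<Gamma> (\<lambda>x. p x * q x)"
  using assms
proof (induction arbitrary: q)
  case (lattice_trig_circ \<theta>)
  from \<open>lattice_trig \<Gamma> q\<close> show ?case
  proof induction
    case (lattice_trig_circ \<theta>')
    have "\<theta> + \<theta>' \<in> \<Gamma>" using \<open>\<theta> \<in> \<Gamma>\<close> lattice_trig_circ \<open>add_closed \<Gamma>\<close> by (simp add: add_closed_def)
    from lattice_trig.lattice_trig_circ[OF this] show ?case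
      by (simp add: inner_left_distrib circ_add)
  next
    case (lattice_trig_cmult p c)
    then show ?case using lattice_trig.lattice_trig_cmult[of \<Gamma> _ c] by (simp add: mult.left_commute)
  next
    case (lattice_trig_add p q)
    then show ?case using lattice_trig.lattice_trig_add by (simp add: distrib_left)
  qed
next
  case (lattice_trig_cmult p c)
  show ?case
    using lattice_trig.lattice_trig_cmult[OF lattice_trig_cmult.IH[OF lattice_trig_cmult.prems], of c]
    by (simp add: mult.assoc)
next
  case (lattice_trig_add p p')
  show ?case
    using lattice_trig.lattice_trig_add[OF lattice_trig_add.IH(1)[OF lattice_trig_add.prems] lattice_trig_add.IH(2)[OF lattice_trig_add.prems]]
    by (simp add: distrib_right)
qed

lemma mean_periodic_trig:
  assumes "lattice_trig \<Gamma> p"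
  shows "mean_periodic \<Gamma> p"
  unfolding mean_periodic_def
proof (intro conjI allI impI)
  fix e :: real assume "e > 0"
  then show "\<exists>q. lattice_trig \<Gamma> q \<and> (\<forall>\<^sub>F P in box_filter. box_avg (\<lambda>x. norm (p x - q x)) P \<le> e)"
    by (intro exI[of _ p] conjI assms) (simp add: box_avg_def)
qed (rule lattice_trig_bounded[OF assms])

lemma mean_periodic_add:
  assumes f: "mean_periodic \<Gamma> f" and g: "mean_periodic \<Gamma> g"
  shows "mean_periodic \<Gamma> (\<lambda>x. f x + g x)"
  unfolding mean_periodic_def
proof (intro conjI allI impI)
  obtain F where F: "\<And>x. norm (f x) \<le> F" using f by (auto simp: mean_periodic_def)
  obtain G where G: "\<And>x. norm (g x) \<le> G" using g by (auto simp: mean_periodic_def)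
  show "\<exists>K. \<forall>x. norm (f x + g x) \<le> K"
    using F G by (intro exI[of _ "F + G"]) (metis add_mono norm_triangle_le)
  fix e :: real assume "e > 0"
  then have e2: "e / 2 > 0" by simp
  obtain p where p: "lattice_trig \<Gamma> p" "\<forall>\<^sub>F P in box_filter. box_avg (\<lambda>x. norm (f x - p x)) P \<le> e / 2"
    using f e2 unfolding mean_periodic_def by blast
  obtain q where q: "lattice_trig \<Gamma> q" "\<forall>\<^sub>F P in box_filter. box_avg (\<lambda>x. norm (g x - q x)) P \<le> e / 2"
    using g e2 unfolding mean_periodic_def by blast
  have "\<forall>\<^sub>F P in box_filter. box_avg (\<lambda>x. norm (f x + g x - (p x + q x))) P \<le> e"
    using p(2) q(2)
  proof eventually_elim
    case (elim P)
    have "box_avg (\<lambda>x. norm (f x + g x - (p x + q x))) P \<le> box_avg (\<lambda>x. norm (f x - p x) + norm (g x - q x)) P"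
      by (intro box_avg_mono norm_diff_triangle_ineq)
    then show ?case using elim by (simp add: box_avg_add)
  qed
  then show "\<exists>p. lattice_trig \<Gamma> p \<and> (\<forall>\<^sub>F P in box_filter. box_avg (\<lambda>x. norm (f x + g x - p x)) P \<le> e)"
    using lattice_trig_add[OF p(1) q(1)] by blast
qed

lemma mean_periodic_limit:
  assumes bnd: "\<And>x. norm (f x) \<le> K"
    and approx: "\<And>e. e > 0 \<Longrightarrow> \<exists>g. mean_periodic \<Gamma> g \<and> (\<forall>\<^sub>F P in box_filter. box_avg (\<lambda>x. norm (f x - g x)) P \<le> e)"
  shows "mean_periodic \<Gamma> f"
  unfolding mean_periodic_def
proof (intro conjI allI impI)
  show "\<exists>K. \<forall>x. norm (f x) \<le> K" using bnd by blast
  fix e :: real assume "e > 0"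
  then have e2: "e / 2 > 0" by simp
  obtain g where g: "mean_periodic \<Gamma> g" "\<forall>\<^sub>F P in box_filter. box_avg (\<lambda>x. norm (f x - g x)) P \<le> e / 2"
    using approx[OF e2] by blast
  obtain p where p: "lattice_trig \<Gamma> p" "\<forall>\<^sub>F P in box_filter. box_avg (\<lambda>x. norm (g x - p x)) P \<le> e / 2"
    using g(1) e2 unfolding mean_periodic_def by blast
  have "\<forall>\<^sub>F P in box_filter. box_avg (\<lambda>x. norm (f x - p x)) P \<le> e"
    using g(2) p(2)
  proof eventually_elim
    case (elim P)
    have "box_avg (\<lambda>x. norm (f x - p x)) P \<le> box_avg (\<lambda>x. norm (f x - g x) + norm (g x - p x)) P"
      by (intro box_avg_mono) (metis add_diff_eq diff_add_cancel norm_triangle_ineq)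
    then show ?case using elim by (simp add: box_avg_add)
  qed
  then show "\<exists>p. lattice_trig \<Gamma> p \<and> (\<forall>\<^sub>F P in box_filter. box_avg (\<lambda>x. norm (f x - p x)) P \<le> e)"
    using p(1) by blast
qed

text \<open>Uses f g - p q = f (g - q) + q (f - p). \<open>q\<close> is chosen before
  \<open>p\<close>, because the accuracy required of \<open>p\<close> depends on the bound
  \<open>Q\<close> of \<open>q\<close>.\<close>

lemma mean_periodic_mult:
  assumes f: "mean_periodic \<Gamma> f" and g: "mean_periodic \<Gamma> g" and \<Gamma>: "add_closed \<Gamma>"
  shows "mean_periodic \<Gamma> (\<lambda>x. f x * g x)"
  unfolding mean_periodic_def
proof (intro conjI allI impI)
  obtain F where F: "\<And>x. norm (f x) \<le> F" using f by (auto simp: mean_periodic_def)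
  obtain G where G: "\<And>x. norm (g x) \<le> G" using g by (auto simp: mean_periodic_def)
  have F0: "F \<ge> 0" using F[of 0] norm_ge_zero order_trans by blast
  show "\<exists>K. \<forall>x. norm (f x * g x) \<le> K"
    using F G F0 by (intro exI[of _ "F * G"]) (auto simp: norm_mult intro!: mult_mono)
  fix e :: real assume e: "e > 0"
  define d where "d = e / (2 * (F + 1))"
  have d: "d > 0" using e F0 by (simp add: d_def)
  obtain q where q: "lattice_trig \<Gamma> q" "\<forall>\<^sub>F P in box_filter. box_avg (\<lambda>x. norm (g x - q x)) P \<le> d"
    using g d unfolding mean_periodic_def by blast
  obtain Q where Q: "\<And>x. norm (q x) \<le> Q" using lattice_trig_bounded[OF q(1)] by blast
  have Q0: "Q \<ge> 0" using Q[of 0] norm_ge_zero order_trans by blast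
  define d' where "d' = e / (2 * (Q + 1))"
  have d': "d' > 0" using e Q0 by (simp add: d'_def)
  obtain p where p: "lattice_trig \<Gamma> p" "\<forall>\<^sub>F P in box_filter. box_avg (\<lambda>x. norm (f x - p x)) P \<le> d'"
    using f d' unfolding mean_periodic_def by blast
  have "\<forall>\<^sub>F P in box_filter. box_avg (\<lambda>x. norm (f x * g x - p x * q x)) P \<le> e"
    using p(2) q(2)
  proof eventually_elim
    case (elim P)
    have "box_avg (\<lambda>x. norm (f x * g x - p x * q x)) P
        \<le> box_avg (\<lambda>x. (F + 1) * norm (g x - q x) + (Q + 1) * norm (f x - p x)) P"
    proof (rule box_avg_mono)
      fix x
      have "f x * g x - p x * q x = f x * (g x - q x) + q x * (f x - p x)" by (simp add: algebra_simps)
      then have "norm (f x * g x - p x * q x) \<le> norm (f x) * norm (g x - q x) + norm (q x) * norm (f x - p x)"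
        by (metis norm_mult norm_triangle_ineq)
      also have "\<dots> \<le> (F + 1) * norm (g x - q x) + (Q + 1) * norm (f x - p x)"
        using F[of x] Q[of x] by (intro add_mono mult_right_mono) auto
      finally show "norm (f x * g x - p x * q x) \<le> (F + 1) * norm (g x - q x) + (Q + 1) * norm (f x - p x)" .
    qed
    also have "\<dots> = (F + 1) * box_avg (\<lambda>x. norm (g x - q x)) P + (Q + 1) * box_avg (\<lambda>x. norm (f x - p x)) P"
      by (simp add: box_avg_add box_avg_mult_left)
    also have "\<dots> \<le> (F + 1) * d + (Q + 1) * d'"
      using elim F0 Q0 by (intro add_mono mult_left_mono) auto
    also have "\<dots> = e" using F0 Q0 by (simp add: d_def d'_def field_simps add_nonneg_eq_0_iff)
    finally show ?case .
  qed
  then show "\<exists>p. lattice_trig \<Gamma> p \<and> (\<forall>\<^sub>F P in box_filter. box_avg (\<lambda>x. norm (f x * g x - p x)) P \<le> e)"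
    using lattice_trig_mult[OF p(1) q(1) \<Gamma>] by blast
qed

text \<open>By \<open>nr\<close> no exponent of an approximating polynomial cancels
  \<open>\<theta>\<close> modulo integer vectors, so each term of the product is a nontrivial
  character of the lattice and has mean 0.\<close>

lemma mean_periodic_nonresonant_mean:
  assumes f: "mean_periodic \<Gamma> f" and nr: "\<And>\<gamma>. \<gamma> \<in> \<Gamma> \<Longrightarrow> \<exists>j. (\<theta> + \<gamma>) $ j \<notin> \<int>"
  shows "(box_avg (\<lambda>x. f x * circ (\<theta> \<bullet> of_int_vec x)) \<longlongrightarrow> 0) box_filter"
proof (rule tendstoI)
  fix e :: real assume e: "e > 0"
  have trig: "(box_avg (\<lambda>x. p x * circ (\<theta> \<bullet> of_int_vec x)) \<longlongrightarrow> 0) box_filter" if "lattice_trig \<Gamma> p" for p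
    using that
  proof induction
    case (lattice_trig_circ \<gamma>)
    obtain j where "(\<theta> + \<gamma>) $ j \<notin> \<int>" using nr lattice_trig_circ by blast
    from tendsto_box_avg_circ[OF this] show ?case
      by (simp add: inner_left_distrib circ_add mult.commute)
  next
    case (lattice_trig_cmult p c)
    then show ?case
      using tendsto_mult_left[of _ 0 box_filter c] by (simp add: mult.assoc box_avg_mult_left)
  next
    case (lattice_trig_add p q)
    then show ?case
      using tendsto_add[of _ 0 box_filter _ 0] by (simp add: distrib_right box_avg_add)
  qed
  obtain p where p: "lattice_trig \<Gamma> p" "\<forall>\<^sub>F P in box_filter. box_avg (\<lambda>x. norm (f x - p x)) P \<le> e / 2"
    using f e unfolding mean_periodic_def by (meson half_gt_zero)
  have "\<forall>\<^sub>F P in box_filter. dist (box_avg (\<lambda>x. p x * circ (\<theta> \<bullet> of_int_vec x)) P) 0 < e / 2"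
    using tendstoD[OF trig[OF p(1)], of "e / 2"] e by simp
  with p(2) show "\<forall>\<^sub>F P in box_filter. dist (box_avg (\<lambda>x. f x * circ (\<theta> \<bullet> of_int_vec x)) P) 0 < e"
  proof eventually_elim
    case (elim P)
    have "norm (box_avg (\<lambda>x. f x * circ (\<theta> \<bullet> of_int_vec x)) P - box_avg (\<lambda>x. p x * circ (\<theta> \<bullet> of_int_vec x)) P)
        \<le> box_avg (\<lambda>x. norm (f x * circ (\<theta> \<bullet> of_int_vec x) - p x * circ (\<theta> \<bullet> of_int_vec x))) P"
      unfolding box_avg_diff[symmetric] by (rule norm_box_avg_le)
    also have "\<dots> = box_avg (\<lambda>x. norm (f x - p x)) P"
      by (simp add: norm_mult flip: left_diff_distrib)
    finally show ?case using elim
      by (smt (verit, best) dist_0_norm dist_commute field_sum_of_halves norm_triangle_sub)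
  qed
qed

subsection \<open>Local constancy\<close>

text \<open>Local constancy in place of continuity yields a closed set for every \<open>g\<close>,
  so no measurability of \<open>g\<close> has to be checked.\<close>

definition jump_set :: "('a::topological_space \<Rightarrow> 'b) \<Rightarrow> 'a set" where
  "jump_set g = {u. \<not> (\<forall>\<^sub>F v in nhds u. g v = g u)}"

lemma closed_jump_set: "closed (jump_set g)"
proof -
  have "open {u. \<forall>\<^sub>F v in nhds u. g v = g u}"
  proof (subst open_subopen, intro ballI)
    fix u assume "u \<in> {u. \<forall>\<^sub>F v in nhds u. g v = g u}"
    then obtain S where S: "open S" "u \<in> S" "\<And>v. v \<in> S \<Longrightarrow> g v = g u"
      by (auto simp: eventually_nhds)
    have "S \<subseteq> {u. \<forall>\<^sub>F v in nhds u. g v = g u}"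
    proof
      fix w assume "w \<in> S"
      then have "\<forall>v\<in>S. g v = g w" using S(3) by metis
      then show "w \<in> {u. \<forall>\<^sub>F v in nhds u. g v = g u}"
        using S(1) \<open>w \<in> S\<close> unfolding mem_Collect_eq eventually_nhds by blast
    qed
    then show "\<exists>T. open T \<and> u \<in> T \<and> T \<subseteq> {u. \<forall>\<^sub>F v in nhds u. g v = g u}"
      using S by blast
  qed
  then show ?thesis
    by (simp add: closed_def jump_set_def Compl_eq)
qed

text \<open>The premise concerns only equality of values: under an integer translation the value of
  \<open>R\<close> changes, but coincidences between its values persist.\<close>

lemma jump_set_translate:
  fixes g :: "'a::real_normed_vector \<Rightarrow> 'b"
  assumes eq: "\<And>u v. g (u + a) = g (v + a) \<longleftrightarrow> g u = g v"
  shows "u + a \<in> jump_set g \<longleftrightarrow> u \<in> jump_set g"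
proof -
  have "(\<forall>\<^sub>F v in nhds (u + a). g v = g (u + a)) \<longleftrightarrow> (\<forall>\<^sub>F v in nhds u. g (v + a) = g (u + a))"
    using eventually_filtermap[of "\<lambda>v. g v = g (u + a)" "\<lambda>v. v + a" "nhds u"] filtermap_nhds_shift[of "- a" u] by simp
  then show ?thesis by (simp add: jump_set_def eq)
qed

section \<open>Frequencies of the forward orbit and nonresonance\<close>

lemma mat_pow_Suc: "mat_pow L (Suc k) = L ** mat_pow L k"
  by (simp add: mat_pow_def)

lemma mat_pow_0: "mat_pow L 0 = mat 1"
  by (simp add: mat_pow_def)

lemma vector_matrix_mult_rows: "v v* A = (\<Sum>i\<in>UNIV. (v $ i) *\<^sub>R row i A)" for A :: "real ^ 'n ^ 'm"
  by (simp add: vec_eq_iff vector_matrix_mult_def row_def mult.commute)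

text \<open>The frequencies of the trigonometric polynomials in \<open>L x, \<dots>, L\<^sup>J x\<close>.\<close>

definition frequencies :: "real ^ 'n ^ 'n \<Rightarrow> nat \<Rightarrow> (real ^ 'n) set" where
  "frequencies L J = {\<Sum>j\<in>{1..J}. of_int_vec (m j) v* mat_pow L j | m. True}"

lemma add_closed_frequencies: "add_closed (frequencies L J)"
  unfolding add_closed_def frequencies_def
proof (safe, goal_cases)
  case 1
  show ?case by (intro exI[of _ "\<lambda>_. 0"]) simp
next
  case (2 _ _ m m')
  show ?case
    by (intro exI[of _ "\<lambda>j. m j + m' j"])
       (simp add: of_int_vec_add vector_matrix_left_distrib sum.distrib)
qed

lemma frequencies_Suc:
  assumes "\<gamma> \<in> frequencies L J"
  shows "\<gamma> + of_int_vec m v* mat_pow L (Suc J) \<in> frequencies L (Suc J)"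
proof -
  obtain m' where "\<gamma> = (\<Sum>j\<in>{1..J}. of_int_vec (m' j) v* mat_pow L j)"
    using assms by (auto simp: frequencies_def)
  then show ?thesis
    unfolding frequencies_def
    by (intro CollectI exI[of _ "m'(Suc J := m)"] conjI) auto
qed

lemma frequencies_0: "0 \<in> frequencies L J"
  using add_closed_frequencies by (auto simp: add_closed_def)

lemma frequencies_mono: "frequencies L J \<subseteq> frequencies L (Suc J)"
  using frequencies_Suc[of _ L J 0] by auto

text \<open>If all components were integers, an integer combination of the rows of
  \<open>L, ..., L^(J+1)\<close> and of the identity would vanish. Nonresonance forces all its
  coefficients to be 0, among them \<open>m\<close>, the coefficient vector of the top
  power.\<close>

lemma iteratively_nonresonant_frequencies:
  fixes L :: "real ^ 'n ^ 'n"
  assumes nr: "iteratively_nonresonant L" and "m \<noteq> 0" "\<gamma> \<in> frequencies L J"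
  shows "\<exists>j. (of_int_vec m v* mat_pow L (Suc J) + \<gamma>) $ j \<notin> \<int>"
proof (rule ccontr)
  assume "\<not> ?thesis"
  then have "\<forall>j. \<exists>z. (of_int_vec m v* mat_pow L (Suc J) + \<gamma>) $ j = of_int z"
    by (auto elim: Ints_cases)
  then obtain z where z: "\<And>j. (of_int_vec m v* mat_pow L (Suc J) + \<gamma>) $ j = of_int (z j)"
    by metis
  obtain m' where m': "\<gamma> + of_int_vec m v* mat_pow L (Suc J) = (\<Sum>j\<in>{1..Suc J}. of_int_vec (m' j) v* mat_pow L j)"
    and m'_top: "m' (Suc J) = m"
  proof -
    obtain m0 where "\<gamma> = (\<Sum>j\<in>{1..J}. of_int_vec (m0 j) v* mat_pow L j)"
      using assms(3) by (auto simp: frequencies_def)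
    then show thesis by (intro that[of "m0(Suc J := m)"]) auto
  qed
  define I where "I = (int ` {1..Suc J}) \<times> (UNIV :: 'n set)"
  have "nonresonant I (\<lambda>(k, i). row i (mat_zpow L k))"
    using nr[unfolded iteratively_nonresonant_def, rule_format, of I] by (fastforce simp: I_def)
  then have ri: "rat_independent (UNIV <+> I) (case_sum (\<lambda>j. row j (mat 1)) (\<lambda>(k, i). row i (mat_zpow L k)))"
    by (simp add: nonresonant_def)
  \<comment> \<open>The vanishing combination: the integer components with a minus sign on the
    identity rows, the integer vectors \<open>m'\<close> on the rows of the powers.\<close>
  define c :: "'n + int \<times> 'n \<Rightarrow> rat" where
    "c = case_sum (\<lambda>j. - of_int (z j)) (\<lambda>(k, i). of_int (m' (nat k) $ i))"
  have "(\<Sum>p\<in>I. of_rat (c (Inr p)) *\<^sub>R (case p of (k, i) \<Rightarrow> row i (mat_zpow L k)))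
      = (\<Sum>k\<in>int ` {1..Suc J}. \<Sum>i\<in>UNIV. of_int (m' (nat k) $ i) *\<^sub>R row i (mat_zpow L k))"
    unfolding I_def by (subst sum.cartesian_product) (auto intro!: sum.cong simp: c_def)
  also have "\<dots> = (\<Sum>j\<in>{1..Suc J}. \<Sum>i\<in>UNIV. of_int (m' j $ i) *\<^sub>R row i (mat_pow L j))"
    by (subst sum.reindex) (auto simp: mat_zpow_def intro!: sum.cong)
  also have "\<dots> = (\<Sum>j\<in>{1..Suc J}. of_int_vec (m' j) v* mat_pow L j)"
    by (simp only: vector_matrix_mult_rows of_int_vec_nth)
  also have "\<dots> = \<gamma> + of_int_vec m v* mat_pow L (Suc J)"
    by (rule m'[symmetric])
  also have "\<dots> = (\<Sum>j\<in>UNIV. of_int (z j) *\<^sub>R row j (mat 1))"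
  proof -
    have "\<gamma> + of_int_vec m v* mat_pow L (Suc J) = (\<chi> j. of_int (z j)) v* mat 1"
      using z by (simp add: vec_eq_iff add.commute)
    then show ?thesis by (simp only: vector_matrix_mult_rows) simp
  qed
  finally have "(\<Sum>p\<in>UNIV <+> I. of_rat (c p) *\<^sub>R case_sum (\<lambda>j. row j (mat 1)) (\<lambda>(k, i). row i (mat_zpow L k)) p) = 0"
    by (subst sum.Plus) (auto simp: I_def c_def of_rat_minus sum_negf)
  then have c0: "\<And>p. p \<in> UNIV <+> I \<Longrightarrow> c p = 0"
    using ri unfolding rat_independent_def by blast
  have "m $ i = 0" for i
  proof -
    have "Inr (int (Suc J), i) \<in> UNIV <+> I"
      unfolding I_def by (intro InrI SigmaI imageI) auto
    from c0[OF this] have "m' (nat (int (Suc J))) $ i = 0" by (simp add: c_def del: of_nat_Suc)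
    then show ?thesis by (simp only: nat_int m'_top)
  qed
  then show False using \<open>m \<noteq> 0\<close> by (simp add: vec_eq_iff)
qed

lemma trig_sandwich_means:
  assumes fin: "(box_avg (\<lambda>x. Re (q (y x))) \<longlongrightarrow> Re c) box_filter" and "Re c \<le> e" "e < e'"
    and le: "\<And>u. norm (\<psi> u - p u) \<le> Re (q u)"
  shows "\<forall>\<^sub>F P in box_filter. box_avg (\<lambda>x. norm (\<psi> (y x) - p (y x))) P \<le> e'"
proof -
  have "\<forall>\<^sub>F P in box_filter. box_avg (\<lambda>x. Re (q (y x))) P < e'"
    using order_tendstoD(2)[OF fin, of e'] assms(2,3) by simp
  then show ?thesis
  proof eventually_elim
    case (elim P)
    have "box_avg (\<lambda>x. norm (\<psi> (y x) - p (y x))) P \<le> box_avg (\<lambda>x. Re (q (y x))) P"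
      by (intro box_avg_mono le)
    then show ?case using elim by simp
  qed
qed

subsection \<open>Equidistribution along the orbits\<close>

locale quantized_system =
  fixes R :: "real ^ 'n \<Rightarrow> int ^ 'n" and L :: "real ^ 'n ^ 'n"
  assumes quant: "quantizer R" and nonres: "iteratively_nonresonant L"
begin

abbreviation "T \<equiv> transition R L"
abbreviation "X \<equiv> R -` {0}"

definition sawtooth :: "real ^ 'n \<Rightarrow> real ^ 'n" where
  "sawtooth u = u - of_int_vec (R u)"

text \<open>Indices start at 0 here: \<open>forcing J\<close> is y_k for k = \<open>Suc J\<close>,
  and the error with number \<open>Suc J\<close> is
  \<open>sawtooth \<circ> forcing J\<close>.\<close>

definition forcing :: "nat \<Rightarrow> int ^ 'n \<Rightarrow> real ^ 'n" where
  "forcing J x = L *v of_int_vec ((T ^^ J) x)"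

lemma R_add: "R (u + of_int_vec z) = R u + z"
  using quant by (simp add: quantizer_def)

lemma R_diff: "R (u - of_int_vec z) = R u - z"
  using R_add[of "u - of_int_vec z" z] by (simp add: algebra_simps)

lemma sawtooth_add [simp]: "sawtooth (u + of_int_vec z) = sawtooth u"
  by (simp add: sawtooth_def R_add of_int_vec_add)

lemma sawtooth_in: "sawtooth u \<in> X"
  by (simp add: sawtooth_def R_diff)

lemma quantization_error_eq: "quantization_error R L (Suc J) = sawtooth \<circ> forcing J"
  by (auto simp: fun_eq_iff quantization_error_def sawtooth_def forcing_def transition_def)

lemma T_Suc: "of_int_vec ((T ^^ Suc J) x) = forcing J x - sawtooth (forcing J x)"
  by (simp add: sawtooth_def forcing_def transition_def)

lemma jordan_X: "bounded X" "negligible (frontier X)"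
  using quant by (simp_all add: quantizer_def jordan_measurable_def)

text \<open>Off this set \<open>sawtooth\<close> is locally a translation and membership in
  \<open>B\<close> is locally constant. So the same set serves for characters of the errors (with
  \<open>B = {}\<close>) and for indicators.\<close>

definition error_jumps :: "(real ^ 'n) set \<Rightarrow> (real ^ 'n) set" where
  "error_jumps B = jump_set (\<lambda>u. (R u, sawtooth u \<in> B))"

text \<open>If \<open>sawtooth u\<close> lies on neither frontier, then near \<open>u\<close> the
  vector \<open>v - of_int_vec (R u)\<close> stays in \<open>X\<close>, which says
  \<open>R v = R u\<close>; membership in \<open>B\<close> is locally constant for the same
  reason.\<close>

lemma error_jumps_frontier:
  assumes "u \<in> error_jumps B"
  shows "sawtooth u \<in> frontier X \<union> frontier B"
proof (rule ccontr)
  assume *: "\<not> ?thesis"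
  have const: "\<forall>\<^sub>F v in nhds (sawtooth u). (v \<in> A) = (sawtooth u \<in> A)" if "sawtooth u \<notin> frontier A" for A
  proof (cases "sawtooth u \<in> A")
    case True
    then have "sawtooth u \<in> interior A" using that closure_subset[of A] by (auto simp: frontier_def)
    then show ?thesis using True interior_subset[of A]
      by (auto simp: eventually_nhds intro!: exI[of _ "interior A"])
  next
    case False
    then have "sawtooth u \<in> - closure A" using that interior_subset[of A] by (auto simp: frontier_def)
    then show ?thesis using False closure_subset[of A]
      by (auto simp: eventually_nhds intro!: exI[of _ "- closure A"])
  qed
  have shift: "\<forall>\<^sub>F v in nhds u. Q (v - of_int_vec (R u))" if "\<forall>\<^sub>F v in nhds (sawtooth u). Q v" for Q
  proof -
    have "filterlim (\<lambda>v. v - of_int_vec (R u)) (nhds (sawtooth u)) (nhds u)"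
      unfolding sawtooth_def by (intro tendsto_intros filterlim_ident)
    then show ?thesis using that by (simp add: filterlim_iff)
  qed
  have "\<forall>\<^sub>F v in nhds u. (v - of_int_vec (R u) \<in> X) = (sawtooth u \<in> X)"
    "\<forall>\<^sub>F v in nhds u. (v - of_int_vec (R u) \<in> B) = (sawtooth u \<in> B)"
    using * by (intro shift[OF const]; blast)+
  then have "\<forall>\<^sub>F v in nhds u. (R v, sawtooth v \<in> B) = (R u, sawtooth u \<in> B)"
  proof eventually_elim
    case (elim v)
    then have "R v = R u" using sawtooth_in[of u] by (simp add: R_diff)
    then show ?case using elim by (simp add: sawtooth_def)
  qed
  then show False using assms by (simp add: error_jumps_def jump_set_def)
qed

text \<open>The jumps lie in countably many integer translates of two negligible frontiers; being
  closed, the set is a null set of Borel measure as well.\<close>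

lemma null_error_jumps:
  assumes "negligible (frontier B)"
  shows "error_jumps B \<in> null_sets lborel"
proof -
  have "error_jumps B \<subseteq> (\<Union>z. (+) (of_int_vec z) ` (frontier X \<union> frontier B))"
  proof
    fix u assume "u \<in> error_jumps B"
    from error_jumps_frontier[OF this] show "u \<in> (\<Union>z. (+) (of_int_vec z) ` (frontier X \<union> frontier B))"
      by (intro UN_I[of "R u"] image_eqI[of _ _ "sawtooth u"]) (auto simp: sawtooth_def)
  qed
  moreover have "negligible (\<Union>z :: int ^ 'n. (+) (of_int_vec z) ` (frontier X \<union> frontier B))"
  proof -
    have "countable (range (\<lambda>z :: int ^ 'n. (+) (of_int_vec z) ` (frontier X \<union> frontier B)))"
      by simp
    then show ?thesis
      by (intro negligible_countable_Union) (use assms jordan_X in \<open>auto intro!: negligible_translation negligible_Un\<close>)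
  qed
  ultimately have "negligible (error_jumps B)" by (rule negligible_subset[rotated])
  moreover have "closed (error_jumps B)" by (simp add: error_jumps_def closed_jump_set)
  ultimately show ?thesis
    by (simp add: negligible_iff_null_sets null_sets_completion_iff borel_closed)
qed

lemma riemann_periodic_sawtooth:
  assumes "negligible (frontier B)" and bnd: "\<And>u. norm (h u) \<le> K"
    and cont: "\<And>u. u \<notin> error_jumps B \<Longrightarrow> isCont (\<lambda>v. h (sawtooth v)) u"
  shows "riemann_periodic (error_jumps B) (\<lambda>u. h (sawtooth u))"
  unfolding riemann_periodic_def
proof (intro conjI allI impI)
  show "closed (error_jumps B)" by (simp add: error_jumps_def closed_jump_set)
  show "error_jumps B \<in> null_sets lborel" by (rule null_error_jumps) fact
  show "u + of_int_vec z \<in> error_jumps B \<longleftrightarrow> u \<in> error_jumps B" for u z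
    unfolding error_jumps_def by (rule jump_set_translate) (simp add: R_add)
  show "lattice_periodic (\<lambda>u. h (sawtooth u))" by (simp add: lattice_periodic_def)
qed (use bnd cont in auto)

lemma sawtooth_locally:
  assumes "u \<notin> error_jumps B"
  shows "\<forall>\<^sub>F v in nhds u. sawtooth v = v - of_int_vec (R u) \<and> (sawtooth v \<in> B \<longleftrightarrow> sawtooth u \<in> B)"
proof -
  have "\<forall>\<^sub>F v in nhds u. (R v, sawtooth v \<in> B) = (R u, sawtooth u \<in> B)"
    using assms by (simp add: error_jumps_def jump_set_def)
  then show ?thesis by eventually_elim (metis prod.inject sawtooth_def)
qed

lemma riemann_periodic_circ:
  "riemann_periodic (error_jumps {}) (\<lambda>u. circ (c \<bullet> sawtooth u))"
proof (rule riemann_periodic_sawtooth[where K = 1])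
  fix u assume "u \<notin> error_jumps {}"
  from sawtooth_locally[OF this]
  have ev: "\<forall>\<^sub>F v in nhds u. circ (c \<bullet> sawtooth v) = circ (c \<bullet> (v - of_int_vec (R u)))"
    by eventually_elim simp
  have "continuous_on UNIV (\<lambda>v. circ (c \<bullet> (v - of_int_vec (R u))))"
    by (intro continuous_intros)
  then show "isCont (\<lambda>v. circ (c \<bullet> sawtooth v)) u"
    by (subst isCont_cong[OF ev]) (simp add: continuous_on_eq_continuous_at)
qed auto

lemma riemann_periodic_indicator:
  assumes "negligible (frontier B)"
  shows "riemann_periodic (error_jumps B) (\<lambda>u. of_bool (sawtooth u \<in> B))"
proof (rule riemann_periodic_sawtooth[where K = 1])
  fix u assume "u \<notin> error_jumps B"
  from sawtooth_locally[OF this]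
  have ev: "\<forall>\<^sub>F v in nhds u. of_bool (sawtooth v \<in> B) = (of_bool (sawtooth u \<in> B) :: complex)"
    by eventually_elim (rule arg_cong[of _ _ of_bool], blast)
  show "isCont (\<lambda>v. of_bool (sawtooth v \<in> B) :: complex) u"
    by (subst isCont_cong[OF ev]) simp
qed (use assms in auto)

text \<open>\<open>T^J x - L^J x\<close> is the accumulated linear effect of the first
  \<open>J\<close> errors. It is the only way in which the past enters the next forcing, besides the
  new term \<open>L^(J+1) x\<close>.\<close>

definition orbit_periodic :: "nat \<Rightarrow> bool" where
  "orbit_periodic J \<longleftrightarrow> (\<forall>c. mean_periodic (frequencies L J)
     (\<lambda>x. circ (c \<bullet> (of_int_vec ((T ^^ J) x) - mat_pow L J *v of_int_vec x))))"

text \<open>Adding and subtracting \<open>L^J x\<close> separates the past, with exponents in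
  \<open>frequencies L J\<close>, from the exponent \<open>m v* L^(J+1)\<close>, which nonresonance
  keeps apart from them.\<close>

lemma circ_forcing:
  "circ (of_int_vec m \<bullet> forcing J x) =
     circ ((of_int_vec m v* L) \<bullet> (of_int_vec ((T ^^ J) x) - mat_pow L J *v of_int_vec x)) *
     circ ((of_int_vec m v* mat_pow L (Suc J)) \<bullet> of_int_vec x)"
proof -
  have "of_int_vec m \<bullet> forcing J x = (of_int_vec m v* L) \<bullet> of_int_vec ((T ^^ J) x)"
    by (simp add: forcing_def dot_lmul_matrix)
  also have "\<dots> = (of_int_vec m v* L) \<bullet> (of_int_vec ((T ^^ J) x) - mat_pow L J *v of_int_vec x)
      + (of_int_vec m v* mat_pow L (Suc J)) \<bullet> of_int_vec x"
    by (simp add: inner_diff_right dot_lmul_matrix mat_pow_Suc matrix_vector_mul_assoc)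
  finally show ?thesis by (simp add: circ_add)
qed

text \<open>Asymptotic independence of the forcing from the past \<open>f\<close>. For
  \<open>m \<noteq> 0\<close> the past factor of the character is absorbed into \<open>f\<close>,
  and the remaining new exponent makes the mean vanish, as does the integral of the
  character.\<close>

lemma mean_trig_forcing:
  assumes P: "orbit_periodic J" and f: "mean_periodic (frequencies L J) f"
    and mu: "(box_avg f \<longlongrightarrow> \<mu>) box_filter" and p: "trig_poly p"
  shows "(box_avg (\<lambda>x. f x * p (forcing J x)) \<longlongrightarrow> \<mu> * (LINT u|cube_measure. p u)) box_filter"
  using p
proof induction
  case (trig_poly_circ m)
  show ?case
  proof (cases "m = 0")
    case True
    then show ?thesis using mu by (simp add: cube.prob_space)
  next
    case False
    have "mean_periodic (frequencies L J) (\<lambda>x. f x * circ ((of_int_vec m v* L) \<bullet> (of_int_vec ((T ^^ J) x) - mat_pow L J *v of_int_vec x)))"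
      using P by (intro mean_periodic_mult f add_closed_frequencies) (simp add: orbit_periodic_def)
    from mean_periodic_nonresonant_mean[OF this iteratively_nonresonant_frequencies[OF nonres False]]
    show ?thesis
      by (simp add: circ_forcing integral_circ_cube[OF False] mult.assoc)
  qed
next
  case (trig_poly_cmult p c)
  then show ?case
    using tendsto_mult_left[of _ "\<mu> * (LINT u|cube_measure. p u)" box_filter c]
    by (simp add: mult.left_commute box_avg_mult_left)
next
  case (trig_poly_add p q)
  then show ?case
    using tendsto_add[of _ "\<mu> * (LINT u|cube_measure. p u)" box_filter _ "\<mu> * (LINT u|cube_measure. q u)"]
    by (simp add: distrib_left box_avg_add integrable_trig_poly)
qed

lemma mean_periodic_const: "mean_periodic (frequencies L J) (\<lambda>_. 1)"
  using mean_periodic_trig[OF lattice_trig_circ[OF frequencies_0]] by simp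

lemma mean_Re_trig_forcing:
  assumes "orbit_periodic J" "trig_poly q"
  shows "(box_avg (\<lambda>x. Re (q (forcing J x))) \<longlongrightarrow> Re (LINT u|cube_measure. q u)) box_filter"
proof -
  have "(box_avg (\<lambda>x. 1 * q (forcing J x)) \<longlongrightarrow> 1 * (LINT u|cube_measure. q u)) box_filter"
    by (rule mean_trig_forcing[OF assms(1) mean_periodic_const tendsto_box_avg_const assms(2)])
  then have "((\<lambda>P. Re (box_avg (\<lambda>x. q (forcing J x)) P)) \<longlongrightarrow> Re (LINT u|cube_measure. q u)) box_filter"
    by (intro tendsto_Re) simp
  then show ?thesis by (simp only: box_avg_Re[symmetric])
qed

text \<open>\<open>\<psi>\<close> may be discontinuous, so \<open>p\<close> is close to it only in
  the mean along the orbit. That mean is bounded by the mean of the majorant \<open>q\<close>, which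
  tends to the integral of \<open>q\<close> by equidistribution of the same forcing.\<close>

lemma mean_periodic_forcing:
  assumes P: "orbit_periodic J" and "riemann_periodic N \<psi>"
  shows "mean_periodic (frequencies L (Suc J)) (\<lambda>x. \<psi> (forcing J x))"
proof -
  obtain K where K: "\<And>u. norm (\<psi> u) \<le> K" using assms(2) by (auto simp: riemann_periodic_def)
  show ?thesis
  proof (rule mean_periodic_limit[where K = K])
    show "norm (\<psi> (forcing J x)) \<le> K" for x by (rule K)
    fix e :: real assume e: "e > 0"
    obtain p q where p: "trig_poly p" and q: "trig_poly q" and le: "\<And>u. norm (\<psi> u - p u) \<le> Re (q u)"
      and int: "Re (LINT u|cube_measure. q u) \<le> e / 2"
      using trig_sandwich[OF assms(2), of "e / 2"] e by auto
    have "mean_periodic (frequencies L (Suc J)) (\<lambda>x. p (forcing J x))"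
      using p
    proof induction
      case (trig_poly_circ m)
      have "of_int_vec m v* mat_pow L (Suc J) \<in> frequencies L (Suc J)"
        using frequencies_Suc[OF frequencies_0, of m L J] by simp
      from mean_periodic_mult[OF _ mean_periodic_trig[OF lattice_trig_circ[OF this]] add_closed_frequencies]
      show ?case
        unfolding circ_forcing using P mean_periodic_mono[OF _ frequencies_mono]
        unfolding orbit_periodic_def by blast
    next
      case (trig_poly_cmult p c)
      have "mean_periodic (frequencies L (Suc J)) (\<lambda>_. c)"
        using mean_periodic_trig[OF lattice_trig_cmult[OF lattice_trig_circ[OF frequencies_0]], of L "Suc J" c] by simp
      then show ?case using mean_periodic_mult[OF _ _ add_closed_frequencies] trig_poly_cmult by blast
    next
      case (trig_poly_add p q)
      then show ?case using mean_periodic_add by blast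
    qed
    moreover have "\<forall>\<^sub>F P in box_filter. box_avg (\<lambda>x. norm (\<psi> (forcing J x) - p (forcing J x))) P \<le> e"
      by (rule trig_sandwich_means[where q = q and y = "forcing J", OF mean_Re_trig_forcing[OF P q] int _ le]) (use e in simp)
    ultimately show "\<exists>g. mean_periodic (frequencies L (Suc J)) g \<and>
        (\<forall>\<^sub>F P in box_filter. box_avg (\<lambda>x. norm (\<psi> (forcing J x) - g x)) P \<le> e)" by blast
  qed
qed

text \<open>\<open>T^(J+1) x - L^(J+1) x\<close> is \<open>L\<close> applied to the previous
  difference, minus the new error. So the character with vector \<open>c\<close> becomes one with
  vector \<open>c v* L\<close> at stage \<open>J\<close>, times a function of the forcing.\<close>

lemma orbit_periodic: "orbit_periodic J"
proof (induction J)
  case 0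
  show ?case using mean_periodic_const[of 0] by (simp add: orbit_periodic_def mat_pow_0)
next
  case (Suc J)
  show ?case unfolding orbit_periodic_def
  proof
    fix c
    have eq: "circ (c \<bullet> (of_int_vec ((T ^^ Suc J) x) - mat_pow L (Suc J) *v of_int_vec x)) =
       circ ((c v* L) \<bullet> (of_int_vec ((T ^^ J) x) - mat_pow L J *v of_int_vec x)) *
       circ ((- c) \<bullet> sawtooth (forcing J x))" for x
    proof -
      have "c \<bullet> (of_int_vec ((T ^^ Suc J) x) - mat_pow L (Suc J) *v of_int_vec x) =
         (c v* L) \<bullet> (of_int_vec ((T ^^ J) x) - mat_pow L J *v of_int_vec x) + (- c) \<bullet> sawtooth (forcing J x)"
        unfolding T_Suc
        by (simp add: forcing_def inner_diff_right dot_lmul_matrix mat_pow_Suc matrix_vector_mul_assoc)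
      then show ?thesis by (simp only: circ_add)
    qed
    have "mean_periodic (frequencies L (Suc J)) (\<lambda>x. circ ((c v* L) \<bullet> (of_int_vec ((T ^^ J) x) - mat_pow L J *v of_int_vec x)))"
      using Suc mean_periodic_mono[OF _ frequencies_mono] by (auto simp: orbit_periodic_def)
    from mean_periodic_mult[OF this mean_periodic_forcing[OF Suc riemann_periodic_circ] add_closed_frequencies]
    show "mean_periodic (frequencies L (Suc J)) (\<lambda>x. circ (c \<bullet> (of_int_vec ((T ^^ Suc J) x) - mat_pow L (Suc J) *v of_int_vec x)))"
      by (simp only: eq)
  qed
qed

text \<open>Three approximations: \<open>\<psi>\<close> by \<open>p\<close> in the mean, the mean
  with \<open>p\<close> by its limit, the integral of \<open>p\<close> by that of
  \<open>\<phi>\<close>. The Borel function \<open>\<phi>\<close> stands in for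
  \<open>\<psi>\<close>, whose measurability is not assumed.\<close>

lemma mean_forcing:
  assumes f: "mean_periodic (frequencies L J) f" and mu: "(box_avg f \<longlongrightarrow> \<mu>) box_filter"
    and \<psi>: "riemann_periodic N \<psi>"
    and \<phi>: "\<phi> \<in> borel_measurable borel" "\<And>u. u \<notin> N \<Longrightarrow> \<phi> u = \<psi> u"
  shows "(box_avg (\<lambda>x. f x * \<psi> (forcing J x)) \<longlongrightarrow> \<mu> * (LINT u|cube_measure. \<phi> u)) box_filter"
proof (rule tendstoI)
  fix e :: real assume e: "e > 0"
  obtain K where K: "\<And>x. norm (f x) \<le> K" using f by (auto simp: mean_periodic_def)
  have K0: "K \<ge> 0" using K[of 0] norm_ge_zero order_trans by blast
  \<comment> \<open>The summand 1 makes both \<open>K * d\<close> and \<open>norm \<mu> * d\<close>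
    strictly smaller than \<open>e / 3\<close>.\<close>
  define S where "S = K + norm \<mu> + 1"
  have S: "S > 0" using K0 norm_ge_zero[of \<mu>] unfolding S_def by linarith
  define d where "d = e / (3 * S)"
  have d: "d > 0" using e S by (simp add: d_def)
  have Kd: "K * d < e / 3" "norm \<mu> * d < e / 3"
  proof -
    have "S * d = e / 3" using S by (simp add: d_def)
    then have "K * d + norm \<mu> * d + d = e / 3" by (simp add: S_def distrib_right)
    moreover have "0 \<le> K * d" "0 \<le> norm \<mu> * d" using K0 d by simp_all
    ultimately show "K * d < e / 3" "norm \<mu> * d < e / 3" using d by linarith+
  qed
  obtain p q where p: "trig_poly p" and q: "trig_poly q" and le: "\<And>u. norm (\<psi> u - p u) \<le> Re (q u)"
    and int: "Re (LINT u|cube_measure. q u) \<le> d / 2"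
    using trig_sandwich[OF \<psi>, of "d / 2"] d by auto
  have int_diff: "norm ((LINT u|cube_measure. p u) - (LINT u|cube_measure. \<phi> u)) \<le> d"
  proof -
    have ae: "AE u in cube_measure. u \<notin> N"
      using AE_not_in[of N lborel] \<psi> unfolding cube_measure_def riemann_periodic_def
      by (subst AE_restrict_space_iff) auto
    obtain B where B: "\<And>u. norm (\<psi> u) \<le> B" using \<psi> by (auto simp: riemann_periodic_def)
    have "AE u in cube_measure. norm (\<phi> u) \<le> B"
      using ae by eventually_elim (simp add: \<phi> B)
    then have int\<phi>: "integrable cube_measure \<phi>"
      using \<phi>(1) by (intro cube.integrable_const_bound[of _ B]) auto
    have "norm ((LINT u|cube_measure. p u) - (LINT u|cube_measure. \<phi> u)) = norm (LINT u|cube_measure. p u - \<phi> u)"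
      using int\<phi> integrable_trig_poly[OF p] by simp
    also have "\<dots> \<le> (LINT u|cube_measure. norm (p u - \<phi> u))" by (rule integral_norm_bound)
    also have "\<dots> \<le> (LINT u|cube_measure. Re (q u))"
    proof (rule integral_mono_AE)
      show "AE u in cube_measure. norm (p u - \<phi> u) \<le> Re (q u)"
        using ae by eventually_elim (simp add: \<phi> norm_minus_commute[of "p _"] le)
      show "integrable cube_measure (\<lambda>u. norm (p u - \<phi> u))"
        by (intro integrable_norm Bochner_Integration.integrable_diff int\<phi> integrable_trig_poly p)
      show "integrable cube_measure (\<lambda>u. Re (q u))"
        by (intro integrable_Re integrable_trig_poly q)
    qed
    also have "\<dots> \<le> d" using int d integrable_trig_poly[OF q] by simp
    finally show ?thesis .
  qed
  have ev1: "\<forall>\<^sub>F P in box_filter. box_avg (\<lambda>x. norm (\<psi> (forcing J x) - p (forcing J x))) P \<le> d"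
    by (rule trig_sandwich_means[where q = q and y = "forcing J", OF mean_Re_trig_forcing[OF orbit_periodic q] int _ le]) (use d in simp)
  have ev2: "\<forall>\<^sub>F P in box_filter. dist (box_avg (\<lambda>x. f x * p (forcing J x)) P) (\<mu> * (LINT u|cube_measure. p u)) < e / 3"
    using tendstoD[OF mean_trig_forcing[OF orbit_periodic f mu p], of "e / 3"] e by simp
  from ev1 ev2
  show "\<forall>\<^sub>F P in box_filter. dist (box_avg (\<lambda>x. f x * \<psi> (forcing J x)) P) (\<mu> * (LINT u|cube_measure. \<phi> u)) < e"
  proof eventually_elim
    case (elim P)
    have "dist (box_avg (\<lambda>x. f x * \<psi> (forcing J x)) P) (box_avg (\<lambda>x. f x * p (forcing J x)) P)
        \<le> box_avg (\<lambda>x. norm (f x * \<psi> (forcing J x) - f x * p (forcing J x))) P"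
      unfolding dist_norm box_avg_diff[symmetric] by (rule norm_box_avg_le)
    also have "\<dots> \<le> box_avg (\<lambda>x. K * norm (\<psi> (forcing J x) - p (forcing J x))) P"
      by (intro box_avg_mono) (simp add: norm_mult K mult_right_mono flip: right_diff_distrib)
    also have "\<dots> \<le> K * d" using elim(1) K0 by (simp add: box_avg_mult_left mult_left_mono)
    finally have 1: "dist (box_avg (\<lambda>x. f x * \<psi> (forcing J x)) P) (box_avg (\<lambda>x. f x * p (forcing J x)) P) < e / 3"
      using Kd by simp
    have "dist (\<mu> * (LINT u|cube_measure. p u)) (\<mu> * (LINT u|cube_measure. \<phi> u)) \<le> norm \<mu> * d"
      unfolding dist_norm right_diff_distrib[symmetric] norm_mult
      by (intro mult_left_mono int_diff) simp
    then have 3: "dist (\<mu> * (LINT u|cube_measure. p u)) (\<mu> * (LINT u|cube_measure. \<phi> u)) < e / 3"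
      using Kd by simp
    show ?case
      using dist_triangle_third[OF 1 elim(2) 3] .
  qed
qed

section \<open>From the measure on the torus to Lebesgue measure on the cell\<close>

definition lifted_interior :: "(real ^ 'n) set \<Rightarrow> (real ^ 'n) set" where
  "lifted_interior B = {u. \<exists>z. u + of_int_vec z \<in> interior B}"

text \<open>\<open>lifted_interior B\<close> is the Borel substitute for the preimage of
  \<open>B\<close> under \<open>sawtooth\<close>. Off the jumps a whole neighbourhood of
  \<open>u\<close>, moved by \<open>- R u\<close>, stays in \<open>B\<close>, so
  \<open>sawtooth u\<close> is an interior point.\<close>

lemma lifted_interior_iff:
  assumes "u \<notin> error_jumps B" "B \<subseteq> X"
  shows "u \<in> lifted_interior B \<longleftrightarrow> sawtooth u \<in> B"
proof
  assume "u \<in> lifted_interior B"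
  then obtain z where z: "u + of_int_vec z \<in> interior B" by (auto simp: lifted_interior_def)
  then have "u + of_int_vec z \<in> B" using interior_subset by blast
  moreover from this have "sawtooth (u + of_int_vec z) = u + of_int_vec z"
    using assms(2) by (auto simp: sawtooth_def)
  ultimately show "sawtooth u \<in> B" by simp
next
  assume B: "sawtooth u \<in> B"
  have "\<forall>\<^sub>F v in nhds u. v - of_int_vec (R u) \<in> B"
    using sawtooth_locally[OF assms(1)] by eventually_elim (use B in metis)
  then obtain S where S: "open S" "u \<in> S" "\<And>v. v \<in> S \<Longrightarrow> v - of_int_vec (R u) \<in> B"
    by (auto simp: eventually_nhds)
  have "(\<lambda>v. v - of_int_vec (R u)) ` S \<subseteq> interior B"
    using S by (intro interior_maximal) (auto intro: open_translation_subtract)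
  then have "u + of_int_vec (- R u) \<in> interior B"
    using S(2) by (auto simp: of_int_vec_minus)
  then show "u \<in> lifted_interior B" by (auto simp: lifted_interior_def)
qed

lemma open_lifted_interior: "open (lifted_interior B)"
proof -
  have "lifted_interior B = (\<Union>z. (\<lambda>u. u + of_int_vec z) -` interior B)"
    by (auto simp: lifted_interior_def)
  then show ?thesis
    by (auto intro!: open_vimage continuous_intros)
qed

text \<open>Unfolding: because \<open>B \<subseteq> X\<close>, the only integer translate of
  \<open>u\<close> that can lie in \<open>interior B\<close> is \<open>u - of_int_vec (R u)\<close>,
  so the sum over translates is an indicator. The null frontier gives \<open>interior B\<close> the
  measure of \<open>B\<close>.\<close>

lemma integral_lifted_interior:
  assumes "B \<subseteq> X" "negligible (frontier B)"
  shows "(LINT u|cube_measure. of_bool (u \<in> lifted_interior B)) = complex_of_real (measure lebesgue B)"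
proof -
  obtain c where c: "\<And>u. u \<in> B \<Longrightarrow> norm u \<le> c"
    using bounded_subset[OF jordan_X(1) assms(1)] by (auto simp: bounded_iff)
  have bB: "bounded B" using bounded_subset[OF jordan_X(1) assms(1)] .
  define f where "f = (\<lambda>u. indicator (interior B) u :: complex)"
  define Z where "Z = {z :: int ^ 'n. norm (of_int_vec z) \<le> c + real CARD('n)}"
  have intf: "integrable lborel f"
  proof -
    have "emeasure lborel (interior B) < \<infinity>"
      using emeasure_bounded_finite[OF bounded_subset[OF bB interior_subset]] .
    then have "integrable lborel (\<lambda>u. complex_of_real (indicat_real (interior B) u))"
      by (intro integrable_of_real integrable_real_indicator) auto
    then show ?thesis by (simp add: f_def of_real_indicator)
  qed
  have in_Z: "z \<in> Z" if "u \<in> unit_cube" "u + of_int_vec z \<in> interior B" for u z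
  proof -
    have "norm (of_int_vec z) = norm ((u + of_int_vec z) - u)" by simp
    also have "\<dots> \<le> norm (u + of_int_vec z) + norm u" by (rule norm_triangle_ineq4)
    also have "\<dots> \<le> c + real CARD('n)"
      using c[of "u + of_int_vec z"] that interior_subset norm_unit_cube_le[OF that(1)] by (intro add_mono) auto
    finally show ?thesis by (simp add: Z_def)
  qed
  have "(LINT u|lborel. f u) = (LINT u|cube_measure. (\<Sum>z\<in>Z. f (u + of_int_vec z)))"
    using in_Z by (intro integral_unfold_lattice intf) (auto simp: f_def Z_def finite_bounded_int_vec indicator_def)
  also have "\<dots> = (LINT u|cube_measure. of_bool (u \<in> lifted_interior B))"
  proof (intro Bochner_Integration.integral_cong refl)
    fix u :: "real ^ 'n" assume "u \<in> space cube_measure"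
    then have u: "u \<in> unit_cube" by (simp add: cube_measure_def space_restrict_space)
    have uniq: "z = - R u" if "u + of_int_vec z \<in> interior B" for z
    proof -
      have "R (u + of_int_vec z) = 0" using that interior_subset assms(1) by blast
      then show ?thesis by (simp add: R_add eq_neg_iff_add_eq_0 add.commute)
    qed
    have "(\<Sum>z\<in>Z. f (u + of_int_vec z)) = (\<Sum>z\<in>Z. if z = - R u then f (u + of_int_vec (- R u)) else 0)"
      using uniq by (intro sum.cong) (auto simp: f_def indicator_def)
    also have "\<dots> = of_bool (u \<in> lifted_interior B)"
      using in_Z[OF u] uniq by (auto simp: f_def lifted_interior_def Z_def finite_bounded_int_vec indicator_def)
    finally show "(\<Sum>z\<in>Z. f (u + of_int_vec z)) = of_bool (u \<in> lifted_interior B)" .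
  qed
  also have "(LINT u|lborel. f u) = complex_of_real (measure lebesgue B)"
  proof -
    have "(LINT u|lborel. f u) = (LINT u|lborel. complex_of_real (indicat_real (interior B) u))"
      by (simp add: f_def of_real_indicator)
    also have "\<dots> = complex_of_real (measure lebesgue (interior B))"
      by (simp only: integral_complex_of_real) simp
    also have "measure lebesgue (interior B) = measure lebesgue B"
      by (rule measure_interior[OF bB assms(2)])
    finally show ?thesis .
  qed
  finally show ?thesis ..
qed

text \<open>The two claims support each other: almost periodicity of the product over the first
  \<open>N\<close> errors makes the next forcing independent of it, and this yields the mean of the
  longer product.\<close>

lemma joint_error_mean:
  assumes "\<And>k. k < N \<Longrightarrow> B k \<subseteq> X \<and> negligible (frontier (B k))"
  shows "mean_periodic (frequencies L N) (\<lambda>x. \<Prod>k<N. of_bool (sawtooth (forcing k x) \<in> B k)) \<and>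
    (box_avg (\<lambda>x. \<Prod>k<N. of_bool (sawtooth (forcing k x) \<in> B k)) \<longlongrightarrow>
       (\<Prod>k<N. complex_of_real (measure lebesgue (B k)))) box_filter"
  using assms
proof (induction N)
  case 0
  then show ?case using mean_periodic_const[of 0] tendsto_box_avg_const[of 1] by simp
next
  case (Suc N)
  then have IH: "mean_periodic (frequencies L N) (\<lambda>x. \<Prod>k<N. of_bool (sawtooth (forcing k x) \<in> B k))"
    "(box_avg (\<lambda>x. \<Prod>k<N. of_bool (sawtooth (forcing k x) \<in> B k)) \<longlongrightarrow>
       (\<Prod>k<N. complex_of_real (measure lebesgue (B k)))) box_filter"
    and B: "B N \<subseteq> X" "negligible (frontier (B N))" by auto
  note rp = riemann_periodic_indicator[OF B(2)]
  have [measurable]: "lifted_interior (B N) \<in> sets borel" using borel_open[OF open_lifted_interior] .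
  have "(box_avg (\<lambda>x. (\<Prod>k<N. of_bool (sawtooth (forcing k x) \<in> B k)) * of_bool (sawtooth (forcing N x) \<in> B N)) \<longlongrightarrow>
       (\<Prod>k<N. complex_of_real (measure lebesgue (B k))) * (LINT u|cube_measure. of_bool (u \<in> lifted_interior (B N)))) box_filter"
    using lifted_interior_iff[OF _ B(1)] by (intro mean_forcing[OF IH rp]) auto
  moreover have "mean_periodic (frequencies L (Suc N)) (\<lambda>x. (\<Prod>k<N. of_bool (sawtooth (forcing k x) \<in> B k)) * of_bool (sawtooth (forcing N x) \<in> B N))"
    by (intro mean_periodic_mult mean_periodic_mono[OF IH(1) frequencies_mono] mean_periodic_forcing[OF orbit_periodic rp] add_closed_frequencies)
  ultimately show ?case by (simp add: integral_lifted_interior[OF B])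
qed

lemma joint_error_frequency:
  assumes "\<And>k. k \<in> {1..N} \<Longrightarrow> B k \<subseteq> X \<and> negligible (frontier (B k))"
  shows "frequency_measurable (\<Inter>k\<in>{1..N}. quantization_error R L k -` B k)"
    and "frequency (\<Inter>k\<in>{1..N}. quantization_error R L k -` B k) = (\<Prod>k\<in>{1..N}. measure lebesgue (B k))"
proof -
  let ?A = "\<Inter>k\<in>{1..N}. quantization_error R L k -` B k"
  have "(box_avg (\<lambda>x. \<Prod>k<N. of_bool (sawtooth (forcing k x) \<in> B (Suc k))) \<longlongrightarrow>
       (\<Prod>k<N. complex_of_real (measure lebesgue (B (Suc k))))) box_filter"
    using assms by (intro joint_error_mean[THEN conjunct2]) auto
  from tendsto_Re[OF this]
  have lim: "(box_avg (\<lambda>x. Re (\<Prod>k<N. of_bool (sawtooth (forcing k x) \<in> B (Suc k)))) \<longlongrightarrow>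
       (\<Prod>k<N. measure lebesgue (B (Suc k)))) box_filter"
    by (simp add: box_avg_Re[abs_def] flip: of_real_prod)
  have mem: "Re (\<Prod>k<N. of_bool (sawtooth (forcing k x) \<in> B (Suc k))) = of_bool (x \<in> ?A)" for x
  proof -
    have "x \<in> ?A \<longleftrightarrow> (\<forall>k<N. sawtooth (forcing k x) \<in> B (Suc k))"
    proof -
      have "{1..N} = Suc ` {..<N}" by (simp add: lessThan_atLeast0 image_Suc_atLeastLessThan atLeastLessThanSuc_atLeastAtMost)
      then show ?thesis
        unfolding \<open>{1..N} = Suc ` {..<N}\<close> by (auto simp: quantization_error_eq)
    qed
    moreover have "(\<Prod>k<N. of_bool (Q k)) = (of_bool (\<forall>k<N. Q k) :: complex)" for Q and N :: nat
      by (induction N) (auto simp: less_Suc_eq)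
    ultimately show ?thesis by simp
  qed
  have prod: "(\<Prod>k<N. measure lebesgue (B (Suc k))) = (\<Prod>k\<in>{1..N}. measure lebesgue (B k))"
    by (rule prod.reindex_bij_witness[of _ "\<lambda>k. k - 1" Suc]) auto
  show "frequency_measurable ?A" "frequency ?A = (\<Prod>k\<in>{1..N}. measure lebesgue (B k))"
    using frequency_of_mean[of ?A] lim unfolding mem prod by blast+
qed

text \<open>A single error is the joint statement with the whole cell \<open>X\<close> in all other
  slots.\<close>

lemma error_frequency:
  assumes "k \<ge> 1" "B \<subseteq> X" "negligible (frontier B)"
  shows "frequency_measurable (quantization_error R L k -` B)"
    and "frequency (quantization_error R L k -` B) = measure lebesgue B"
proof -
  have X1: "frequency (UNIV :: (int ^ 'n) set) = measure lebesgue X ^ N" for N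
  proof -
    have "(\<Inter>k\<in>{1..N}. quantization_error R L k -` X) = UNIV"
    proof -
      have "quantization_error R L k x \<in> X" if "k \<ge> 1" for k x
        using that sawtooth_in by (cases k) (auto simp: quantization_error_eq)
      then show ?thesis by auto
    qed
    then show ?thesis
      using joint_error_frequency(2)[of N "\<lambda>_. X"] jordan_X(2) by simp
  qed
  \<comment> \<open>Both values of \<open>N\<close> compute the frequency of the full lattice:
    \<open>N = 0\<close> gives the empty product 1, \<open>N = 1\<close> gives the measure of
    \<open>X\<close>.\<close>
  have meas_X: "measure lebesgue X = 1"
    using X1[of 0] X1[of 1] by simp
  define B' where "B' = (\<lambda>j. if j = k then B else X)"
  have B': "B' j \<subseteq> X \<and> negligible (frontier (B' j))" for j
    using assms jordan_X(2) by (auto simp: B'_def)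
  have "(\<Inter>j\<in>{1..k}. quantization_error R L j -` B' j) = quantization_error R L k -` B"
  proof -
    have "quantization_error R L j x \<in> X" if "j \<ge> 1" for j x
      using that sawtooth_in by (cases j) (auto simp: quantization_error_eq)
    then show ?thesis using assms(1) by (auto simp: B'_def split: if_splits)
  qed
  moreover have "(\<Prod>j\<in>{1..k}. measure lebesgue (B' j)) = measure lebesgue B"
    using assms(1) by (simp add: B'_def meas_X if_distrib[of "measure lebesgue"] cong: if_cong)
  ultimately show "frequency_measurable (quantization_error R L k -` B)"
    "frequency (quantization_error R L k -` B) = measure lebesgue B"
    using joint_error_frequency[of k B'] B' by simp_all
qed

end

subsection \<open>Lebesgue measure on a Jordan measurable subspace\<close>

lemma
  assumes "X \<in> sets lebesgue"
  shows sets_lebesgue_borel_on: "sets (lebesgue_borel_on X) = sets (restrict_space borel X)"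
    and space_lebesgue_borel_on: "space (lebesgue_borel_on X) = X"
    and emeasure_lebesgue_borel_on:
      "\<And>B. B \<in> sets (restrict_space borel X) \<Longrightarrow> emeasure (lebesgue_borel_on X) B = emeasure lebesgue B"
proof -
  have sp: "space (restrict_space borel X) = X" by (simp add: space_restrict_space)
  have sub: "sets (restrict_space borel X) \<subseteq> Pow X"
    using sets.space_closed[of "restrict_space borel X"] by (simp add: sp)
  have leb: "sets (restrict_space borel X) \<subseteq> sets lebesgue"
  proof
    fix A assume "A \<in> sets (restrict_space borel X)"
    then obtain C where "C \<in> sets borel" "A = X \<inter> C"
      by (auto simp: sets_restrict_space)
    then show "A \<in> sets lebesgue" using assms by auto
  qed
  show sets: "sets (lebesgue_borel_on X) = sets (restrict_space borel X)"
    using sets.sigma_sets_eq[of "restrict_space borel X"] sub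
    by (simp add: lebesgue_borel_on_def sp sets_measure_of)
  show "space (lebesgue_borel_on X) = X"
    using sub by (simp add: lebesgue_borel_on_def space_measure_of)
  fix B assume B: "B \<in> sets (restrict_space borel X)"
  show "emeasure (lebesgue_borel_on X) B = emeasure lebesgue B"
  proof (rule emeasure_measure_of[OF lebesgue_borel_on_def sub])
    show "B \<in> sets (lebesgue_borel_on X)" using B sets by simp
    show "positive (sets (lebesgue_borel_on X)) (emeasure lebesgue)"
      by (simp add: positive_def)
    show "countably_additive (sets (lebesgue_borel_on X)) (emeasure lebesgue)"
    proof (rule countably_additiveI)
      fix A :: "nat \<Rightarrow> 'a set" assume A: "range A \<subseteq> sets (lebesgue_borel_on X)" "disjoint_family A"
      then show "(\<Sum>i. emeasure lebesgue (A i)) = emeasure lebesgue (\<Union>i. A i)"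
        using leb by (intro suminf_emeasure) (auto simp: sets)
    qed
  qed
qed

text \<open>The boundary relative to \<open>X\<close> and the full frontier differ only inside
  \<open>frontier X\<close>, which is null. This replaces the condition on the relative boundary by
  one that behaves well under translations and \<open>sawtooth\<close>.\<close>

lemma null_top_of_set_frontier_iff:
  assumes X: "bounded X" "negligible (frontier X)" and B: "B \<subseteq> X"
  shows "measure (lebesgue_borel_on X) (top_of_set X frontier_of B) = 0 \<longleftrightarrow> negligible (frontier B)"
proof -
  let ?F = "top_of_set X frontier_of B"
  have lebX: "X \<in> sets lebesgue"
    using measurable_Jordan[OF X] by (rule fmeasurableD)
  have "closedin (top_of_set X) ?F" by (rule closedin_frontier_of)
  then obtain C where C: "closed C" "?F = X \<inter> C" by (auto simp: closedin_closed)
  have F_sets: "?F \<in> sets (restrict_space borel X)"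
    unfolding C(2) using C(1) by (auto simp: sets_restrict_space)
  have F_leb: "?F \<in> sets lebesgue" using lebX C by auto
  have F_sub: "?F \<subseteq> frontier B"
    using frontier_of_subtopology_subset[of X euclidean B] frontier_of_subset_topspace[of "top_of_set X" B] by auto
  have B_sub: "frontier B \<subseteq> frontier X \<union> ?F"
  proof
    fix u assume u: "u \<in> frontier B"
    show "u \<in> frontier X \<union> ?F"
    proof (cases "u \<in> frontier X")
      case False
      have "u \<in> closure X" using u closure_mono[OF B] by (auto simp: frontier_def)
      with False have uX: "u \<in> interior X" by (simp add: frontier_def)
      have "u \<in> top_of_set X closure_of B"
        using u uX interior_subset B by (auto simp: closure_of_subtopology frontier_def Int_absorb1)
      moreover have "u \<notin> top_of_set X interior_of B"
      proof
        assume "u \<in> top_of_set X interior_of B"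
        then obtain T where T: "open T" "u \<in> X \<inter> T" "X \<inter> T \<subseteq> B"
          by (auto simp: interior_of_def openin_open)
        then have "T \<inter> interior X \<subseteq> interior B"
          using interior_subset by (intro interior_maximal) auto
        then show False using u uX T by (auto simp: frontier_def)
      qed
      ultimately show ?thesis by (simp add: frontier_of_def)
    qed simp
  qed
  \<comment> \<open>\<open>measure\<close> is also 0 on sets of infinite measure, so finiteness must
    be known before a null set can be inferred.\<close>
  have fin: "emeasure lebesgue ?F \<noteq> \<infinity>"
  proof -
    have "emeasure lebesgue ?F \<le> emeasure lebesgue X"
      using frontier_of_subset_topspace[of "top_of_set X" B] lebX by (intro emeasure_mono) auto
    then show ?thesis
      using measurable_Jordan[OF X] by (auto simp: fmeasurable_def top_unique)
  qed
  have "measure (lebesgue_borel_on X) ?F = 0 \<longleftrightarrow> emeasure lebesgue ?F = 0"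
    using fin by (simp add: measure_def emeasure_lebesgue_borel_on[OF lebX F_sets] enn2real_eq_0_iff)
  also have "\<dots> \<longleftrightarrow> negligible ?F"
    using F_leb by (simp add: negligible_iff_null_sets null_sets_def)
  also have "\<dots> \<longleftrightarrow> negligible (frontier B)"
    using F_sub B_sub X(2) negligible_subset negligible_Un by metis
  finally show ?thesis .
qed

context quantized_system
begin

lemma X_lebesgue: "X \<in> sets lebesgue"
  using measurable_Jordan[OF jordan_X] by (rule fmeasurableD)

lemma quantization_error_in: "k \<ge> 1 \<Longrightarrow> quantization_error R L k x \<in> X"
  using sawtooth_in by (cases k) (auto simp: quantization_error_eq)

lemma distributed_quantization_error:
  assumes "k \<ge> 1"
  shows "distributed_map X (lebesgue_borel_on X) (quantization_error R L k)"
proof -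
  have "frequency (UNIV :: (int ^ 'n) set) = 1"
    by (rule frequency_of_mean) (simp add: tendsto_box_avg_const)
  moreover have "quantization_error R L k -` X = UNIV"
    using quantization_error_in[OF assms] by auto
  ultimately have 1: "measure lebesgue X = 1"
    using error_frequency(2)[OF assms _ jordan_X(2)] by simp
  have Xs: "X \<in> sets (restrict_space borel X)" by (auto simp: sets_restrict_space)
  \<comment> \<open>Infinite measure would make \<open>measure\<close> equal to 0 instead of
    1.\<close>
  have "emeasure lebesgue X = 1"
    using 1 emeasure_eq_ennreal_measure[of lebesgue X] by (auto simp: measure_def)
  then have "prob_space (lebesgue_borel_on X)"
    by (intro prob_spaceI) (simp only: space_lebesgue_borel_on[OF X_lebesgue] emeasure_lebesgue_borel_on[OF X_lebesgue Xs])
  moreover have "frequency_measurable (quantization_error R L k -` B) \<and>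
      frequency (quantization_error R L k -` B) = measure (lebesgue_borel_on X) B"
    if B: "B \<in> sets (restrict_space borel X)" "measure (lebesgue_borel_on X) (top_of_set X frontier_of B) = 0" for B
  proof -
    have sub: "B \<subseteq> X" using B(1) by (auto simp: sets_restrict_space)
    have "negligible (frontier B)"
      using B(2) null_top_of_set_frontier_iff[OF jordan_X sub] by simp
    moreover have "measure (lebesgue_borel_on X) B = measure lebesgue B"
      by (simp add: measure_def emeasure_lebesgue_borel_on[OF X_lebesgue B(1)])
    ultimately show ?thesis using error_frequency[OF assms sub] by simp
  qed
  ultimately show ?thesis
    using quantization_error_in[OF assms]
    by (simp add: distributed_map_def space_lebesgue_borel_on[OF X_lebesgue] sets_lebesgue_borel_on[OF X_lebesgue])
qed

text \<open>A Jordan measurable set need not be a Borel set, but it can be replaced by one without changing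
  its intersection with the countable range of the error.\<close>

lemma error_algebra_eq:
  "error_algebra R L k = {quantization_error R L k -` B | B. B \<subseteq> X \<and> negligible (frontier B)}"
proof (intro equalityI subsetI)
  fix A assume "A \<in> error_algebra R L k"
  then obtain B where B: "A = quantization_error R L k -` B" "B \<in> sets (restrict_space borel X)"
      "measure (lebesgue_borel_on X) (top_of_set X frontier_of B) = 0"
    by (auto simp: error_algebra_def generated_algebra_def)
  have sub: "B \<subseteq> X" using B(2) by (auto simp: sets_restrict_space)
  then show "A \<in> {quantization_error R L k -` B | B. B \<subseteq> X \<and> negligible (frontier B)}"
    using B null_top_of_set_frontier_iff[OF jordan_X sub] by blast
next
  fix A assume "A \<in> {quantization_error R L k -` B | B. B \<subseteq> X \<and> negligible (frontier B)}"
  then obtain B where B: "A = quantization_error R L k -` B" "B \<subseteq> X" "negligible (frontier B)" by blast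
  define B' where "B' = interior B \<union> (B \<inter> range (quantization_error R L k))"
  have B'_sub: "B' \<subseteq> B" using interior_subset by (auto simp: B'_def)
  have "frontier B' \<subseteq> frontier B"
  proof -
    \<comment> \<open>The interior is kept in \<open>B'\<close> so that passing to the smaller set
      cannot enlarge the frontier.\<close>
    have "interior B \<subseteq> interior B'" by (intro interior_maximal) (auto simp: B'_def)
    then show ?thesis using closure_mono[OF B'_sub] by (auto simp: frontier_def)
  qed
  then have "negligible (frontier B')" using B(3) negligible_subset by blast
  then have 1: "measure (lebesgue_borel_on X) (top_of_set X frontier_of B') = 0"
    using null_top_of_set_frontier_iff[OF jordan_X, of B'] B'_sub B(2) by blast
  have "countable (B \<inter> range (quantization_error R L k))"
    by (rule countable_subset[OF Int_lower2]) (intro countable_image countableI_type)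
  then have "B \<inter> range (quantization_error R L k) \<in> sets borel"
    by (rule sets.countable[rotated]) simp
  then have "B' \<in> sets borel" unfolding B'_def by auto
  then have 2: "B' \<in> sets (restrict_space borel X)"
    using B'_sub B(2) by (auto simp: sets_restrict_space image_iff intro!: bexI[of _ B'])
  have "A = quantization_error R L k -` B'" using B(1) B'_sub by (auto simp: B'_def)
  with 1 2 show "A \<in> error_algebra R L k"
    by (auto simp: error_algebra_def generated_algebra_def)
qed

lemma independent_error_algebras:
  assumes "\<And>k. k \<in> {1..N} \<Longrightarrow> A k \<in> error_algebra R L k"
  shows "frequency_measurable (\<Inter>k\<in>{1..N}. A k)"
    and "frequency (\<Inter>k\<in>{1..N}. A k) = (\<Prod>k\<in>{1..N}. frequency (A k))"
proof -
  have "\<forall>k\<in>{1..N}. \<exists>B. A k = quantization_error R L k -` B \<and> B \<subseteq> X \<and> negligible (frontier B)"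
    using assms unfolding error_algebra_eq by blast
  then obtain B where B: "\<And>k. k \<in> {1..N} \<Longrightarrow> A k = quantization_error R L k -` B k \<and> B k \<subseteq> X \<and> negligible (frontier (B k))"
    by metis
  have eq: "(\<Inter>k\<in>{1..N}. A k) = (\<Inter>k\<in>{1..N}. quantization_error R L k -` B k)"
    using B by (intro INF_cong) auto
  have "(\<Prod>k\<in>{1..N}. frequency (A k)) = (\<Prod>k\<in>{1..N}. measure lebesgue (B k))"
  proof (intro prod.cong refl)
    fix k assume k: "k \<in> {1..N}"
    then have "k \<ge> 1" by simp
    with B[OF k] show "frequency (A k) = measure lebesgue (B k)"
      using error_frequency(2)[of k "B k"] by simp
  qed
  then show "frequency_measurable (\<Inter>k\<in>{1..N}. A k)"
    "frequency (\<Inter>k\<in>{1..N}. A k) = (\<Prod>k\<in>{1..N}. frequency (A k))"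
    using joint_error_frequency[of N B] B unfolding eq by simp_all
qed

end

subsection \<open>Null sets and frontiers in finite products\<close>

text \<open>Places the extensional functions on \<open>I\<close> inside the full function type, so
  that facts about \<open>continuous_on\<close> transfer to the product over \<open>I\<close>.
  Coordinates outside \<open>I\<close> are constantly \<open>undefined\<close>.\<close>

lemma continuous_map_product_to_fun:
  "continuous_map (product_topology (\<lambda>_. euclideanreal) I) euclidean (\<lambda>g. g)"
proof -
  have "continuous_map (product_topology (\<lambda>_. euclideanreal) I) euclideanreal (\<lambda>g. g p)" for p
  proof (cases "p \<in> I")
    case False
    have "continuous_map (product_topology (\<lambda>_. euclideanreal) I) euclideanreal (\<lambda>g. undefined)" by simp
    then show ?thesis
      by (rule continuous_map_eq) (use False in \<open>simp add: PiE_iff extensional_def\<close>)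
  qed (rule continuous_map_product_projection)
  then have "continuous_map (product_topology (\<lambda>_. euclideanreal) I) (product_topology (\<lambda>_. euclideanreal) UNIV) (\<lambda>g. g)"
    by (simp add: continuous_map_componentwise_UNIV)
  then show ?thesis by (simp add: euclidean_product_topology)
qed

lemma measurable_product_to_fun:
  fixes I :: "'i::countable set"
  shows "(\<lambda>g. g) \<in> borel_measurable (Pi\<^sub>M I (\<lambda>_. lborel :: real measure))"
proof (rule measurable_coordinatewise_then_product)
  fix p
  show "(\<lambda>g. g p) \<in> borel_measurable (Pi\<^sub>M I (\<lambda>_. lborel :: real measure))"
  proof (cases "p \<in> I")
    case True
    then have "(\<lambda>g. g p) \<in> measurable (Pi\<^sub>M I (\<lambda>_. lborel :: real measure)) lborel"
      by (rule measurable_component_singleton)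
    then show ?thesis by simp
  next
    case False
    have "(\<lambda>g. undefined :: real) \<in> borel_measurable (Pi\<^sub>M I (\<lambda>_. lborel :: real measure))" by simp
    then show ?thesis
      by (rule measurable_cong[THEN iffD1, rotated]) (use False in \<open>simp add: space_PiM PiE_iff extensional_def\<close>)
  qed
qed

text \<open>Through the retraction \<open>restrict\<close>, \<open>C\<close> is the trace of a
  closed, hence Borel, set of the full function space.\<close>

lemma closedin_product_sets_PiM:
  fixes I :: "'i::countable set"
  assumes "closedin (product_topology (\<lambda>_. euclideanreal) I) C"
  shows "C \<in> sets (Pi\<^sub>M I (\<lambda>_. lborel :: real measure))"
proof -
  have "continuous_map (product_topology (\<lambda>_. euclideanreal) UNIV) (product_topology (\<lambda>_. euclideanreal) I) (\<lambda>f. restrict f I)"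
    by (auto simp: continuous_map_componentwise intro: continuous_map_product_projection)
  then have cont: "continuous_map euclidean (product_topology (\<lambda>_. euclideanreal) I) (\<lambda>f. restrict f I)"
    by (simp add: euclidean_product_topology)
  have "closed {f. restrict f I \<in> C}"
    using closedin_continuous_map_preimage[OF cont assms] by simp
  then have "(\<lambda>g. g) -` {f. restrict f I \<in> C} \<inter> space (Pi\<^sub>M I (\<lambda>_. lborel :: real measure)) \<in> sets (Pi\<^sub>M I (\<lambda>_. lborel))"
    by (intro measurable_sets[OF measurable_product_to_fun] borel_closed)
  also have "(\<lambda>g. g) -` {f. restrict f I \<in> C} \<inter> space (Pi\<^sub>M I (\<lambda>_. lborel :: real measure)) = C"
    using closedin_subset[OF assms] by (auto simp: space_PiM PiE_restrict)
  finally show ?thesis .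
qed

lemma not_in_frontier_of:
  assumes "openin T V" "g \<in> V" "\<And>h. h \<in> V \<Longrightarrow> h \<in> G \<longleftrightarrow> g \<in> G"
  shows "g \<notin> T frontier_of G"
proof (cases "g \<in> G")
  case True
  then have "V \<subseteq> T interior_of G" using assms by (intro interior_of_maximal) blast+
  then show ?thesis using assms(2) by (auto simp: frontier_of_def)
next
  case False
  then have "g \<notin> T closure_of G" using assms unfolding in_closure_of by blast
  then show ?thesis by (simp add: frontier_of_def)
qed

text \<open>The part of a point of the stacked space that stands for \<open>L^j x\<close> modulo
  integer vectors.\<close>

definition block :: "(nat \<times> 'n \<Rightarrow> real) \<Rightarrow> nat \<Rightarrow> real ^ 'n" where
  "block g j = (\<chi> i. g (j, i))"

lemma continuous_on_block: "continuous_on A (\<lambda>g. block g j)"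
  unfolding block_def
  by (intro continuous_on_vec_lambda continuous_on_subset[OF continuous_on_product_coordinates]) auto

lemma measurable_block:
  "(\<lambda>g. block g j) \<in> borel_measurable (Pi\<^sub>M I (\<lambda>_. lborel :: real measure))" for I :: "(nat \<times> 'n::finite) set"
  using measurable_compose[OF measurable_product_to_fun[of I] borel_measurable_continuous_onI[OF continuous_on_block]] by simp

lemma distr_block:
  "distr (Pi\<^sub>M ({j} \<times> UNIV) (\<lambda>_. lborel :: real measure)) borel (\<lambda>g. block g j) = (lborel :: (real ^ 'n) measure)"
proof (rule lborel_eqI[symmetric])
  interpret product_sigma_finite "\<lambda>_. lborel :: real measure" ..
  let ?M = "Pi\<^sub>M ({j} \<times> (UNIV :: 'n set)) (\<lambda>_. lborel :: real measure)"
  fix l u :: "real ^ 'n" assume lu: "\<And>b. b \<in> Basis \<Longrightarrow> l \<bullet> b \<le> u \<bullet> b"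
  have le: "l $ i \<le> u $ i" for i using lu[of "axis i 1"] by (simp add: inner_axis)
  have "emeasure (distr ?M borel (\<lambda>g. block g j)) (box l u) = emeasure ?M ((\<lambda>g. block g j) -` box l u \<inter> space ?M)"
    by (intro emeasure_distr measurable_block) auto
  also have "(\<lambda>g. block g j) -` box l u \<inter> space ?M = (\<Pi>\<^sub>E p\<in>{j} \<times> UNIV. {l $ snd p<..<u $ snd p})"
    by (auto simp: space_PiM block_def mem_box_cart PiE_iff)
  also have "emeasure ?M \<dots> = (\<Prod>p\<in>{j} \<times> UNIV. emeasure lborel {l $ snd p<..<u $ snd p})"
    by (rule emeasure_PiM) auto
  also have "\<dots> = (\<Prod>p\<in>{j} \<times> UNIV. ennreal (u $ snd p - l $ snd p))"
    using le by (intro prod.cong) auto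
  also have "\<dots> = ennreal (\<Prod>p\<in>{j} \<times> UNIV. u $ snd p - l $ snd p)"
    using le by (intro prod_ennreal) auto
  also have "(\<Prod>p\<in>{j} \<times> UNIV. u $ snd p - l $ snd p) = (\<Prod>i\<in>UNIV. u $ i - l $ i)"
    by (rule prod.reindex_bij_witness[of _ "\<lambda>i. (j, i)" snd]) auto
  also have "\<dots> = (\<Prod>b\<in>Basis. (u - l) \<bullet> b)"
  proof -
    have "inj (\<lambda>i::'n. axis i (1::real))" by (rule injI) (simp add: axis_eq_axis)
    then have "(\<Prod>b\<in>range (\<lambda>i::'n. axis i (1::real)). (u - l) \<bullet> b) = (\<Prod>i\<in>UNIV. u $ i - l $ i)"
      by (subst prod.reindex) (simp_all add: inner_axis)
    moreover have "(Basis :: (real ^ 'n) set) = range (\<lambda>i. axis i 1)" by (auto simp: Basis_vec_def)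
    ultimately show ?thesis by metis
  qed
  finally show "emeasure (distr ?M borel (\<lambda>g. block g j)) (box l u) = (\<Prod>b\<in>Basis. (u - l) \<bullet> b)" .
qed simp

lemma null_sets_translate:
  fixes N :: "'a::euclidean_space set"
  assumes "N \<in> null_sets lborel"
  shows "{v. v + c \<in> N} \<in> null_sets lborel"
proof -
  have [measurable]: "N \<in> sets borel" using assms by auto
  have "emeasure lborel N = emeasure (distr lborel borel ((+) c)) N" by (simp add: lborel_distr_plus)
  also have "\<dots> = emeasure lborel ((+) c -` N \<inter> space lborel)" by (rule emeasure_distr) auto
  also have "(+) c -` N \<inter> space lborel = {v. v + c \<in> N}" by (auto simp: add.commute)
  finally have "emeasure lborel {v. v + c \<in> N} = 0" using assms by auto
  moreover have "{v. v + c \<in> N} \<in> sets lborel" by measurable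
  ultimately show ?thesis by (intro null_setsI)
qed

text \<open>Fubini: with all other blocks fixed, the block \<open>j\<close> ranges over a translate of \<open>N\<close>.\<close>

lemma null_sets_block:
  fixes I :: "(nat \<times> 'n::finite) set"
  assumes I: "finite I" "{j} \<times> UNIV \<subseteq> I" and N: "N \<in> null_sets lborel"
    and c: "continuous_on UNIV c" "\<And>g h. (\<And>p. fst p \<noteq> j \<Longrightarrow> g p = h p) \<Longrightarrow> c g = c h"
  shows "{g \<in> space (Pi\<^sub>M I (\<lambda>_. lborel)). block g j + c g \<in> N} \<in> null_sets (Pi\<^sub>M I (\<lambda>_. lborel))"
proof -
  interpret product_sigma_finite "\<lambda>_. lborel :: real measure" ..
  define J where "J = {j} \<times> (UNIV :: 'n set)"
  define I' where "I' = I - J"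
  have I': "I = I' \<union> J" "I' \<inter> J = {}" "finite I'" "finite J"
    using I by (auto simp: I'_def J_def)
  let ?S = "{g \<in> space (Pi\<^sub>M I (\<lambda>_. lborel)). block g j + c g \<in> N}"
  have [measurable]: "N \<in> sets borel" using N by auto
  have cm: "c \<in> borel_measurable (Pi\<^sub>M I (\<lambda>_. lborel))"
    using measurable_compose[OF measurable_product_to_fun[of I] borel_measurable_continuous_onI[OF c(1)]] by simp
  have "(\<lambda>g. block g j + c g) -` N \<inter> space (Pi\<^sub>M I (\<lambda>_. lborel)) \<in> sets (Pi\<^sub>M I (\<lambda>_. lborel))"
    by (intro measurable_sets[of _ _ borel] borel_measurable_add cm measurable_block) simp
  also have "(\<lambda>g. block g j + c g) -` N \<inter> space (Pi\<^sub>M I (\<lambda>_. lborel)) = ?S" by auto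
  finally have S: "?S \<in> sets (Pi\<^sub>M I (\<lambda>_. lborel))" .
  have inner: "(\<integral>\<^sup>+y. indicator ?S (merge I' J (x, y)) \<partial>Pi\<^sub>M J (\<lambda>_. lborel)) = 0"
    if x: "x \<in> space (Pi\<^sub>M I' (\<lambda>_. lborel))" for x
  proof -
    \<comment> \<open>\<open>c\<close> ignores the block \<open>j\<close>, so the filler 0 in its
      place may be arbitrary.\<close>
    define c0 where "c0 = c (merge I' J (x, \<lambda>_. 0))"
    define N0 where "N0 = {v. v + c0 \<in> N}"
    have N0: "N0 \<in> null_sets lborel" unfolding N0_def by (rule null_sets_translate[OF N])
    have "(\<integral>\<^sup>+y. indicator ?S (merge I' J (x, y)) \<partial>Pi\<^sub>M J (\<lambda>_. lborel))
        = (\<integral>\<^sup>+y. indicator ((\<lambda>y. block y j) -` N0 \<inter> space (Pi\<^sub>M J (\<lambda>_. lborel))) y \<partial>Pi\<^sub>M J (\<lambda>_. lborel))"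
    proof (rule nn_integral_cong)
      fix y assume y: "y \<in> space (Pi\<^sub>M J (\<lambda>_. lborel :: real measure))"
      have sp: "merge I' J (x, y) \<in> space (Pi\<^sub>M I (\<lambda>_. lborel))"
        using x y unfolding I'(1) by (auto simp: space_PiM)
      have "block (merge I' J (x, y)) j = block y j"
        using I'(2) by (auto simp: block_def merge_def J_def vec_eq_iff)
      moreover have "c (merge I' J (x, y)) = c0"
        unfolding c0_def by (rule c(2)) (auto simp: merge_def J_def)
      ultimately show "indicator ?S (merge I' J (x, y)) = (indicator ((\<lambda>y. block y j) -` N0 \<inter> space (Pi\<^sub>M J (\<lambda>_. lborel))) y :: ennreal)"
        using sp y by (simp add: N0_def indicator_def)
    qed
    also have "\<dots> = emeasure (Pi\<^sub>M J (\<lambda>_. lborel)) ((\<lambda>y. block y j) -` N0 \<inter> space (Pi\<^sub>M J (\<lambda>_. lborel)))"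
      using N0 by (intro nn_integral_indicator measurable_sets[OF measurable_block]) auto
    also have "\<dots> = emeasure (distr (Pi\<^sub>M J (\<lambda>_. lborel)) borel (\<lambda>y. block y j)) N0"
      using N0 by (intro emeasure_distr[symmetric] measurable_block) auto
    also have "\<dots> = 0" using N0 by (simp add: J_def distr_block null_setsD1)
    finally show ?thesis .
  qed
  have "emeasure (Pi\<^sub>M I (\<lambda>_. lborel)) ?S = (\<integral>\<^sup>+g. indicator ?S g \<partial>Pi\<^sub>M I (\<lambda>_. lborel))"
    using S by (rule nn_integral_indicator[symmetric])
  also have "\<dots> = (\<integral>\<^sup>+x. \<integral>\<^sup>+y. indicator ?S (merge I' J (x, y)) \<partial>Pi\<^sub>M J (\<lambda>_. lborel) \<partial>Pi\<^sub>M I' (\<lambda>_. lborel))"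
    using S unfolding I'(1) by (intro product_nn_integral_fold I') auto
  also have "\<dots> = 0"
    using inner by (simp cong: nn_integral_cong)
  finally show ?thesis using S by (intro null_setsI)
qed

subsection \<open>Errors as quasiperiodic functions\<close>

context quantized_system
begin

text \<open>The orbit of \<open>x\<close> in terms of \<open>w j = L\<^sup>j x\<close> (\<open>j \<ge> 1\<close>), with \<open>w 0 = 0\<close>: the integer vectors
  \<open>torus_orbit w j\<close> are \<open>T\<^sup>j x\<close>, and translating the \<open>w j\<close> by integer vectors translates them alike.\<close>

fun torus_orbit :: "(nat \<Rightarrow> real ^ 'n) \<Rightarrow> nat \<Rightarrow> int ^ 'n" where
  "torus_orbit w 0 = 0"
| "torus_orbit w (Suc j) = R (w (Suc j) + L *v (of_int_vec (torus_orbit w j) - w j))"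

definition torus_forcing :: "(nat \<Rightarrow> real ^ 'n) \<Rightarrow> nat \<Rightarrow> real ^ 'n" where
  "torus_forcing w j = w (Suc j) + L *v (of_int_vec (torus_orbit w j) - w j)"

lemma torus_orbit_Suc: "torus_orbit w (Suc j) = R (torus_forcing w j)"
  by (simp add: torus_forcing_def)

lemma torus_orbit_shift:
  assumes "\<And>j. j \<le> J \<Longrightarrow> w' j = w j + of_int_vec (\<zeta> j)" "\<zeta> 0 = 0" "j \<le> J"
  shows "torus_orbit w' j = torus_orbit w j + \<zeta> j"
  using assms(3)
proof (induction j)
  case (Suc j)
  have "w' (Suc j) + L *v (of_int_vec (torus_orbit w' j) - w' j) =
      w (Suc j) + L *v (of_int_vec (torus_orbit w j) - w j) + of_int_vec (\<zeta> (Suc j))"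
    using Suc by (simp add: assms(1) of_int_vec_add)
  then show ?case by (simp add: R_add)
qed (simp add: assms(2))

lemma torus_forcing_shift:
  assumes "\<And>j. j \<le> Suc J \<Longrightarrow> w' j = w j + of_int_vec (\<zeta> j)" "\<zeta> 0 = 0"
  shows "torus_forcing w' J = torus_forcing w J + of_int_vec (\<zeta> (Suc J))"
  using torus_orbit_shift[of "Suc J" w' w \<zeta> J] assms
  by (simp add: torus_forcing_def of_int_vec_add)

text \<open>The orbit starts at \<open>x\<close>, whereas \<open>torus_orbit\<close> and
  \<open>w\<close> start at 0. Only their difference enters the first step, and it is 0 either way;
  this is why \<open>j = 0\<close> is set apart in the induction.\<close>

lemma torus_forcing_orbit:
  "torus_forcing (\<lambda>j. if j = 0 then 0 else mat_pow L j *v of_int_vec x) J = forcing J x"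
proof -
  let ?w = "\<lambda>j. if j = 0 then 0 else mat_pow L j *v of_int_vec x"
  have step: "torus_forcing ?w j = forcing j x" if "j = 0 \<or> torus_orbit ?w j = (T ^^ j) x" for j
  proof (cases j)
    case 0
    then show ?thesis by (simp add: torus_forcing_def forcing_def mat_pow_Suc mat_pow_0)
  next
    case (Suc i)
    then show ?thesis using that
      by (simp add: torus_forcing_def forcing_def mat_pow_Suc[of L "Suc i"] matrix_vector_mult_diff_distrib matrix_vector_mul_assoc del: torus_orbit.simps)
  qed
  have "j = 0 \<or> torus_orbit ?w j = (T ^^ j) x" for j
  proof (induction j)
    case (Suc j)
    show ?case
      by (simp only: torus_orbit_Suc step[OF Suc] forcing_def funpow.simps o_apply transition_def[of R L "(T ^^ j) x"])
         simp
  qed simp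
  then show ?thesis by (rule step)
qed

definition blocks :: "(nat \<times> 'n \<Rightarrow> real) \<Rightarrow> nat \<Rightarrow> real ^ 'n" where
  "blocks g j = (if j = 0 then 0 else block g j)"

definition error_region :: "nat \<Rightarrow> (real ^ 'n) set \<Rightarrow> (nat \<times> 'n \<Rightarrow> real) set" where
  "error_region J B = {g \<in> {1..Suc J} \<times> UNIV \<rightarrow>\<^sub>E {0..<1}. sawtooth (torus_forcing (blocks g) J) \<in> B}"

lemma inner_row_mat_pow: "row i (mat_pow L j) \<bullet> v = (mat_pow L j *v v) $ i"
  by (simp add: row_def matrix_vector_mul_component)

text \<open>A representative of \<open>(L x, ..., L^(J+1) x)\<close> in the unit cube differs from
  it by integer vectors. These shift the forcing by an integer vector, which \<open>sawtooth\<close>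
  does not see.\<close>

lemma quasiperiodic_error_region:
  "quasiperiodic_set ({1..Suc J} \<times> UNIV) (error_region J B) (\<lambda>(j, i). row i (mat_pow L j))
     = quantization_error R L (Suc J) -` B"
proof (intro set_eqI iffI)
  fix x
  let ?w = "\<lambda>j. if j = 0 then 0 else mat_pow L j *v of_int_vec x"
  {
    assume "x \<in> quasiperiodic_set ({1..Suc J} \<times> UNIV) (error_region J B) (\<lambda>(j, i). row i (mat_pow L j))"
    then obtain g z where g: "g \<in> error_region J B"
      and z: "\<forall>p\<in>{1..Suc J} \<times> UNIV. (case p of (j, i) \<Rightarrow> row i (mat_pow L j)) \<bullet> of_int_vec x = g p + of_int (z p :: int)"
      unfolding quasiperiodic_set_def by blast
    define \<zeta> where "\<zeta> = (\<lambda>j. if j = 0 then 0 else (\<chi> i. z (j, i)))"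
    have "?w j = blocks g j + of_int_vec (\<zeta> j)" if "j \<le> Suc J" for j
      using z that by (auto simp: blocks_def block_def \<zeta>_def vec_eq_iff inner_row_mat_pow)
    then have "torus_forcing ?w J = torus_forcing (blocks g) J + of_int_vec (\<zeta> (Suc J))"
      by (rule torus_forcing_shift) (simp_all add: \<zeta>_def)
    then show "x \<in> quantization_error R L (Suc J) -` B"
      using g by (simp add: torus_forcing_orbit quantization_error_eq error_region_def)
  }
  {
    assume x: "x \<in> quantization_error R L (Suc J) -` B"
    define z where "z = (\<lambda>(j, i). \<lfloor>(mat_pow L j *v of_int_vec x) $ i\<rfloor>)"
    define g where "g = restrict (\<lambda>(j, i). frac ((mat_pow L j *v of_int_vec x) $ i)) ({1..Suc J} \<times> UNIV)"
    define \<zeta> where "\<zeta> = (\<lambda>j. if j = 0 then 0 else (\<chi> i. z (j, i)))"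
    have "?w j = blocks g j + of_int_vec (\<zeta> j)" if "j \<le> Suc J" for j
      using that by (auto simp: blocks_def block_def \<zeta>_def vec_eq_iff g_def z_def frac_def)
    then have "torus_forcing ?w J = torus_forcing (blocks g) J + of_int_vec (\<zeta> (Suc J))"
      by (rule torus_forcing_shift) (simp_all add: \<zeta>_def)
    then have "sawtooth (torus_forcing (blocks g) J) \<in> B"
      using x by (simp add: torus_forcing_orbit quantization_error_eq)
    moreover have "g \<in> {1..Suc J} \<times> UNIV \<rightarrow>\<^sub>E {0..<1}"
      by (auto simp: g_def frac_lt_1)
    ultimately have "g \<in> error_region J B" by (simp add: error_region_def)
    then show "x \<in> quasiperiodic_set ({1..Suc J} \<times> UNIV) (error_region J B) (\<lambda>(j, i). row i (mat_pow L j))"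
      unfolding quasiperiodic_set_def
      by (intro CollectI bexI[of _ g] exI[of _ z]) (auto simp: g_def z_def frac_def inner_row_mat_pow)
  }
qed

text \<open>Fixing the integer vectors visited makes the forcing affine in the coordinates.\<close>

definition frozen_forcing :: "int ^ 'n \<Rightarrow> nat \<Rightarrow> (nat \<times> 'n \<Rightarrow> real) \<Rightarrow> real ^ 'n" where
  "frozen_forcing z j g = block g (Suc j) + L *v (of_int_vec z - blocks g j)"

lemma frozen_forcing_eq: "frozen_forcing (torus_orbit (blocks g) j) j g = torus_forcing (blocks g) j"
  by (simp add: frozen_forcing_def torus_forcing_def blocks_def)

lemma continuous_on_blocks: "continuous_on A (\<lambda>g. blocks g j)"
  unfolding blocks_def by (cases "j = 0") (simp_all add: continuous_on_block)

lemma continuous_on_frozen_shift: "continuous_on A (\<lambda>g. L *v (of_int_vec z - blocks g j))"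
  by (rule continuous_on_compose2[OF matrix_vector_mult_linear_continuous_on[of UNIV L]])
     (intro continuous_intros continuous_on_blocks subset_UNIV)+

lemma continuous_on_frozen_forcing: "continuous_on A (frozen_forcing z j)"
  unfolding frozen_forcing_def by (intro continuous_intros continuous_on_block continuous_on_frozen_shift)

text \<open>\<open>z\<close> runs over all integer vectors, so the set is a countable union of
  affine preimages that no longer refers to the orbit of \<open>g\<close>. The coordinate values 0
  and 1 account for the faces of the cube.\<close>

definition exceptional_set :: "nat \<Rightarrow> (real ^ 'n) set \<Rightarrow> (nat \<times> 'n \<Rightarrow> real) set" where
  "exceptional_set J B = {g \<in> {1..Suc J} \<times> UNIV \<rightarrow>\<^sub>E UNIV.
     (\<exists>p\<in>{1..Suc J} \<times> UNIV. g p = 0 \<or> g p = 1) \<or> (\<exists>j\<le>J. \<exists>z. frozen_forcing z j g \<in> error_jumps B)}"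

lemma frontier_error_region:
  "product_topology (\<lambda>_. euclideanreal) ({1..Suc J} \<times> UNIV) frontier_of (error_region J B) \<subseteq> exceptional_set J B"
proof
  let ?I = "{1..Suc J} \<times> (UNIV :: 'n set)"
  let ?T = "product_topology (\<lambda>_. euclideanreal) ?I"
  fix g assume g: "g \<in> ?T frontier_of (error_region J B)"
  show "g \<in> exceptional_set J B"
  proof (rule ccontr)
    assume *: "g \<notin> exceptional_set J B"
    have g_in: "g \<in> ?I \<rightarrow>\<^sub>E UNIV"
      using g frontier_of_subset_topspace[of ?T] by auto
    define r where "r = torus_orbit (blocks g)"
    have good: "\<forall>\<^sub>F v in nhds (torus_forcing (blocks g) j). (R v, sawtooth v \<in> B) =
        (R (torus_forcing (blocks g) j), sawtooth (torus_forcing (blocks g) j) \<in> B)" if "j \<le> J" for j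
    proof -
      have "torus_forcing (blocks g) j \<notin> error_jumps B"
        using * g_in that unfolding exceptional_set_def frozen_forcing_eq[of g j, symmetric] by blast
      then show ?thesis by (simp add: error_jumps_def jump_set_def)
    qed
    have "\<forall>j. \<exists>S. j \<le> J \<longrightarrow> open S \<and> torus_forcing (blocks g) j \<in> S \<and> (\<forall>v\<in>S. (R v, sawtooth v \<in> B) =
        (R (torus_forcing (blocks g) j), sawtooth (torus_forcing (blocks g) j) \<in> B))"
      using good unfolding eventually_nhds by blast
    then obtain S where S: "\<And>j. j \<le> J \<Longrightarrow> open (S j)" "\<And>j. j \<le> J \<Longrightarrow> torus_forcing (blocks g) j \<in> S j"
      "\<And>j v. j \<le> J \<Longrightarrow> v \<in> S j \<Longrightarrow> (R v, sawtooth v \<in> B) =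
        (R (torus_forcing (blocks g) j), sawtooth (torus_forcing (blocks g) j) \<in> B)"
      by metis
    \<comment> \<open>No coordinate of \<open>g\<close> is 0 or 1, so each lies in one of these two
      open sets, and membership in [0, 1) is constant on either.\<close>
    define U where "U = (\<lambda>p. if g p \<in> {0<..<1} then {0<..<1} else - {0..1 :: real})"
    define V' where "V' = (\<Inter>p\<in>?I. {h. h p \<in> U p}) \<inter> (\<Inter>j\<in>{..J}. frozen_forcing (r j) j -` S j)"
    have "open V'"
      unfolding V'_def
    proof (intro open_Int open_INT ballI)
      fix p
      have "open (U p)" by (auto simp: U_def intro!: open_Compl)
      then have "open ((\<lambda>h :: nat \<times> 'n \<Rightarrow> real. h p) -` U p)"
        by (rule open_vimage) (rule continuous_on_product_coordinates)
      then show "open {h :: nat \<times> 'n \<Rightarrow> real. h p \<in> U p}" by (simp add: vimage_def)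
    next
      fix j assume "j \<in> {..J}"
      then show "open (frozen_forcing (r j) j -` S j)"
        using S(1) by (intro open_vimage continuous_on_frozen_forcing) auto
    qed auto
    then have "openin ?T {h \<in> topspace ?T. h \<in> V'}"
      using openin_continuous_map_preimage[OF continuous_map_product_to_fun[of ?I], of V'] by simp
    moreover have "g \<in> {h \<in> topspace ?T. h \<in> V'}"
    proof -
      have "g p \<in> U p" if "p \<in> ?I" for p
        using * g_in that by (force simp: U_def exceptional_set_def)
      then show ?thesis
        using g_in S(2) by (auto simp: V'_def r_def frozen_forcing_eq)
    qed
    moreover have "h \<in> error_region J B \<longleftrightarrow> g \<in> error_region J B" if h: "h \<in> {h \<in> topspace ?T. h \<in> V'}" for h
    proof -
      have SV: "frozen_forcing (r j) j h \<in> S j" if "j \<le> J" for j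
        using h that by (auto simp: V'_def)
      have orb: "torus_orbit (blocks h) j = r j" if "j \<le> J" for j
        using that
      proof (induction j)
        case (Suc j)
        then have IH: "torus_orbit (blocks h) j = r j" by simp
        have "torus_forcing (blocks h) j \<in> S j"
          using SV[of j] Suc.prems frozen_forcing_eq[of h j] by (simp add: IH)
        then have "R (torus_forcing (blocks h) j) = R (torus_forcing (blocks g) j)"
          using S(3)[of j] Suc.prems by simp
        then show ?case by (simp only: r_def torus_orbit_Suc)
      qed (simp add: r_def)
      have "torus_forcing (blocks h) J \<in> S J"
        using SV[of J] frozen_forcing_eq[of h J] by (simp add: orb)
      then have "sawtooth (torus_forcing (blocks h) J) \<in> B \<longleftrightarrow> sawtooth (torus_forcing (blocks g) J) \<in> B"
        using S(3)[of J] by simp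
      moreover have "h \<in> ?I \<rightarrow>\<^sub>E {0..<1} \<longleftrightarrow> g \<in> ?I \<rightarrow>\<^sub>E {0..<1}"
      proof -
        have "h p \<in> {0..<1} \<longleftrightarrow> g p \<in> {0..<1}" if "p \<in> ?I" for p
        proof -
          have "h p \<in> U p" using h that by (auto simp: V'_def)
          moreover have "g p \<noteq> 0" using * g_in that by (auto simp: exceptional_set_def)
          ultimately show ?thesis by (auto simp: U_def split: if_splits)
        qed
        moreover have "h \<in> ?I \<rightarrow>\<^sub>E UNIV" using h by simp
        ultimately show ?thesis using g_in by (simp add: PiE_iff)
      qed
      ultimately show ?thesis by (simp add: error_region_def)
    qed
    ultimately have "g \<notin> ?T frontier_of (error_region J B)"
      by (rule not_in_frontier_of)
    with g show False by contradiction
  qed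
qed

text \<open>In \<open>frozen_forcing z j\<close> the block \<open>Suc j\<close> is a free summand
  and the rest depends on block \<open>j\<close> alone, which is the shape that
  \<open>null_sets_block\<close> asks for. The faces of the cube are hyperplanes in one
  block.\<close>

lemma null_exceptional_set:
  assumes "negligible (frontier B)"
  shows "exceptional_set J B \<in> null_sets (Pi\<^sub>M ({1..Suc J} \<times> UNIV) (\<lambda>_. lborel))"
proof -
  let ?I = "{1..Suc J} \<times> (UNIV :: 'n set)"
  let ?M = "Pi\<^sub>M ?I (\<lambda>_. lborel :: real measure)"
  have "{g \<in> space ?M. g p = a} \<in> null_sets ?M" if "p \<in> ?I" for p a
  proof -
    obtain j i where p: "p = (j, i)" by (cases p)
    have "negligible {v :: real ^ 'n. v \<bullet> axis i 1 = a}"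
      by (rule negligible_standard_hyperplane) (auto simp: Basis_vec_def)
    moreover have "closed {v :: real ^ 'n. v \<bullet> axis i 1 = a}"
      by (intro closed_Collect_eq continuous_intros)
    ultimately have "{v :: real ^ 'n. v \<bullet> axis i 1 = a} \<in> null_sets lborel"
      by (simp add: negligible_iff_null_sets null_sets_completion_iff borel_closed)
    moreover have "finite ?I" "{j} \<times> UNIV \<subseteq> ?I" using that p by auto
    ultimately have "{g \<in> space ?M. block g j + 0 \<in> {v. v \<bullet> axis i 1 = a}} \<in> null_sets ?M"
      by (intro null_sets_block continuous_on_const) auto
    then
    show ?thesis by (simp add: p block_def inner_axis)
  qed
  moreover have "{g \<in> space ?M. frozen_forcing z j g \<in> error_jumps B} \<in> null_sets ?M" if "j \<le> J" for z j
    unfolding frozen_forcing_def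
    using that by (intro null_sets_block null_error_jumps assms continuous_on_frozen_shift)
      (auto simp: blocks_def block_def)
  ultimately have "(\<Union>p\<in>?I. {g \<in> space ?M. g p = 0} \<union> {g \<in> space ?M. g p = 1}) \<union>
      (\<Union>j\<in>{..J}. \<Union>z. {g \<in> space ?M. frozen_forcing z j g \<in> error_jumps B}) \<in> null_sets ?M"
    by (intro null_sets.Un null_sets_UN') auto
  also have "(\<Union>p\<in>?I. {g \<in> space ?M. g p = 0} \<union> {g \<in> space ?M. g p = 1}) \<union>
      (\<Union>j\<in>{..J}. \<Union>z. {g \<in> space ?M. frozen_forcing z j g \<in> error_jumps B}) = exceptional_set J B"
    by (auto simp: exceptional_set_def space_PiM)
  finally show ?thesis .
qed

lemma quantization_error_vimage_in_forward_algebra: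
  assumes "negligible (frontier B)"
  shows "quantization_error R L (Suc J) -` B \<in> forward_algebra L (Suc J)"
proof -
  let ?I = "{1..Suc J} \<times> (UNIV :: 'n set)"
  have "product_topology (\<lambda>_. euclideanreal) ?I frontier_of error_region J B \<in> null_sets (Pi\<^sub>M ?I (\<lambda>_. lborel))"
    by (rule null_sets_subset[OF null_exceptional_set[OF assms] _ frontier_error_region])
       (intro closedin_product_sets_PiM closedin_frontier_of)
  moreover have sub: "error_region J B \<subseteq> ?I \<rightarrow>\<^sub>E {0..<1}" by (auto simp: error_region_def)
  moreover have "\<exists>c. \<forall>u\<in>error_region J B. \<forall>p\<in>?I. \<bar>u p\<bar> \<le> c"
  proof (intro exI ballI)
    fix u p assume "u \<in> error_region J B" "p \<in> ?I"
    then have "u p \<in> {0..<1}" using sub by (blast intro: PiE_mem)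
    then show "\<bar>u p\<bar> \<le> 1" by simp
  qed
  ultimately have "jordan_measurable_in ?I (error_region J B)"
    unfolding jordan_measurable_in_def using PiE_mono[of ?I "\<lambda>_. {0..<1::real}" "\<lambda>_. UNIV"] by blast
  then show ?thesis
    unfolding forward_algebra_def quasiperiodic_algebra_def
    using sub quasiperiodic_error_region[of J B] by blast
qed

section \<open>From quasiperiodic sets of \<open>L\<close> back to sets of errors\<close>

lemma homeomorphic_block:
  "homeomorphic_map (product_topology (\<lambda>_. euclideanreal) ({j} \<times> UNIV)) euclidean (\<lambda>g. block g j :: real ^ 'n)"
  unfolding homeomorphic_map_maps homeomorphic_maps_def
proof (intro exI[of _ "\<lambda>v. restrict (\<lambda>(_, i). v $ i) ({j} \<times> UNIV)"] conjI ballI)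
  let ?T = "product_topology (\<lambda>_. euclideanreal) ({j} \<times> (UNIV :: 'n set))"
  show "continuous_map ?T euclidean (\<lambda>g. block g j :: real ^ 'n)"
    using continuous_map_compose[OF continuous_map_product_to_fun, of euclidean "\<lambda>g. block g j" "{j} \<times> UNIV"]
      continuous_on_block[of UNIV j] by (simp add: o_def)
  show "continuous_map euclidean ?T (\<lambda>v::real ^ 'n. restrict (\<lambda>(_, i). v $ i) ({j} \<times> UNIV))"
    unfolding continuous_map_componentwise by (auto intro!: continuous_intros)
qed (auto simp: block_def vec_eq_iff PiE_iff extensional_def fun_eq_iff)

text \<open>\<open>block\<close> is a homeomorphism and carries the product measure to Lebesgue
  measure, so the frontier of the image is the image of the frontier and remains null.\<close>

lemma negligible_frontier_block_image:
  assumes "jordan_measurable_in ({j} \<times> UNIV) G"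
  shows "negligible (frontier ((\<lambda>g. block g j) ` G :: (real ^ 'n) set))"
proof -
  let ?I = "{j} \<times> (UNIV :: 'n set)"
  let ?T = "product_topology (\<lambda>_. euclideanreal) ?I"
  let ?M = "Pi\<^sub>M ?I (\<lambda>_. lborel :: real measure)"
  have G: "G \<subseteq> topspace ?T" and null: "?T frontier_of G \<in> null_sets ?M"
    using assms by (simp_all add: jordan_measurable_in_def)
  let ?F = "frontier ((\<lambda>g. block g j) ` G :: (real ^ 'n) set)"
  have eq: "?F = (\<lambda>g. block g j) ` (?T frontier_of G)"
    using homeomorphic_map_frontier_of[OF homeomorphic_block G] by simp
  have inj: "inj_on (\<lambda>g. block g j :: real ^ 'n) (topspace ?T)"
    using homeomorphic_block by (rule homeomorphic_imp_injective_map)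
  have "emeasure lborel ?F = emeasure (distr ?M borel (\<lambda>g. block g j)) ?F"
    by (simp add: distr_block)
  also have "\<dots> = emeasure ?M ((\<lambda>g. block g j) -` ?F \<inter> space ?M)"
    by (intro emeasure_distr measurable_block) (simp add: borel_closed)
  also have "(\<lambda>g. block g j) -` ?F \<inter> space ?M = ?T frontier_of G"
  proof -
    have "?T frontier_of G \<subseteq> space ?M"
      using frontier_of_subset_topspace[of ?T G] by (simp add: space_PiM)
    moreover have "inj_on (\<lambda>g. block g j :: real ^ 'n) (space ?M)"
      using inj by (simp add: space_PiM)
    ultimately show ?thesis unfolding eq inj_on_def by blast
  qed
  also have "emeasure ?M \<dots> = 0" using null by (rule null_setsD1)
  finally have "?F \<in> null_sets lborel" by (intro null_setsI) (simp_all add: borel_closed)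
  then show ?thesis by (simp add: negligible_iff_null_sets null_sets_completionI)
qed

text \<open>The unit cube and \<open>X\<close> are both fundamental domains of the integer lattice.
  \<open>B\<close> is \<open>G'\<close> cut into pieces and moved into \<open>X\<close>; boundedness
  leaves finitely many translates, so the frontier of their union lies in the union of the
  frontiers.\<close>

lemma forward_algebra_1_subset:
  assumes "A \<in> forward_algebra L 1"
  shows "\<exists>B. B \<subseteq> X \<and> negligible (frontier B) \<and> A = quantization_error R L (Suc 0) -` B"
proof -
  let ?I = "{1::nat} \<times> (UNIV :: 'n set)"
  obtain G where A: "A = quasiperiodic_set ?I G (\<lambda>(k, i). row i (mat_pow L k))"
    and G: "G \<subseteq> ?I \<rightarrow>\<^sub>E {0..<1}" and J: "jordan_measurable_in ?I G"
    using assms by (auto simp: forward_algebra_def quasiperiodic_algebra_def)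
  define G' where "G' = ((\<lambda>g. block g 1) ` G :: (real ^ 'n) set)"
  have G'_cube: "G' \<subseteq> unit_cube"
    using G by (force simp: G'_def unit_cube_def block_def)
  have L1: "mat_pow L (Suc 0) = L" by (simp add: mat_pow_def)
  have A_iff: "x \<in> A \<longleftrightarrow> (\<exists>z. L *v of_int_vec x - of_int_vec z \<in> G')" for x
  proof
    assume "x \<in> A"
    then obtain g and z :: "nat \<times> 'n \<Rightarrow> int" where g: "g \<in> G"
      and z: "\<forall>p\<in>?I. (case p of (k, i) \<Rightarrow> row i (mat_pow L k)) \<bullet> of_int_vec x = g p + of_int (z p)"
      unfolding A quasiperiodic_set_def by blast
    have "L *v of_int_vec x - of_int_vec (\<chi> i. z (1, i)) = block g 1"
      using z inner_row_mat_pow[of _ 1] by (simp add: vec_eq_iff block_def L1)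
    then show "\<exists>z. L *v of_int_vec x - of_int_vec z \<in> G'"
      using g unfolding G'_def by blast
  next
    assume "\<exists>z. L *v of_int_vec x - of_int_vec z \<in> G'"
    then obtain z g where g: "g \<in> G" "L *v of_int_vec x - of_int_vec z = block g 1"
      unfolding G'_def by blast
    have "(L *v of_int_vec x) $ i = g (1, i) + of_int (z $ i)" for i
      using arg_cong[OF g(2), of "\<lambda>v. v $ i"] by (simp add: block_def)
    then show "x \<in> A"
      unfolding A quasiperiodic_set_def using g(1) inner_row_mat_pow[of _ 1]
      by (intro CollectI bexI[of _ g] exI[of _ "\<lambda>p. z $ snd p"]) (auto simp: L1)
  qed
  obtain c where c: "\<And>u. u \<in> X \<Longrightarrow> norm u \<le> c"
    using jordan_X(1) by (auto simp: bounded_iff)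
  \<comment> \<open>A relevant \<open>z\<close> is a difference of a point of \<open>X\<close>, of
    norm at most \<open>c\<close>, and a point of the unit cube.\<close>
  define Z where "Z = {z :: int ^ 'n. norm (of_int_vec z) \<le> c + real CARD('n)}"
  have Z: "finite Z" unfolding Z_def by (rule finite_bounded_int_vec)
  define B where "B = X \<inter> (\<Union>z\<in>Z. (+) (of_int_vec z) ` G')"
  have "negligible (frontier B)"
  proof -
    have "frontier B \<subseteq> frontier X \<union> frontier (\<Union>z\<in>Z. (+) (of_int_vec z) ` G')"
      unfolding B_def by (rule frontier_Int_subset)
    also have "frontier (\<Union>z\<in>Z. (+) (of_int_vec z) ` G') \<subseteq> (\<Union>z\<in>Z. frontier ((+) (of_int_vec z) ` G'))"
      using frontier_of_Union_subset[of "(\<lambda>z. (+) (of_int_vec z) ` G') ` Z" euclidean] Z by simp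
    finally have "frontier B \<subseteq> frontier X \<union> (\<Union>z\<in>Z. (+) (of_int_vec z) ` frontier G')"
      by (auto simp: frontier_translation)
    moreover have "negligible (frontier X \<union> (\<Union>z\<in>Z. (+) (of_int_vec z) ` frontier G'))"
      using Z jordan_X(2) negligible_frontier_block_image[OF J]
      by (intro negligible_Un negligible_Union finite_imageI)
         (auto simp: G'_def intro: negligible_translation)
    ultimately show ?thesis by (rule negligible_subset[rotated])
  qed
  moreover have "A = quantization_error R L (Suc 0) -` B"
  proof (intro set_eqI)
    fix x
    have E: "quantization_error R L (Suc 0) x = L *v of_int_vec x - of_int_vec (T x)"
      by (simp add: quantization_error_def)
    have EX: "quantization_error R L (Suc 0) x \<in> X" by (rule quantization_error_in) simp
    show "x \<in> A \<longleftrightarrow> x \<in> quantization_error R L (Suc 0) -` B"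
    proof
      assume "x \<in> A"
      then obtain z where z: "L *v of_int_vec x - of_int_vec z \<in> G'" using A_iff by blast
      have eq: "quantization_error R L (Suc 0) x = of_int_vec (z - T x) + (L *v of_int_vec x - of_int_vec z)"
        by (simp add: E of_int_vec_diff)
      have "norm (of_int_vec (z - T x)) = norm (quantization_error R L (Suc 0) x - (L *v of_int_vec x - of_int_vec z))"
        by (simp add: eq)
      also have "\<dots> \<le> norm (quantization_error R L (Suc 0) x) + norm (L *v of_int_vec x - of_int_vec z)"
        by (rule norm_triangle_ineq4)
      also have "\<dots> \<le> c + real CARD('n)"
        using c[OF EX] norm_unit_cube_le z G'_cube by (intro add_mono) auto
      finally have "z - T x \<in> Z" by (simp add: Z_def)
      then show "x \<in> quantization_error R L (Suc 0) -` B"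
        using z EX unfolding B_def vimage_eq eq by blast
    next
      assume "x \<in> quantization_error R L (Suc 0) -` B"
      then obtain z g where "g \<in> G'" "quantization_error R L (Suc 0) x = of_int_vec z + g"
        by (auto simp: B_def)
      then have "L *v of_int_vec x - of_int_vec (T x + z) \<in> G'"
        by (simp add: E of_int_vec_add algebra_simps)
      then show "x \<in> A" using A_iff by blast
    qed
  qed
  ultimately show ?thesis by (intro exI[of _ B]) (auto simp: B_def)
qed

lemma quantization_error_vimage:
  "quantization_error R L (Suc J) -` B = (T ^^ J) -` (quantization_error R L (Suc 0) -` B)"
  by (auto simp: quantization_error_def)

text \<open>Since the later errors are the first error composed with powers of \<open>T\<close>,
  only the first one has to be compared with \<open>forward_algebra L 1\<close>.\<close>

lemma error_algebra_eq_forward: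
  "error_algebra R L (Suc J) = (\<lambda>A. (T ^^ J) -` A) ` forward_algebra L 1"
proof (intro equalityI subsetI)
  fix A assume "A \<in> error_algebra R L (Suc J)"
  then obtain B where B: "A = quantization_error R L (Suc J) -` B" "negligible (frontier B)"
    unfolding error_algebra_eq by blast
  have "quantization_error R L (Suc 0) -` B \<in> forward_algebra L 1"
    using quantization_error_vimage_in_forward_algebra[OF B(2), of 0] by simp
  then show "A \<in> (\<lambda>A. (T ^^ J) -` A) ` forward_algebra L 1"
    unfolding B(1) quantization_error_vimage[of J B] by (rule imageI)
next
  fix A assume "A \<in> (\<lambda>A. (T ^^ J) -` A) ` forward_algebra L 1"
  then obtain A' where A: "A = (T ^^ J) -` A'" "A' \<in> forward_algebra L 1" by blast
  from forward_algebra_1_subset[OF A(2)] obtain B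
    where B: "B \<subseteq> X" "negligible (frontier B)" "A' = quantization_error R L (Suc 0) -` B" by blast
  have "A = quantization_error R L (Suc J) -` B"
    unfolding A(1) B(3) by (rule quantization_error_vimage[of J B, symmetric])
  then show "A \<in> error_algebra R L (Suc J)"
    unfolding error_algebra_eq using B(1,2) by blast
qed

lemma error_algebra_subset_forward: "error_algebra R L (Suc J) \<subseteq> forward_algebra L (Suc J)"
  unfolding error_algebra_eq using quantization_error_vimage_in_forward_algebra by blast

end

theorem theorem10:
  fixes R :: "real ^ 'n \<Rightarrow> int ^ 'n" and L :: "real ^ 'n ^ 'n"
  assumes "quantizer R" and "invertible L" and "iteratively_nonresonant L"
  shows "(\<forall>k\<ge>1.
            distributed_map (R -` {0}) (lebesgue_borel_on (R -` {0})) (quantization_error R L k)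
          \<and> error_algebra R L k
              = (\<lambda>A. (transition R L ^^ (k - 1)) -` A) ` forward_algebra L 1
          \<and> (\<lambda>A. (transition R L ^^ (k - 1)) -` A) ` forward_algebra L 1
              \<subseteq> forward_algebra L k)
       \<and> (\<forall>N\<ge>1. \<forall>A :: nat \<Rightarrow> (int ^ 'n) set.
            (\<forall>k\<in>{1..N}. A k \<in> error_algebra R L k) \<longrightarrow>
              frequency_measurable (\<Inter>k\<in>{1..N}. A k)
            \<and> frequency (\<Inter>k\<in>{1..N}. A k) = (\<Prod>k\<in>{1..N}. frequency (A k)))"
proof -
  interpret quantized_system R L using assms by unfold_locales
  show ?thesis
  proof (intro conjI allI impI)
    fix k :: nat assume k: "1 \<le> k"
    show "distributed_map X (lebesgue_borel_on X) (quantization_error R L k)"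
      by (rule distributed_quantization_error[OF k])
    from k obtain J where J: "k = Suc J" by (cases k) auto
    show alg: "error_algebra R L k = (\<lambda>A. (T ^^ (k - 1)) -` A) ` forward_algebra L 1"
      using error_algebra_eq_forward[of J] by (simp add: J)
    show "(\<lambda>A. (T ^^ (k - 1)) -` A) ` forward_algebra L 1 \<subseteq> forward_algebra L k"
      unfolding alg[symmetric] using error_algebra_subset_forward[of J] by (simp add: J)
  next
    fix N :: nat and A :: "nat \<Rightarrow> (int ^ 'n) set"
    assume "\<forall>k\<in>{1..N}. A k \<in> error_algebra R L k"
    then have A: "\<And>k. k \<in> {1..N} \<Longrightarrow> A k \<in> error_algebra R L k" by (rule bspec)
    show "frequency_measurable (\<Inter>k\<in>{1..N}. A k)"
      by (rule independent_error_algebras(1)[OF A])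
    show "frequency (\<Inter>k\<in>{1..N}. A k) = (\<Prod>k\<in>{1..N}. frequency (A k))"
      by (rule independent_error_algebras(2)[OF A])
  qed
qed

end
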